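(* Let $(M,g,\mathcal{F},J^Q)$ and $(M',g',\mathcal{F}',J^{Q'})$ be transversely almost Hermitian foliated manifolds such that $(M,g,\mathcal{F},J^Q)$ is transversely cosymplectic and $(M',g',\mathcal{F}',J^{Q'})$ is transversely $(1,2)$-symplectic. Then any transversely holomorphic map $\phi:M\to M'$ is transversely harmonic.
   Context: A foliated Riemannian manifold $(M,g,\mathcal{F})$ is a manifold with a Riemannian foliation $\mathcal{F}$ and a bundle-like metric $g$; equivalently, $\mathcal{F}$ is given by local Riemannian submersions with connected fibres $f_i:U_i\to T$ onto open subsets of a Riemannian manifold $(T,\bar g)$ with transition maps that are local isometries. $Q=TM/T\mathcal{F}$ is the normal bundle, $g_Q$ the induced metric on it (locally $f_i^*\bar g$), and $\nabla$ the normal Levi-Civita connection on $Q$ (locally the pull-back by $f_i$ of the Levi-Civita connection of $\bar g$). A tensor on $Q$ is foliated if locally it is the pull-back by $f_i$ of a tensor on $T$. Transversely almost Hermitian: $Q$ carries a foliated $J=J^Q$ with $J^2=-\mathrm{Id}$, $g_Q(JX,JY)=g_Q(X,Y)$. Write $Q^{\mathbb{C}}=Q^{1,0}\oplus Q^{0,1}$ ($\pm i$ eigenbundles of $J$), $Q^{2,0}=\bigwedge^2Q^{1,0}$, $Q^{0,2}=\bigwedge^2Q^{0,1}$. The fundamental 2-vector $F\in\Gamma(\bigwedge^2Q)$ is defined by $g_Q(F,X\wedge Y)=g_Q(JX,Y)$. Identifying $Q^*$ with $Q$ by $g_Q$, the derivative of $F$ in normal directions is a section $\nabla F$ of $(Q\otimes\bigwedge^2Q)^{\mathbb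 C}$ and decomposes as $\nabla F=D_1F+D_2F$ with $D_1F\in (Q^{1,0}\otimes Q^{2,0})\oplus(Q^{0,1}\otimes Q^{0,2})$ and $D_2F\in(Q^{1,0}\otimes Q^{0,2})\oplus(Q^{0,1}\otimes Q^{2,0})$. The foliation is transversely $(1,2)$-symplectic if $D_2F=0$ and transversely cosymplectic if $\mathrm{tr}(D_2F)=0$, where $\mathrm{tr}$ is the $g_Q$-contraction of the derivative slot with the 2-vector, with values in $Q^{\mathbb C}$. A map $\phi:(M,\mathcal{F})\to(M',\mathcal{F}')$ is foliated if it is smooth and maps leaves into leaves; $\phi^T_*:Q\to\phi^{-1}Q'$ is the map induced by the differential on normal bundles. A transversely holomorphic map is a smooth foliated map with $\phi^T_*\circ J^Q=J^{Q'}\circ\phi^T_*$. The transverse tension field is $\tau_b(\phi)=\mathrm{tr}_Q\tilde\nabla\phi^T_*$, where $\tilde\nabla$ is the connection on $Q^*\otimes\phi^{-1}Q'$ induced by the normal Levi-Civita connections and the trace is taken over a local $g_Q$-orthonormal frame of $Q$; $\phi$ is transversely harmonic if $\tau_b(\phi)=0$. *)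

theory Defs
  imports "HOL-Analysis.Analysis"
begin

section \<open>Smooth manifolds\<close>

text \<open>\<open>C^k\<close> functions on an open set, by iterated directional derivatives.\<close>

fun Ck_on :: "nat \<Rightarrow> ('e::real_normed_vector \<Rightarrow> 'f::real_normed_vector) \<Rightarrow> 'e set \<Rightarrow> bool" where
  "Ck_on 0 f S \<longleftrightarrow> continuous_on S f"
| "Ck_on (Suc k) f S \<longleftrightarrow> (\<forall>y\<in>S. f differentiable at y) \<and>
     (\<forall>v. Ck_on k (\<lambda>y. frechet_derivative f (at y) v) S)"

definition smooth_on :: "('e::real_normed_vector \<Rightarrow> 'f::real_normed_vector) \<Rightarrow> 'e set \<Rightarrow> bool" where
  "smooth_on f S \<longleftrightarrow> (\<forall>k. Ck_on k f S)"

text \<open>A chart is a pair of its domain and its coordinate map. The atlas need not be maximal.\<close>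

record ('a, 'e) manifold =
  mtop :: "'a topology"
  atlas :: "('a set \<times> ('a \<Rightarrow> 'e)) set"

definition chart_inv :: "'a set \<times> ('a \<Rightarrow> 'e) \<Rightarrow> 'e \<Rightarrow> 'a" where
  "chart_inv C = inv_into (fst C) (snd C)"

definition is_chart :: "'a topology \<Rightarrow> 'a set \<times> ('a \<Rightarrow> 'e::euclidean_space) \<Rightarrow> bool" where
  "is_chart X C \<longleftrightarrow> openin X (fst C) \<and> open (snd C ` fst C) \<and>
     homeomorphic_map (subtopology X (fst C)) (top_of_set (snd C ` fst C)) (snd C)"

definition smooth_manifold :: "('a, 'e::euclidean_space, 'z) manifold_scheme \<Rightarrow> bool" where
  "smooth_manifold M \<longleftrightarrow>
     Hausdorff_space (mtop M) \<and> second_countable (mtop M) \<and>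
     (\<forall>C\<in>atlas M. is_chart (mtop M) C) \<and>
     (\<Union>C\<in>atlas M. fst C) = topspace (mtop M) \<and>
     (\<forall>C\<in>atlas M. \<forall>D\<in>atlas M. smooth_on (snd D \<circ> chart_inv C) (snd C ` (fst C \<inter> fst D)))"

definition smooth_map ::
  "('a, 'e::euclidean_space, 'z) manifold_scheme \<Rightarrow> ('b, 'f::euclidean_space, 'y) manifold_scheme \<Rightarrow>
   'a set \<Rightarrow> ('a \<Rightarrow> 'b) \<Rightarrow> bool" where
  "smooth_map M N U f \<longleftrightarrow> openin (mtop M) U \<and>
     continuous_map (subtopology (mtop M) U) (mtop N) f \<and>
     (\<forall>C\<in>atlas M. \<forall>D\<in>atlas N.
        smooth_on (snd D \<circ> f \<circ> chart_inv C) (snd C ` (U \<inter> fst C \<inter> f -` fst D)))"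

text \<open>
  The tangent space at \<open>x\<close> is the model space \<open>'e\<close>: a tangent vector is given by its components
  in a chart selected at \<open>x\<close>. Hence the components of one vector in two charts at \<open>x\<close> are
  related by the differential of the change of charts, and a vector field is a function
  \<open>'a \<Rightarrow> 'e\<close> whose value at \<open>x\<close> refers to the chart selected at \<open>x\<close>.
\<close>

definition chart_at :: "('a, 'e, 'z) manifold_scheme \<Rightarrow> 'a \<Rightarrow> 'a set \<times> ('a \<Rightarrow> 'e)" where
  "chart_at M x = (SOME C. C \<in> atlas M \<and> x \<in> fst C)"

definition coord :: "('a, 'e, 'z) manifold_scheme \<Rightarrow> 'a \<Rightarrow> 'a \<Rightarrow> 'e" where
  "coord M x = snd (chart_at M x)"

definition coord_inv :: "('a, 'e, 'z) manifold_scheme \<Rightarrow> 'a \<Rightarrow> 'e \<Rightarrow> 'a" where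
  "coord_inv M x = chart_inv (chart_at M x)"

text \<open>Derivative at \<open>x\<close>, along the tangent vector \<open>v\<close>, of a vector-valued function.\<close>

definition dir_deriv ::
  "('a, 'e::euclidean_space, 'z) manifold_scheme \<Rightarrow> ('a \<Rightarrow> 'v::real_normed_vector) \<Rightarrow> 'a \<Rightarrow> 'e \<Rightarrow> 'v" where
  "dir_deriv M h x v = frechet_derivative (h \<circ> coord_inv M x) (at (coord M x x)) v"

text \<open>The differential \<open>T\<^sub>xM \<rightarrow> T\<^sub>f\<^sub>(\<^sub>x\<^sub>)N\<close> of a map.\<close>

definition tangent_map ::
  "('a, 'e::euclidean_space, 'z) manifold_scheme \<Rightarrow> ('b, 'f::euclidean_space, 'y) manifold_scheme \<Rightarrow>
   ('a \<Rightarrow> 'b) \<Rightarrow> 'a \<Rightarrow> 'e \<Rightarrow> 'f" where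
  "tangent_map M N f x v = dir_deriv M (coord N (f x) \<circ> f) x v"

text \<open>Components in the chart \<open>C\<close> of a vector at \<open>x\<close>, and the vector at the point with
  coordinates \<open>y\<close> that has given components in \<open>C\<close>.\<close>

definition chart_deriv ::
  "('a, 'e::euclidean_space, 'z) manifold_scheme \<Rightarrow> 'a set \<times> ('a \<Rightarrow> 'e) \<Rightarrow> 'a \<Rightarrow> 'e \<Rightarrow> 'e" where
  "chart_deriv M C x v = dir_deriv M (snd C) x v"

definition chart_lift ::
  "('a, 'e::euclidean_space, 'z) manifold_scheme \<Rightarrow> 'a set \<times> ('a \<Rightarrow> 'e) \<Rightarrow> 'e \<Rightarrow> 'e \<Rightarrow> 'e" where
  "chart_lift M C y u =
     frechet_derivative (coord M (chart_inv C y) \<circ> chart_inv C) (at y) u"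

text \<open>The extension of a tangent vector at \<open>x\<close> to the vector field on the domain of the chart
  selected at \<open>x\<close> that has constant components in that chart.\<close>

definition const_ext ::
  "('a, 'e::euclidean_space, 'z) manifold_scheme \<Rightarrow> 'a \<Rightarrow> 'e \<Rightarrow> 'a \<Rightarrow> 'e" where
  "const_ext M x w p = chart_lift M (chart_at M x) (coord M x p) w"

text \<open>Smooth fields of endomorphisms of the tangent spaces over an open set \<open>V\<close>.\<close>

definition smooth_endo_field ::
  "('a, 'e::euclidean_space, 'z) manifold_scheme \<Rightarrow> 'a set \<Rightarrow> ('a \<Rightarrow> 'e \<Rightarrow> 'e) \<Rightarrow> bool" where
  "smooth_endo_field M V K \<longleftrightarrow> openin (mtop M) V \<and> (\<forall>p\<in>V. linear (K p)) \<and>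
     (\<forall>C\<in>atlas M. \<forall>u.
        smooth_on (\<lambda>y. chart_deriv M C (chart_inv C y) (K (chart_inv C y) (chart_lift M C y u)))
          (snd C ` (V \<inter> fst C)))"


section \<open>Riemannian manifolds\<close>

record ('a, 'e) riem = "('a, 'e) manifold" +
  metric :: "'a \<Rightarrow> 'e \<Rightarrow> 'e \<Rightarrow> real"

definition metric_in_chart ::
  "('a, 'e::euclidean_space, 'z) riem_scheme \<Rightarrow> 'a set \<times> ('a \<Rightarrow> 'e) \<Rightarrow> 'e \<Rightarrow> 'e \<Rightarrow> 'e \<Rightarrow> real" where
  "metric_in_chart M C y u v =
     metric M (chart_inv C y) (chart_lift M C y u) (chart_lift M C y v)"

definition riemannian_manifold :: "('a, 'e::euclidean_space, 'z) riem_scheme \<Rightarrow> bool" where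
  "riemannian_manifold M \<longleftrightarrow> smooth_manifold M \<and>
     (\<forall>x\<in>topspace (mtop M). bilinear (metric M x) \<and>
        (\<forall>u v. metric M x u v = metric M x v u) \<and> (\<forall>v. v \<noteq> 0 \<longrightarrow> metric M x v v > 0)) \<and>
     (\<forall>C\<in>atlas M. \<forall>u v. smooth_on (\<lambda>y. metric_in_chart M C y u v) (snd C ` fst C))"

text \<open>The Levi-Civita connection in a chart: the Christoffel symbols as the bilinear map
  \<open>(u, w) \<mapsto> \<Gamma>(u, w)\<close>, by the Koszul formula for vector fields with constant components.\<close>

definition christoffel ::
  "('a, 'e::euclidean_space, 'z) riem_scheme \<Rightarrow> 'a set \<times> ('a \<Rightarrow> 'e) \<Rightarrow> 'e \<Rightarrow> 'e \<Rightarrow> 'e \<Rightarrow> 'e" where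
  "christoffel M C y u w = (THE \<gamma>. \<forall>z.
     2 * metric_in_chart M C y \<gamma> z =
       frechet_derivative (\<lambda>y. metric_in_chart M C y w z) (at y) u
     + frechet_derivative (\<lambda>y. metric_in_chart M C y u z) (at y) w
     - frechet_derivative (\<lambda>y. metric_in_chart M C y u w) (at y) z)"

text \<open>The pull-back by \<open>f : M \<rightarrow> N\<close> of the Levi-Civita connection of \<open>N\<close>: for a section \<open>s\<close> of
  \<open>f\<^sup>-\<^sup>1TN\<close> near \<open>x\<close> and \<open>v \<in> T\<^sub>xM\<close>, the value in \<open>T\<^sub>f\<^sub>(\<^sub>x\<^sub>)N\<close> of the
  covariant derivative of \<open>s\<close> along \<open>v\<close>. Components are taken in the chart selected at \<open>f x\<close>.\<close>

definition pullback_lc ::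
  "('a, 'e::euclidean_space, 'z) manifold_scheme \<Rightarrow> ('b, 'f::euclidean_space, 'y) riem_scheme \<Rightarrow>
   ('a \<Rightarrow> 'b) \<Rightarrow> ('a \<Rightarrow> 'f) \<Rightarrow> 'a \<Rightarrow> 'e \<Rightarrow> 'f" where
  "pullback_lc M N f s x v =
     dir_deriv M (\<lambda>p. chart_deriv N (chart_at N (f x)) (f p) (s p)) x v +
     christoffel N (chart_at N (f x)) (coord N (f x) (f x)) (tangent_map M N f x v) (s x)"


section \<open>Foliated Riemannian manifolds\<close>

text \<open>The foliation is given by a cocycle of pairs \<open>(U, f)\<close> with \<open>f\<close> a submersion of \<open>U\<close> into
  the Riemannian manifold \<open>model S\<close>.\<close>

record ('a, 'e, 't, 'q) foliated = "('a, 'e) riem" +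
  model :: "('t, 'q) riem"
  cocycle :: "('a set \<times> ('a \<Rightarrow> 't)) set"

definition riemannian_submersion ::
  "('a, 'e::euclidean_space, 'z) riem_scheme \<Rightarrow> ('b, 'f::euclidean_space, 'y) riem_scheme \<Rightarrow>
   'a set \<Rightarrow> ('a \<Rightarrow> 'b) \<Rightarrow> bool" where
  "riemannian_submersion M N U f \<longleftrightarrow> smooth_map M N U f \<and>
     (\<forall>x\<in>U. surj (tangent_map M N f x) \<and>
       (\<forall>v w. (\<forall>t. tangent_map M N f x t = 0 \<longrightarrow> metric M x v t = 0 \<and> metric M x w t = 0) \<longrightarrow>
          metric N (f x) (tangent_map M N f x v) (tangent_map M N f x w) = metric M x v w))"

definition local_isometry ::
  "('a, 'e::euclidean_space, 'z) riem_scheme \<Rightarrow> 'a set \<Rightarrow> ('a \<Rightarrow> 'a) \<Rightarrow> bool" where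
  "local_isometry M V \<gamma> \<longleftrightarrow> smooth_map M M V \<gamma> \<and>
     (\<forall>y\<in>V. \<forall>u w. metric M (\<gamma> y) (tangent_map M M \<gamma> y u) (tangent_map M M \<gamma> y w) = metric M y u w)"

definition foliated_riemannian ::
  "('a, 'e::euclidean_space, 't, 'q::euclidean_space, 'z) foliated_scheme \<Rightarrow> bool" where
  "foliated_riemannian S \<longleftrightarrow> riemannian_manifold S \<and> riemannian_manifold (model S) \<and>
     (\<Union>(U, f)\<in>cocycle S. U) = topspace (mtop S) \<and>
     (\<forall>(U, f)\<in>cocycle S. riemannian_submersion S (model S) U f \<and>
        openin (mtop (model S)) (f ` U) \<and>
        (\<forall>x\<in>U. connectedin (mtop S) {p \<in> U. f p = f x})) \<and>
     (\<forall>(U, f)\<in>cocycle S. \<forall>(V, h)\<in>cocycle S. \<exists>\<gamma>.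
        local_isometry (model S) (f ` (U \<inter> V)) \<gamma> \<and> (\<forall>x\<in>U \<inter> V. h x = \<gamma> (f x)))"

text \<open>The connected fibres of the submersions are the plaques; a leaf consists of all points that
  can be reached from one of them by a finite chain of plaques.\<close>

definition same_plaque :: "('a, 'e, 't, 'q, 'z) foliated_scheme \<Rightarrow> ('a \<times> 'a) set" where
  "same_plaque S = {(x, y). \<exists>(U, f)\<in>cocycle S. x \<in> U \<and> y \<in> U \<and> f x = f y}"

definition leaf :: "('a, 'e, 't, 'q, 'z) foliated_scheme \<Rightarrow> 'a \<Rightarrow> 'a set" where
  "leaf S x = {y. (x, y) \<in> (same_plaque S)\<^sup>*}"

definition leaf_tangent ::
  "('a, 'e::euclidean_space, 't, 'q::euclidean_space, 'z) foliated_scheme \<Rightarrow> 'a \<Rightarrow> 'e set" where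
  "leaf_tangent S x =
     {v. \<forall>(U, f)\<in>cocycle S. x \<in> U \<longrightarrow> tangent_map S (model S) f x v = 0}"


section \<open>The normal bundle\<close>

text \<open>
  The fibre of \<open>Q\<close> at \<open>x\<close> is the quotient of the tangent space by \<open>leaf_tangent S x\<close>. Below,
  elements and sections of \<open>Q\<close> are denoted by representing tangent vectors and vector fields;
  two vectors \<open>v\<close>, \<open>w\<close> denote the same element of the quotient iff
  \<open>normal_class S x v = normal_class S x w\<close>. Maps between normal spaces are
  likewise represented by maps between tangent spaces.
\<close>

definition normal_class ::
  "('a, 'e::euclidean_space, 't, 'q::euclidean_space, 'z) foliated_scheme \<Rightarrow> 'a \<Rightarrow> 'e \<Rightarrow> 'e set" where
  "normal_class S x v = {v + t | t. t \<in> leaf_tangent S x}"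

definition horizontal ::
  "('a, 'e::euclidean_space, 't, 'q::euclidean_space, 'z) foliated_scheme \<Rightarrow> 'a \<Rightarrow> 'e \<Rightarrow> 'e" where
  "horizontal S x v =
     (THE h. h \<in> normal_class S x v \<and> (\<forall>t\<in>leaf_tangent S x. metric S x h t = 0))"

definition gQ ::
  "('a, 'e::euclidean_space, 't, 'q::euclidean_space, 'z) foliated_scheme \<Rightarrow> 'a \<Rightarrow> 'e \<Rightarrow> 'e \<Rightarrow> real" where
  "gQ S x v w = metric S x (horizontal S x v) (horizontal S x w)"

text \<open>The trace over a \<open>gQ\<close>-orthonormal basis of the normal space (which has dimension
  \<open>DIM('q)\<close>) of a bilinear map on the normal space.\<close>

definition normal_frame ::
  "('a, 'e::euclidean_space, 't, 'q::euclidean_space, 'z) foliated_scheme \<Rightarrow> 'a \<Rightarrow> nat \<Rightarrow> 'e" where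
  "normal_frame S x =
     (SOME e. \<forall>a<DIM('q). \<forall>b<DIM('q). gQ S x (e a) (e b) = (if a = b then 1 else 0))"

definition normal_trace ::
  "('a, 'e::euclidean_space, 't, 'q::euclidean_space, 'z) foliated_scheme \<Rightarrow> 'a \<Rightarrow>
   ('e \<Rightarrow> 'e \<Rightarrow> 'v::comm_monoid_add) \<Rightarrow> 'v" where
  "normal_trace S x B = (\<Sum>a<DIM('q). B (normal_frame S x a) (normal_frame S x a))"

definition submersion_at :: "('a, 'e, 't, 'q, 'z) foliated_scheme \<Rightarrow> 'a \<Rightarrow> 'a \<Rightarrow> 't" where
  "submersion_at S x = (SOME f. \<exists>U. (U, f) \<in> cocycle S \<and> x \<in> U)"

text \<open>
  The pull-back by \<open>\<psi> : N \<rightarrow> M\<close> of the normal Levi-Civita connection: a section \<open>s\<close> of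
  \<open>\<psi>\<^sup>-\<^sup>1Q\<close> is identified, through the differential of a submersion \<open>f\<close> of the cocycle at
  \<open>\<psi> z\<close>, with a section of \<open>(f \<circ> \<psi>)\<^sup>-\<^sup>1TT\<close>, and differentiated there. As \<open>df\<close> has
  kernel \<open>leaf_tangent\<close>, the result is well defined as an element of the normal space at \<open>\<psi> z\<close>;
  it depends neither on the submersion nor on the representatives. For \<open>\<psi> = id\<close> this is the
  normal Levi-Civita connection itself.
\<close>

definition normal_conn_along ::
  "('c, 'd::euclidean_space, 'y) manifold_scheme \<Rightarrow>
   ('a, 'e::euclidean_space, 't, 'q::euclidean_space, 'z) foliated_scheme \<Rightarrow>
   ('c \<Rightarrow> 'a) \<Rightarrow> ('c \<Rightarrow> 'e) \<Rightarrow> 'c \<Rightarrow> 'd \<Rightarrow> 'e" where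
  "normal_conn_along N S \<psi> s z v = (let f = submersion_at S (\<psi> z) in
     SOME w. tangent_map S (model S) f (\<psi> z) w =
       pullback_lc N (model S) (f \<circ> \<psi>) (\<lambda>p. tangent_map S (model S) f (\<psi> p) (s p)) z v)"

definition normal_conn ::
  "('a, 'e::euclidean_space, 't, 'q::euclidean_space, 'z) foliated_scheme \<Rightarrow>
   ('a \<Rightarrow> 'e) \<Rightarrow> 'a \<Rightarrow> 'e \<Rightarrow> 'e" where
  "normal_conn S = normal_conn_along S S (\<lambda>p. p)"


section \<open>Transversely almost Hermitian foliations\<close>

record ('a, 'e, 't, 'q) trans_hermitian = "('a, 'e, 't, 'q) foliated" +
  acs :: "'a \<Rightarrow> 'e \<Rightarrow> 'e"

text \<open>A family of endomorphisms of the normal spaces that is locally the pull-back by the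
  submersions of the cocycle of a smooth field of endomorphisms on the model.\<close>

definition foliated_endo ::
  "('a, 'e::euclidean_space, 't, 'q::euclidean_space, 'z) foliated_scheme \<Rightarrow>
   ('a \<Rightarrow> 'e \<Rightarrow> 'e) \<Rightarrow> bool" where
  "foliated_endo S J \<longleftrightarrow> (\<forall>(U, f)\<in>cocycle S. \<forall>x\<in>U. \<exists>W K.
     openin (mtop S) W \<and> x \<in> W \<and> W \<subseteq> U \<and> smooth_endo_field (model S) (f ` W) K \<and>
     (\<forall>p\<in>W. \<forall>v. tangent_map S (model S) f p (J p v) = K (f p) (tangent_map S (model S) f p v)))"

definition transversely_almost_hermitian ::
  "('a, 'e::euclidean_space, 't, 'q::euclidean_space, 'z) trans_hermitian_scheme \<Rightarrow> bool" where
  "transversely_almost_hermitian S \<longleftrightarrow> foliated_riemannian S \<and>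
     foliated_endo S (acs S) \<and>
     (\<forall>x\<in>topspace (mtop S). linear (acs S x) \<and> acs S x ` leaf_tangent S x \<subseteq> leaf_tangent S x \<and>
        (\<forall>v. normal_class S x (acs S x (acs S x v)) = normal_class S x (- v)) \<and>
        (\<forall>v w. gQ S x (acs S x v) (acs S x w) = gQ S x v w))"

text \<open>
  Identifying \<open>Q\<close> with its dual by \<open>gQ\<close>, a tensor \<open>t\<close> of order \<open>k\<close> on \<open>Q\<close>, possibly with complex
  coefficients, is represented by the multilinear map \<open>(X\<^sub>1, ..., X\<^sub>k) \<mapsto> gQ(t, X\<^sub>1 \<otimes> ... \<otimes> X\<^sub>k)\<close>,
  where \<open>gQ\<close> is extended complex bilinearly. For 2-vectors the pairing is
  \<open>gQ(v \<and> w, Y \<and> Z) = gQ(v, Y) gQ(w, Z) - gQ(v, Z) gQ(w, Y)\<close>.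
\<close>

definition fundamental ::
  "('a, 'e::euclidean_space, 't, 'q::euclidean_space, 'z) trans_hermitian_scheme \<Rightarrow>
   'a \<Rightarrow> 'e \<Rightarrow> 'e \<Rightarrow> real" where
  "fundamental S x Y Z = gQ S x (acs S x Y) Z"

text \<open>The derivative of the fundamental 2-vector; the first slot is the derivative slot. Being
  tensorial, it may be evaluated on arbitrary extensions of \<open>Y\<close> and \<open>Z\<close>.\<close>

definition nabla_fundamental ::
  "('a, 'e::euclidean_space, 't, 'q::euclidean_space, 'z) trans_hermitian_scheme \<Rightarrow>
   'a \<Rightarrow> 'e \<Rightarrow> 'e \<Rightarrow> 'e \<Rightarrow> real" where
  "nabla_fundamental S x X Y Z =
     dir_deriv S (\<lambda>p. fundamental S p (const_ext S x Y p) (const_ext S x Z p)) x X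
     - fundamental S x (normal_conn S (const_ext S x Y) x X) Z
     - fundamental S x Y (normal_conn S (const_ext S x Z) x X)"

text \<open>Elements of the complexification of the normal space: \<open>(a, b)\<close> stands for \<open>a + i b\<close>.\<close>

definition Q10 ::
  "('a, 'e::euclidean_space, 't, 'q::euclidean_space, 'z) trans_hermitian_scheme \<Rightarrow> 'a \<Rightarrow> ('e \<times> 'e) set" where
  "Q10 S x = {(a, b). normal_class S x (acs S x a) = normal_class S x (- b) \<and>
                      normal_class S x (acs S x b) = normal_class S x a}"

definition Q01 ::
  "('a, 'e::euclidean_space, 't, 'q::euclidean_space, 'z) trans_hermitian_scheme \<Rightarrow> 'a \<Rightarrow> ('e \<times> 'e) set" where
  "Q01 S x = {(a, b). normal_class S x (acs S x a) = normal_class S x b \<and>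
                      normal_class S x (acs S x b) = normal_class S x (- a)}"

definition gQ_C ::
  "('a, 'e::euclidean_space, 't, 'q::euclidean_space, 'z) foliated_scheme \<Rightarrow>
   'a \<Rightarrow> 'e \<times> 'e \<Rightarrow> 'e \<Rightarrow> complex" where
  "gQ_C S x u X = Complex (gQ S x (fst u) X) (gQ S x (snd u) X)"

text \<open>For complex subspaces \<open>A\<close>, \<open>B\<close> of the complexified normal space, the tensors
  in \<open>A \<otimes> \<Lambda>\<^sup>2B\<close>, that is, the sums of elements \<open>u \<otimes> (v \<and> w)\<close>.\<close>

definition tensor_wedge ::
  "('a, 'e::euclidean_space, 't, 'q::euclidean_space, 'z) foliated_scheme \<Rightarrow> 'a \<Rightarrow>
   ('e \<times> 'e) set \<Rightarrow> ('e \<times> 'e) set \<Rightarrow> ('e \<Rightarrow> 'e \<Rightarrow> 'e \<Rightarrow> complex) set" where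
  "tensor_wedge S x A B =
     {\<lambda>X Y Z. \<Sum>k<n. gQ_C S x (u k) X *
         (gQ_C S x (v k) Y * gQ_C S x (w k) Z - gQ_C S x (v k) Z * gQ_C S x (w k) Y)
      | (n::nat) u v w. \<forall>k<n. u k \<in> A \<and> v k \<in> B \<and> w k \<in> B}"

definition tensor_sum ::
  "('e \<Rightarrow> 'e \<Rightarrow> 'e \<Rightarrow> complex) set \<Rightarrow> ('e \<Rightarrow> 'e \<Rightarrow> 'e \<Rightarrow> complex) set \<Rightarrow>
   ('e \<Rightarrow> 'e \<Rightarrow> 'e \<Rightarrow> complex) set" where
  "tensor_sum A B = {\<lambda>X Y Z. s X Y Z + t X Y Z | s t. s \<in> A \<and> t \<in> B}"

definition D2_fundamental ::
  "('a, 'e::euclidean_space, 't, 'q::euclidean_space, 'z) trans_hermitian_scheme \<Rightarrow>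
   'a \<Rightarrow> 'e \<Rightarrow> 'e \<Rightarrow> 'e \<Rightarrow> complex" where
  "D2_fundamental S x = (THE D2.
     D2 \<in> tensor_sum (tensor_wedge S x (Q10 S x) (Q01 S x)) (tensor_wedge S x (Q01 S x) (Q10 S x)) \<and>
     (\<exists>D1\<in>tensor_sum (tensor_wedge S x (Q10 S x) (Q10 S x)) (tensor_wedge S x (Q01 S x) (Q01 S x)).
        \<forall>X Y Z. complex_of_real (nabla_fundamental S x X Y Z) = D1 X Y Z + D2 X Y Z))"

definition transversely_12_symplectic ::
  "('a, 'e::euclidean_space, 't, 'q::euclidean_space, 'z) trans_hermitian_scheme \<Rightarrow> bool" where
  "transversely_12_symplectic S \<longleftrightarrow>
     (\<forall>x\<in>topspace (mtop S). \<forall>X Y Z. D2_fundamental S x X Y Z = 0)"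

definition transversely_cosymplectic ::
  "('a, 'e::euclidean_space, 't, 'q::euclidean_space, 'z) trans_hermitian_scheme \<Rightarrow> bool" where
  "transversely_cosymplectic S \<longleftrightarrow>
     (\<forall>x\<in>topspace (mtop S). \<forall>Z. normal_trace S x (\<lambda>X Y. D2_fundamental S x X Y Z) = 0)"


section \<open>Transversely holomorphic and transversely harmonic maps\<close>

definition foliated_map ::
  "('a, 'e::euclidean_space, 't, 'q::euclidean_space, 'z) foliated_scheme \<Rightarrow>
   ('b, 'f::euclidean_space, 's, 'r::euclidean_space, 'y) foliated_scheme \<Rightarrow> ('a \<Rightarrow> 'b) \<Rightarrow> bool" where
  "foliated_map S S' \<phi> \<longleftrightarrow> smooth_map S S' (topspace (mtop S)) \<phi> \<and>
     (\<forall>x\<in>topspace (mtop S). \<phi> ` leaf S x \<subseteq> leaf S' (\<phi> x))"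

text \<open>The differential of a foliated map induces the map between the normal bundles; on
  representatives it is \<open>tangent_map\<close>.\<close>

definition transversely_holomorphic ::
  "('a, 'e::euclidean_space, 't, 'q::euclidean_space, 'z) trans_hermitian_scheme \<Rightarrow>
   ('b, 'f::euclidean_space, 's, 'r::euclidean_space, 'y) trans_hermitian_scheme \<Rightarrow> ('a \<Rightarrow> 'b) \<Rightarrow> bool" where
  "transversely_holomorphic S S' \<phi> \<longleftrightarrow> foliated_map S S' \<phi> \<and>
     (\<forall>x\<in>topspace (mtop S). \<forall>v.
        normal_class S' (\<phi> x) (tangent_map S S' \<phi> x (acs S x v)) =
        normal_class S' (\<phi> x) (acs S' (\<phi> x) (tangent_map S S' \<phi> x v)))"

text \<open>The covariant derivative of the induced map \<open>\<phi>\<^sub>* : Q \<rightarrow> \<phi>\<^sup>-\<^sup>1Q'\<close>,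
  \<open>(\<nabla>\<^sub>X \<phi>\<^sub>*) Y = \<nabla>\<^sub>X (\<phi>\<^sub>* Y) - \<phi>\<^sub>* (\<nabla>\<^sub>X Y)\<close> for any extension of \<open>Y\<close>.\<close>

definition nabla_induced ::
  "('a, 'e::euclidean_space, 't, 'q::euclidean_space, 'z) foliated_scheme \<Rightarrow>
   ('b, 'f::euclidean_space, 's, 'r::euclidean_space, 'y) foliated_scheme \<Rightarrow> ('a \<Rightarrow> 'b) \<Rightarrow>
   'a \<Rightarrow> 'e \<Rightarrow> 'e \<Rightarrow> 'f" where
  "nabla_induced S S' \<phi> x X Y =
     normal_conn_along S S' \<phi> (\<lambda>p. tangent_map S S' \<phi> p (const_ext S x Y p)) x X
     - tangent_map S S' \<phi> x (normal_conn S (const_ext S x Y) x X)"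

definition transverse_tension ::
  "('a, 'e::euclidean_space, 't, 'q::euclidean_space, 'z) foliated_scheme \<Rightarrow>
   ('b, 'f::euclidean_space, 's, 'r::euclidean_space, 'y) foliated_scheme \<Rightarrow> ('a \<Rightarrow> 'b) \<Rightarrow> 'a \<Rightarrow> 'f" where
  "transverse_tension S S' \<phi> x = normal_trace S x (nabla_induced S S' \<phi> x)"

definition transversely_harmonic ::
  "('a, 'e::euclidean_space, 't, 'q::euclidean_space, 'z) foliated_scheme \<Rightarrow>
   ('b, 'f::euclidean_space, 's, 'r::euclidean_space, 'y) foliated_scheme \<Rightarrow> ('a \<Rightarrow> 'b) \<Rightarrow> bool" where
  "transversely_harmonic S S' \<phi> \<longleftrightarrow>
     (\<forall>x\<in>topspace (mtop S).
        normal_class S' (\<phi> x) (transverse_tension S S' \<phi> x) = normal_class S' (\<phi> x) 0)"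

end

theory Submission
  imports Defs
begin

text \<open>
  Near a point \<open>x\<close>, let \<open>f\<close> and \<open>f'\<close> be the submersions at \<open>x\<close> and \<open>\<phi> x\<close>, let \<open>F\<close> be \<open>f\<close> in
  charts and \<open>H\<close> be \<open>f' \<circ> \<phi>\<close> in charts. As \<open>\<phi>\<close> maps leaves into leaves and a leaf meets the domain
  of \<open>f'\<close> in countably many plaques, \<open>H\<close> takes countably many values on a fibre of \<open>F\<close>; hence
  \<open>DH\<close> vanishes on the kernel of \<open>DF\<close>, and the second fundamental form
  \<open>\<beta>(X, Y) = D\<^sup>2H(X, Y) + \<Gamma>'(DH X, DH Y) - DH(\<nabla>\<^sub>X Y)\<close> is a symmetric bilinear form on the normal space.
  Differentiating the holomorphy relation gives
  \<open>\<beta>(X, JY) = (\<nabla>'\<^bsub>\<phi>X\<^esub> J')(\<phi>Y) + J' \<beta>(X, Y) - \<phi>((\<nabla>\<^sub>X J) Y)\<close>, so by symmetry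
  \<open>\<beta>(JX, JX) + \<beta>(X, X)\<close> equals \<open>J' ((\<nabla>'\<^bsub>\<phi>X\<^esub> J')(\<phi>X) + (\<nabla>'\<^bsub>J'\<phi>X\<^esub> J')(J'\<phi>X))\<close> minus
  \<open>\<phi> J ((\<nabla>\<^sub>X J) X + (\<nabla>\<^bsub>JX\<^esub> J)(JX))\<close>. Since \<open>2 D\<^sub>2F(X, Y, Z) = \<nabla>F(X, Y, Z) + \<nabla>F(JX, JY, Z)\<close>,
  the first term vanishes if the target is \<open>(1,2)\<close>-symplectic, and the sum of the second over an
  orthonormal frame vanishes if the source is cosymplectic. Finally \<open>J\<close> maps an orthonormal frame
  to an orthonormal frame, so the trace of \<open>\<beta>\<close> is zero.
\<close>

section \<open>Calculus\<close>

text \<open>The obstacle is that normal vectors and J have no smooth representatives at hand: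
  \<open>acs\<close> acts on tangent vectors, only its image under the differential of a submersion
  is known to be smooth, and a covariant derivative is fixed only up to \<open>leaf_tangent\<close>.
  So J Y cannot be differentiated as a vector field. Every identity is therefore stated after
  applying \<open>DF\<close> or \<open>DH\<close>, and holomorphy enters as an implication between
  linear equations: \<open>DF(y) w = K(F y) DF(y) Y\<close> forces
  \<open>DH(y) w = K'(H y) DH(y) Y\<close>. Such an implication can be differentiated without a
  smooth choice of w. The inclusion of kernels is the case of zero right-hand sides, and its
  derivative is what makes \<beta> a tensor on the normal space. Countability is the form in which
  the leaf condition is usable: a leaf may return to the domain of a submersion infinitely often, so
  its image there is not one point, but a nonzero derivative along a fibre would produce an interval
  of values.\<close>

abbreviation Df :: "('a::real_normed_vector \<Rightarrow> 'b::real_normed_vector) \<Rightarrow> 'a \<Rightarrow> 'a \<Rightarrow> 'b" where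
  "Df f y v \<equiv> frechet_derivative f (at y) v"

abbreviation D2f :: "('a::real_normed_vector \<Rightarrow> 'b::real_normed_vector) \<Rightarrow> 'a \<Rightarrow> 'a \<Rightarrow> 'a \<Rightarrow> 'b" where
  "D2f f y u v \<equiv> Df (\<lambda>z. Df f z v) y u"

text \<open>Second-order differentiability at one point, with no continuity of the second
  derivative. It follows from smoothness, survives composition, and suffices for the symmetry of
  \<open>D2f\<close>.\<close>

definition twice_differentiable_at ::
  "('a::real_normed_vector \<Rightarrow> 'b::real_normed_vector) \<Rightarrow> 'a \<Rightarrow> bool" where
  "twice_differentiable_at f a \<longleftrightarrow>
     (\<forall>\<^sub>F y in nhds a. f differentiable at y) \<and> (\<forall>v. (\<lambda>y. Df f y v) differentiable at a)"

lemma Df_eqI: "(f has_derivative f') (at y) \<Longrightarrow> Df f y v = f' v"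
  using frechet_derivative_at by metis

lemma has_derivative_Df: "f differentiable at y \<Longrightarrow> (f has_derivative Df f y) (at y)"
  by (simp add: frechet_derivative_works)

lemma Df_linear:
  assumes "f differentiable at y"
  shows "Df f y (u + v) = Df f y u + Df f y v" "Df f y (u - v) = Df f y u - Df f y v"
    "Df f y (- u) = - Df f y u" "Df f y (c *\<^sub>R u) = c *\<^sub>R Df f y u" "Df f y 0 = 0"
  using linear_frechet_derivative[OF assms]
  by (auto simp: linear_add linear_diff linear_neg linear_cmul linear_0)

lemma has_derivative_cong_nhds:
  assumes "\<forall>\<^sub>F y in nhds a. f y = g y" "(f has_derivative D) (at a)"
  shows "(g has_derivative D) (at a)"
proof (rule has_derivative_transform_eventually[OF assms(2)])
  show "\<forall>\<^sub>F y in at a. f y = g y"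
    using assms(1) unfolding eventually_at_filter by (rule eventually_mono) simp
  show "f a = g a" using assms(1) by (rule eventually_nhds_x_imp_x)
qed simp

lemma Df_cong_ev:
  assumes "\<forall>\<^sub>F y in nhds a. f y = g y"
  shows "Df f a v = Df g a v"
proof -
  have "\<forall>\<^sub>F y in nhds a. g y = f y" using assms by (rule eventually_mono) simp
  then have "(f has_derivative D) (at a) \<longleftrightarrow> (g has_derivative D) (at a)" for D
    using assms has_derivative_cong_nhds by metis
  then show ?thesis unfolding frechet_derivative_def by simp
qed

lemma differentiable_cong_ev:
  assumes "\<forall>\<^sub>F y in nhds a. f y = g y" "f differentiable at a"
  shows "g differentiable at a"
  using has_derivative_cong_nhds[OF assms(1)] assms(2) unfolding differentiable_def by blast

lemma smooth_on_imp_twice_differentiable_at: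
  assumes "smooth_on f S" "open S" "a \<in> S"
  shows "twice_differentiable_at f a"
proof -
  have "Ck_on (Suc (Suc 0)) f S" using assms(1) unfolding smooth_on_def by blast
  then have "\<forall>y\<in>S. f differentiable at y" "\<forall>v. \<forall>y\<in>S. (\<lambda>y. Df f y v) differentiable at y"
    by auto
  then show ?thesis unfolding twice_differentiable_at_def using assms(2,3)
    by (auto simp: eventually_nhds)
qed

lemma smooth_on_differentiable:
  assumes "smooth_on f S" "a \<in> S"
  shows "f differentiable at a"
proof -
  have "Ck_on (Suc 0) f S" using assms(1) unfolding smooth_on_def by blast
  with assms(2) show ?thesis by simp
qed

lemma twice_differentiable_imp_differentiable:
  "twice_differentiable_at f a \<Longrightarrow> f differentiable at a"
  unfolding twice_differentiable_at_def using eventually_nhds_x_imp_x by blast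

section \<open>Symmetry of the second derivative\<close>

text \<open>The mean value theorem along u reduces the second difference to an increment of
  \<open>\<lambda>y. Df f y u\<close> between two points near a, and differentiability of that map
  at a controls the increment.\<close>

lemma second_difference_real:
  fixes f :: "'a::real_normed_vector \<Rightarrow> real"
  assumes ev: "\<forall>\<^sub>F y in nhds a. f differentiable at y"
    and d: "(\<lambda>y. Df f y u) differentiable at a" and e: "e > 0"
  shows "\<forall>\<^sub>F h in at_right 0.
    \<bar>f (a + h *\<^sub>R u + h *\<^sub>R v) - f (a + h *\<^sub>R u) - f (a + h *\<^sub>R v) + f a - h\<^sup>2 * D2f f a v u\<bar> \<le> e * h\<^sup>2"
proof -
  \<comment> \<open>The factor 2 pays for the two points whose derivatives are compared; the summand
    1 keeps \<open>B\<close> positive when u and v vanish.\<close>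
  define B where "B = 2 * (norm u + norm v) + 1"
  have B: "B > 0" unfolding B_def by (simp add: add_nonneg_pos)
  have "((\<lambda>y. Df f y u) has_derivative Df (\<lambda>y. Df f y u) a) (at a)"
    by (rule has_derivative_Df[OF d])
  then obtain d1 where d1: "d1 > 0" and
    est: "\<And>y. norm (y - a) < d1 \<Longrightarrow> norm (Df f y u - Df f a u - D2f f a (y - a) u) \<le> (e / B) * norm (y - a)"
    unfolding has_derivative_at_alt using e B by (meson divide_pos_pos)
  obtain d2 where d2: "d2 > 0" and df: "\<And>y. dist y a < d2 \<Longrightarrow> f differentiable at y"
    using ev unfolding eventually_nhds_metric by blast
  have lin: "linear (\<lambda>w. D2f f a w u)" by (rule linear_frechet_derivative[OF d])
  define r where "r = min d1 d2 / B"
  have r: "r > 0" unfolding r_def using d1 d2 B by simp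
  have main: "\<bar>f (a + h *\<^sub>R u + h *\<^sub>R v) - f (a + h *\<^sub>R u) - f (a + h *\<^sub>R v) + f a - h\<^sup>2 * D2f f a v u\<bar> \<le> e * h\<^sup>2"
    if h: "0 < h" "h < r" for h
  proof -
    have small: "norm (s *\<^sub>R u + t *\<^sub>R v) \<le> h * (norm u + norm v)"
      if "0 \<le> s" "s \<le> h" "0 \<le> t" "t \<le> h" for s t
    proof -
      have "norm (s *\<^sub>R u + t *\<^sub>R v) \<le> s * norm u + t * norm v"
        using norm_triangle_ineq[of "s *\<^sub>R u" "t *\<^sub>R v"] that by simp
      also have "\<dots> \<le> h * norm u + h * norm v"
        using that by (intro add_mono mult_right_mono) auto
      finally show ?thesis by (simp add: algebra_simps)
    qed
    have hB: "h * B < min d1 d2" using h B unfolding r_def by (simp add: field_simps)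
    have "h * (norm u + norm v) \<le> h * B" using h unfolding B_def by (intro mult_left_mono) auto
    then have small2: "norm (s *\<^sub>R u + t *\<^sub>R v) < min d1 d2"
      if "0 \<le> s" "s \<le> h" "0 \<le> t" "t \<le> h" for s t
      using small[OF that] hB by linarith
    have dfs: "f differentiable at (a + s *\<^sub>R u + t *\<^sub>R v)"
      if "0 \<le> s" "s \<le> h" "0 \<le> t" "t \<le> h" for s t
      using small2[OF that] by (intro df) (simp add: dist_norm algebra_simps)
    have der: "((\<lambda>s. f (a + s *\<^sub>R u + t *\<^sub>R v)) has_real_derivative Df f (a + s *\<^sub>R u + t *\<^sub>R v) u) (at s)"
      if "0 \<le> s" "s \<le> h" "0 \<le> t" "t \<le> h" for s t
    proof -
      have "((\<lambda>s. a + s *\<^sub>R u + t *\<^sub>R v) has_derivative (\<lambda>s. s *\<^sub>R u)) (at s)"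
        by (auto intro!: derivative_eq_intros)
      from has_derivative_compose[OF this has_derivative_Df[OF dfs[OF that]]]
      show ?thesis unfolding has_field_derivative_def
        by (rule has_derivative_eq_rhs) (simp add: fun_eq_iff Df_linear(4)[OF dfs[OF that]])
    qed
    \<comment> \<open>The second difference is \<open>\<psi> h - \<psi> 0\<close>. Keeping
      \<open>0 *\<^sub>R v\<close> lets \<open>der\<close> differentiate both terms, with
      \<open>t = h\<close> and \<open>t = 0\<close>.\<close>
    define \<psi> where "\<psi> s = f (a + s *\<^sub>R u + h *\<^sub>R v) - f (a + s *\<^sub>R u + 0 *\<^sub>R v)" for s
    have "\<exists>z>0. z < h \<and> \<psi> h - \<psi> 0 = (h - 0) * (Df f (a + z *\<^sub>R u + h *\<^sub>R v) u - Df f (a + z *\<^sub>R u + 0 *\<^sub>R v) u)"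
      unfolding \<psi>_def
      by (rule MVT2[OF h(1)]) (use h in \<open>intro DERIV_diff der; simp\<close>)
    then obtain z where z: "0 < z" "z < h" and
      eq: "\<psi> h - \<psi> 0 = h * (Df f (a + z *\<^sub>R u + h *\<^sub>R v) u - Df f (a + z *\<^sub>R u + 0 *\<^sub>R v) u)"
      by auto
    have e1: "\<bar>Df f (a + z *\<^sub>R u + t *\<^sub>R v) u - Df f a u - D2f f a (z *\<^sub>R u + t *\<^sub>R v) u\<bar> \<le> (e / B) * (h * (norm u + norm v))"
      if t: "0 \<le> t" "t \<le> h" for t
    proof -
      have "norm ((a + z *\<^sub>R u + t *\<^sub>R v) - a) < d1" using small2[of z t] z t h by (simp add: algebra_simps)
      from est[OF this] have "\<bar>Df f (a + z *\<^sub>R u + t *\<^sub>R v) u - Df f a u - D2f f a (z *\<^sub>R u + t *\<^sub>R v) u\<bar>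
        \<le> (e / B) * norm (z *\<^sub>R u + t *\<^sub>R v)" by (simp add: algebra_simps)
      also have "\<dots> \<le> (e / B) * (h * (norm u + norm v))"
        using small[of z t] z t e B by (intro mult_left_mono) auto
      finally show ?thesis .
    qed
    have "D2f f a (z *\<^sub>R u + h *\<^sub>R v) u - D2f f a (z *\<^sub>R u + 0 *\<^sub>R v) u = h * D2f f a v u"
      using lin by (simp add: linear_add linear_cmul)
    with e1[of h] e1[of 0] h
    have "\<bar>Df f (a + z *\<^sub>R u + h *\<^sub>R v) u - Df f (a + z *\<^sub>R u + 0 *\<^sub>R v) u - h * D2f f a v u\<bar>
      \<le> 2 * ((e / B) * (h * (norm u + norm v)))" by simp
    also have "\<dots> = (e * h) * (2 * (norm u + norm v) / B)" by simp
    also have "\<dots> \<le> (e * h) * 1"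
      using h e B by (intro mult_left_mono) (auto simp: B_def)
    finally have b: "\<bar>Df f (a + z *\<^sub>R u + h *\<^sub>R v) u - Df f (a + z *\<^sub>R u + 0 *\<^sub>R v) u - h * D2f f a v u\<bar> \<le> e * h"
      by simp
    have "\<bar>\<psi> h - \<psi> 0 - h\<^sup>2 * D2f f a v u\<bar>
      = h * \<bar>Df f (a + z *\<^sub>R u + h *\<^sub>R v) u - Df f (a + z *\<^sub>R u + 0 *\<^sub>R v) u - h * D2f f a v u\<bar>"
    proof -
      have "\<psi> h - \<psi> 0 - h\<^sup>2 * D2f f a v u
        = h * (Df f (a + z *\<^sub>R u + h *\<^sub>R v) u - Df f (a + z *\<^sub>R u + 0 *\<^sub>R v) u - h * D2f f a v u)"
        unfolding eq by (simp only: right_diff_distrib power2_eq_square mult.assoc)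
      then show ?thesis using h by (simp only: abs_mult)
    qed
    also have "\<dots> \<le> h * (e * h)" using b h by (intro mult_left_mono) auto
    finally show ?thesis unfolding \<psi>_def by (simp add: power2_eq_square algebra_simps)
  qed
  show ?thesis unfolding eventually_at_right_field
  proof (intro exI conjI allI impI)
    show "0 < r" by (rule r)
  qed (rule main)
qed

text \<open>The second difference is symmetric in u and v, so both mixed derivatives, times
  \<open>h\<^sup>2\<close>, approximate it up to \<open>e * h\<^sup>2\<close>. They differ by at
  most \<open>2 * e\<close>, which the quarter in the definition of \<open>e\<close> makes
  impossible.\<close>

lemma symmetric_second_derivative_real:
  fixes f :: "'a::real_normed_vector \<Rightarrow> real"
  assumes "twice_differentiable_at f a"
  shows "D2f f a u v = D2f f a v u"
proof (rule ccontr)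
  assume "D2f f a u v \<noteq> D2f f a v u"
  define e where "e = \<bar>D2f f a u v - D2f f a v u\<bar> / 4"
  have e: "e > 0" unfolding e_def using \<open>_ \<noteq> _\<close> by simp
  have ev: "\<forall>\<^sub>F y in nhds a. f differentiable at y" and d: "\<And>v. (\<lambda>y. Df f y v) differentiable at a"
    using assms unfolding twice_differentiable_at_def by auto
  have "\<forall>\<^sub>F h::real in at_right 0. h > 0"
    by (simp add: eventually_at_right_less)
  with second_difference_real[OF ev d e, of u v] second_difference_real[OF ev d e, of v u]
  have "\<forall>\<^sub>F h in at_right (0::real). False"
  proof eventually_elim
    case (elim h)
    have s: "a + h *\<^sub>R v + h *\<^sub>R u = a + h *\<^sub>R u + h *\<^sub>R v" by (simp add: algebra_simps)
    have "\<bar>h\<^sup>2 * D2f f a u v - h\<^sup>2 * D2f f a v u\<bar> \<le> 2 * (e * h\<^sup>2)"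
      using elim(1,2) unfolding s by linarith
    moreover have "h\<^sup>2 * D2f f a u v - h\<^sup>2 * D2f f a v u = h\<^sup>2 * (D2f f a u v - D2f f a v u)"
      by (rule right_diff_distrib[symmetric])
    ultimately have "h\<^sup>2 * \<bar>D2f f a u v - D2f f a v u\<bar> \<le> h\<^sup>2 * (2 * e)"
      by (simp only: abs_mult abs_power2 mult.commute mult.left_commute)
    then have "\<bar>D2f f a u v - D2f f a v u\<bar> \<le> 2 * e" using elim(3) by simp
    then show False using e unfolding e_def by simp
  qed
  then show False by simp
qed

lemma Df_inner:
  fixes f :: "'a::real_normed_vector \<Rightarrow> 'b::real_inner"
  assumes "f differentiable at y"
  shows "Df (\<lambda>y. f y \<bullet> b) y v = Df f y v \<bullet> b" "(\<lambda>y. f y \<bullet> b) differentiable at y"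
proof -
  have "((\<lambda>y. f y \<bullet> b) has_derivative (\<lambda>v. Df f y v \<bullet> b)) (at y)"
    using has_derivative_Df[OF assms] by (rule has_derivative_inner_left)
  then show "Df (\<lambda>y. f y \<bullet> b) y v = Df f y v \<bullet> b" "(\<lambda>y. f y \<bullet> b) differentiable at y"
    by (auto simp: Df_eqI differentiable_def)
qed

lemma symmetric_second_derivative:
  fixes f :: "'a::real_normed_vector \<Rightarrow> 'b::euclidean_space"
  assumes "twice_differentiable_at f a"
  shows "D2f f a u v = D2f f a v u"
proof (rule euclidean_eqI)
  fix b :: 'b
  have ev: "\<forall>\<^sub>F y in nhds a. f differentiable at y" and d: "\<And>v. (\<lambda>y. Df f y v) differentiable at a"
    using assms unfolding twice_differentiable_at_def by auto
  have e: "\<forall>\<^sub>F y in nhds a. Df (\<lambda>y. f y \<bullet> b) y v = Df f y v \<bullet> b" for v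
    using ev by eventually_elim (rule Df_inner)
  have D: "D2f (\<lambda>y. f y \<bullet> b) a u v = D2f f a u v \<bullet> b" for u v
    using Df_cong_ev[OF e] Df_inner[OF d] by metis
  have "twice_differentiable_at (\<lambda>y. f y \<bullet> b) a"
    unfolding twice_differentiable_at_def
  proof (intro conjI allI)
    show "\<forall>\<^sub>F y in nhds a. (\<lambda>y. f y \<bullet> b) differentiable at y"
      using ev by eventually_elim (rule Df_inner)
    fix v
    have "\<forall>\<^sub>F y in nhds a. Df f y v \<bullet> b = Df (\<lambda>y. f y \<bullet> b) y v"
      using e by (simp add: eq_commute)
    then show "(\<lambda>y. Df (\<lambda>y. f y \<bullet> b) y v) differentiable at a"
      by (rule differentiable_cong_ev) (rule Df_inner[OF d])
  qed
  from symmetric_second_derivative_real[OF this, of u v]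
  show "D2f f a u v \<bullet> b = D2f f a v u \<bullet> b" by (simp only: D)
qed

section \<open>Derivatives of families of multilinear maps with moving arguments\<close>

text \<open>Only the values at fixed vectors are known to be differentiable in q. Expanding both
  arguments in the basis, which bilinearity allows on \<open>S\<close>, leaves finitely many such
  values with differentiable coefficients, and the product rule applies.\<close>

lemma has_derivative_bilinear_family:
  fixes g :: "'p::real_normed_vector \<Rightarrow> 'q::euclidean_space \<Rightarrow> 'q \<Rightarrow> 'v::real_normed_vector"
  assumes "open S" "q0 \<in> S" and bil: "\<And>q. q \<in> S \<Longrightarrow> bilinear (g q)"
    and dg: "\<And>u v. (\<lambda>q. g q u v) differentiable at q0"
    and F: "(F has_derivative F') (at y0)" "F y0 = q0"
    and s: "(s has_derivative s') (at y0)" and t: "(t has_derivative t') (at y0)"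
  shows "((\<lambda>y. g (F y) (s y) (t y)) has_derivative
     (\<lambda>X. Df (\<lambda>q. g q (s y0) (t y0)) q0 (F' X) + g q0 (s' X) (t y0) + g q0 (s y0) (t' X))) (at y0)"
proof -
  have ex: "g q u v = (\<Sum>i\<in>Basis. \<Sum>j\<in>Basis. ((u \<bullet> i) * (v \<bullet> j)) *\<^sub>R g q i j)" if "q \<in> S" for q u v
  proof -
    have "g q u v = g q (\<Sum>i\<in>Basis. (u \<bullet> i) *\<^sub>R i) (\<Sum>j\<in>Basis. (v \<bullet> j) *\<^sub>R j)"
      by (simp add: euclidean_representation)
    also have "\<dots> = (\<Sum>(i,j)\<in>Basis\<times>Basis. g q ((u \<bullet> i) *\<^sub>R i) ((v \<bullet> j) *\<^sub>R j))"
      by (rule bilinear_sum[OF bil[OF that]])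
    also have "\<dots> = (\<Sum>i\<in>Basis. \<Sum>j\<in>Basis. ((u \<bullet> i) * (v \<bullet> j)) *\<^sub>R g q i j)"
      using bil[OF that] by (simp add: sum.cartesian_product bilinear_lmul bilinear_rmul mult.commute)
    finally show ?thesis .
  qed
  have Dg: "Df (\<lambda>q. g q u v) q0 X = (\<Sum>i\<in>Basis. \<Sum>j\<in>Basis. ((u \<bullet> i) * (v \<bullet> j)) *\<^sub>R Df (\<lambda>q. g q i j) q0 X)"
    for u v X
  proof -
    have "Df (\<lambda>q. g q u v) q0 X = Df (\<lambda>q. \<Sum>i\<in>Basis. \<Sum>j\<in>Basis. ((u \<bullet> i) * (v \<bullet> j)) *\<^sub>R g q i j) q0 X"
      by (rule Df_cong_ev) (use assms(1,2) ex in \<open>auto simp: eventually_nhds intro!: exI[of _ S]\<close>)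
    also have "\<dots> = (\<Sum>i\<in>Basis. \<Sum>j\<in>Basis. ((u \<bullet> i) * (v \<bullet> j)) *\<^sub>R Df (\<lambda>q. g q i j) q0 X)"
      by (rule Df_eqI) (intro has_derivative_sum has_derivative_scaleR_right has_derivative_Df dg)
    finally show ?thesis .
  qed
  have gF: "((\<lambda>y. g (F y) i j) has_derivative (\<lambda>X. Df (\<lambda>q. g q i j) q0 (F' X))) (at y0)" for i j
    using has_derivative_compose[OF F(1), of "\<lambda>q. g q i j"] has_derivative_Df[OF dg] F(2) by auto
  have 1: "((\<lambda>y. \<Sum>i\<in>Basis. \<Sum>j\<in>Basis. ((s y \<bullet> i) * (t y \<bullet> j)) *\<^sub>R g (F y) i j) has_derivative
     (\<lambda>X. \<Sum>i\<in>Basis. \<Sum>j\<in>Basis. ((s y0 \<bullet> i) * (t y0 \<bullet> j)) *\<^sub>R Df (\<lambda>q. g q i j) q0 (F' X) +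
        ((s y0 \<bullet> i) * (t' X \<bullet> j) + (s' X \<bullet> i) * (t y0 \<bullet> j)) *\<^sub>R g (F y0) i j)) (at y0)"
    by (intro has_derivative_sum has_derivative_scaleR has_derivative_mult
        has_derivative_inner_left s t gF)
  have "((\<lambda>y. \<Sum>i\<in>Basis. \<Sum>j\<in>Basis. ((s y \<bullet> i) * (t y \<bullet> j)) *\<^sub>R g (F y) i j) has_derivative
     (\<lambda>X. Df (\<lambda>q. g q (s y0) (t y0)) q0 (F' X) + g q0 (s' X) (t y0) + g q0 (s y0) (t' X))) (at y0)"
    by (rule has_derivative_eq_rhs[OF 1])
      (simp add: fun_eq_iff Dg[of "s y0" "t y0"] ex[OF assms(2), of "s' _" "t y0"]
        ex[OF assms(2), of "s y0" "t' _"] F(2) sum.distrib scaleR_add_left add.commute add.left_commute)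
  moreover have "\<forall>\<^sub>F y in at y0. F y \<in> S"
    using F assms(1,2) has_derivative_continuous[OF F(1)]
    by (simp add: continuous_within tendsto_def)
  then have "\<forall>\<^sub>F y in at y0. (\<Sum>i\<in>Basis. \<Sum>j\<in>Basis. ((s y \<bullet> i) * (t y \<bullet> j)) *\<^sub>R g (F y) i j) = g (F y) (s y) (t y)"
    by eventually_elim (simp add: ex[symmetric])
  ultimately show ?thesis
    by (rule has_derivative_transform_eventually) (simp_all add: ex[symmetric] F(2) assms(2))
qed

lemma has_derivative_linear_family:
  fixes K :: "'p::real_normed_vector \<Rightarrow> 'q::euclidean_space \<Rightarrow> 'v::real_normed_vector"
  assumes "open S" "q0 \<in> S" and lin: "\<And>q. q \<in> S \<Longrightarrow> linear (K q)"
    and dK: "\<And>u. (\<lambda>q. K q u) differentiable at q0"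
    and F: "(F has_derivative F') (at y0)" "F y0 = q0"
    and s: "(s has_derivative s') (at y0)"
  shows "((\<lambda>y. K (F y) (s y)) has_derivative
     (\<lambda>X. Df (\<lambda>q. K q (s y0)) q0 (F' X) + K q0 (s' X))) (at y0)"
proof -
  have ex: "K q u = (\<Sum>i\<in>Basis. (u \<bullet> i) *\<^sub>R K q i)" if "q \<in> S" for q u
  proof -
    have "K q u = K q (\<Sum>i\<in>Basis. (u \<bullet> i) *\<^sub>R i)"
      by (simp add: euclidean_representation)
    then show ?thesis by (simp add: linear_sum[OF lin[OF that]] linear_cmul[OF lin[OF that]])
  qed
  have DK: "Df (\<lambda>q. K q u) q0 X = (\<Sum>i\<in>Basis. (u \<bullet> i) *\<^sub>R Df (\<lambda>q. K q i) q0 X)" for u X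
  proof -
    have "Df (\<lambda>q. K q u) q0 X = Df (\<lambda>q. \<Sum>i\<in>Basis. (u \<bullet> i) *\<^sub>R K q i) q0 X"
      by (rule Df_cong_ev) (use assms(1,2) ex in \<open>auto simp: eventually_nhds intro!: exI[of _ S]\<close>)
    also have "\<dots> = (\<Sum>i\<in>Basis. (u \<bullet> i) *\<^sub>R Df (\<lambda>q. K q i) q0 X)"
      by (rule Df_eqI) (intro has_derivative_sum has_derivative_scaleR_right has_derivative_Df dK)
    finally show ?thesis .
  qed
  have KF: "((\<lambda>y. K (F y) i) has_derivative (\<lambda>X. Df (\<lambda>q. K q i) q0 (F' X))) (at y0)" for i
    using has_derivative_compose[OF F(1), of "\<lambda>q. K q i"] has_derivative_Df[OF dK] F(2) by auto
  have 1: "((\<lambda>y. \<Sum>i\<in>Basis. (s y \<bullet> i) *\<^sub>R K (F y) i) has_derivative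
     (\<lambda>X. \<Sum>i\<in>Basis. (s y0 \<bullet> i) *\<^sub>R Df (\<lambda>q. K q i) q0 (F' X) + (s' X \<bullet> i) *\<^sub>R K (F y0) i)) (at y0)"
    by (intro has_derivative_sum has_derivative_scaleR has_derivative_inner_left s KF)
  have "((\<lambda>y. \<Sum>i\<in>Basis. (s y \<bullet> i) *\<^sub>R K (F y) i) has_derivative
     (\<lambda>X. Df (\<lambda>q. K q (s y0)) q0 (F' X) + K q0 (s' X))) (at y0)"
    by (rule has_derivative_eq_rhs[OF 1])
      (simp add: fun_eq_iff DK[of "s y0"] ex[OF assms(2), of "s' _"] F(2) sum.distrib)
  moreover have "\<forall>\<^sub>F y in at y0. F y \<in> S"
    using F assms(1,2) has_derivative_continuous[OF F(1)]
    by (simp add: continuous_within tendsto_def)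
  then have "\<forall>\<^sub>F y in at y0. (\<Sum>i\<in>Basis. (s y \<bullet> i) *\<^sub>R K (F y) i) = K (F y) (s y)"
    by eventually_elim (simp add: ex[symmetric])
  ultimately show ?thesis
    by (rule has_derivative_transform_eventually) (simp_all add: ex[symmetric] F(2) assms(2))
qed

section \<open>Differentiating an implication between linear equations\<close>

lemma isCont_imp_tendsto_nhds: "isCont f a \<Longrightarrow> (f \<longlongrightarrow> f a) (nhds a)"
  by (simp add: isCont_def tendsto_at_iff_tendsto_nhds)

lemma linear_norm_bound:
  fixes f :: "'e::euclidean_space \<Rightarrow> 'v::real_normed_vector"
  assumes "linear f"
  shows "norm (f e) \<le> norm e * (\<Sum>i\<in>Basis. norm (f i))"
proof -
  have "f e = f (\<Sum>i\<in>Basis. (e \<bullet> i) *\<^sub>R i)" by (simp add: euclidean_representation)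
  also have "\<dots> = (\<Sum>i\<in>Basis. (e \<bullet> i) *\<^sub>R f i)"
    by (simp add: linear_sum[OF assms] linear_cmul[OF assms])
  finally have "norm (f e) \<le> (\<Sum>i\<in>Basis. norm ((e \<bullet> i) *\<^sub>R f i))"
    using norm_sum by metis
  also have "\<dots> \<le> (\<Sum>i\<in>Basis. norm e * norm (f i))"
    by (intro sum_mono) (simp add: mult_right_mono Basis_le_norm)
  finally show ?thesis by (simp add: sum_distrib_left)
qed

text \<open>For a right inverse \<open>R\<close> at y0, the map \<open>L y \<circ> R\<close> is
  close to the identity, hence invertible with inverse of norm at most 2. Preimages are thus bounded
  uniformly in y, so that an error in an equation can be corrected at comparable cost.\<close>

lemma surj_near_surj:
  fixes L :: "'p::real_normed_vector \<Rightarrow> 'e::euclidean_space \<Rightarrow> 'q::euclidean_space"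
  assumes lin: "\<forall>\<^sub>F y in nhds y0. linear (L y)" and surj: "surj (L y0)"
    and cont: "\<And>w. isCont (\<lambda>y. L y w) y0"
  obtains C where "\<forall>\<^sub>F y in nhds y0. \<forall>z. \<exists>e. L y e = z \<and> norm e \<le> C * norm z"
proof -
  have lin0: "linear (L y0)" using eventually_nhds_x_imp_x[OF lin] .
  obtain R where R: "linear R" "L y0 \<circ> R = id"
    using linear_surjective_right_inverse[OF lin0 surj] by blast
  have tends: "((\<lambda>y. \<Sum>i\<in>Basis. norm (L y (R i) - i)) \<longlongrightarrow> (\<Sum>i\<in>Basis. norm (L y0 (R i) - i))) (nhds y0)"
    by (intro tendsto_intros isCont_imp_tendsto_nhds[OF cont])
  have "(\<Sum>i\<in>Basis. norm (L y0 (R i) - i)) = 0" using R(2) by (simp add: fun_eq_iff)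
  with tends have small: "\<forall>\<^sub>F y in nhds y0. (\<Sum>i\<in>Basis. norm (L y (R i) - i)) < 1/2"
    by (intro order_tendstoD(2)[of _ 0]) simp_all
  define C where "C = 2 * (\<Sum>i\<in>Basis. norm (R i))"
  have "\<forall>\<^sub>F y in nhds y0. \<forall>z. \<exists>e. L y e = z \<and> norm e \<le> C * norm z"
    using lin small
  proof eventually_elim
    case (elim y)
    define P where "P v = L y (R v)" for v
    have linP: "linear P" unfolding P_def using linear_compose[OF R(1) elim(1)] by (simp add: o_def)
    have "linear (\<lambda>v. P v - v)" using linP linear_ident by (rule linear_compose_sub)
    from linear_norm_bound[OF this]
    have close: "norm (P v - v) \<le> norm v * (1/2)" for v
      using elim(2) unfolding P_def by (meson less_imp_le mult_left_mono norm_ge_zero order_trans)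
    have lower: "norm v \<le> 2 * norm (P v)" for v
      using close[of v] norm_triangle_ineq2[of v "P v"] norm_minus_commute[of v "P v"] by linarith
    have "v = 0" if "P v = 0" for v using lower[of v] that by simp
    then have "inj P" using linear_injective_0[OF linP] by blast
    then have "surj P" using linP linear_injective_imp_surjective by blast
    show ?case
    proof
      fix z
      obtain v where v: "P v = z" using \<open>surj P\<close> by (metis surjD)
      have "norm (R v) \<le> norm v * (\<Sum>i\<in>Basis. norm (R i))" by (rule linear_norm_bound[OF R(1)])
      also have "\<dots> \<le> (2 * norm z) * (\<Sum>i\<in>Basis. norm (R i))"
        using lower[of v] v by (intro mult_right_mono) (auto intro: sum_nonneg)
      finally have "norm (R v) \<le> C * norm z" unfolding C_def by (simp add: mult_ac)
      then show "\<exists>e. L y e = z \<and> norm e \<le> C * norm z" using v unfolding P_def by blast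
    qed
  qed
  then show thesis by (rule that)
qed

text \<open>The path \<open>w0 + t n\<close> solves \<open>L w = a\<close> along \<open>y0 + t X\<close> up to \<open>o(t)\<close>, and surjectivity of \<open>L\<close>
  corrects it to an exact solution by a term that is \<open>o(t)\<close>.\<close>

lemma implicit_variation:
  fixes L :: "'p::real_normed_vector \<Rightarrow> 'e::euclidean_space \<Rightarrow> 'q::euclidean_space"
    and N :: "'p \<Rightarrow> 'e \<Rightarrow> 'r::euclidean_space"
  assumes lin: "\<forall>\<^sub>F y in nhds y0. linear (L y)" "\<forall>\<^sub>F y in nhds y0. linear (N y)"
    and imp: "\<forall>\<^sub>F y in nhds y0. \<forall>w. L y w = a y \<longrightarrow> N y w = b y"
    and surj: "surj (L y0)"
    and dL: "\<And>w. (\<lambda>y. L y w) differentiable at y0" and dN: "\<And>w. (\<lambda>y. N y w) differentiable at y0"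
    and da: "a differentiable at y0" and db: "b differentiable at y0"
    and w0: "L y0 w0 = a y0" and n: "L y0 n + Df (\<lambda>y. L y w0) y0 X = Df a y0 X"
  shows "N y0 n + Df (\<lambda>y. N y w0) y0 X = Df b y0 X"
proof -
  define p where "p t = y0 + t *\<^sub>R X" for t :: real
  have p: "(p has_derivative (\<lambda>t. t *\<^sub>R X)) (at 0)" "p 0 = y0"
    unfolding p_def by (auto intro!: derivative_eq_intros)
  have s: "((\<lambda>t. w0 + t *\<^sub>R n) has_derivative (\<lambda>t. t *\<^sub>R n)) (at 0)"
    by (auto intro!: derivative_eq_intros)
  \<comment> \<open>Used for \<open>L\<close> with a and for \<open>N\<close> with b: it gives the
    derivative at 0 of the residual of the equation along the path. For the first equation it
    vanishes by the assumption on n.\<close>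
  have along: "((\<lambda>t. P (p t) (w0 + t *\<^sub>R n) - c (p t)) has_derivative
      (\<lambda>t. t *\<^sub>R (P y0 n + Df (\<lambda>y. P y w0) y0 X - Df c y0 X))) (at 0)"
    if l: "\<forall>\<^sub>F y in nhds y0. linear (P y)" and dP: "\<And>w. (\<lambda>y. P y w) differentiable at y0"
      and dc: "c differentiable at y0" for P :: "'p \<Rightarrow> 'e \<Rightarrow> 'z::euclidean_space" and c
  proof -
    obtain S where S: "open S" "y0 \<in> S" "\<And>y. y \<in> S \<Longrightarrow> linear (P y)"
      using l unfolding eventually_nhds by blast
    have 1: "((\<lambda>t. P (p t) (w0 + t *\<^sub>R n)) has_derivative
        (\<lambda>t. Df (\<lambda>y. P y (w0 + 0 *\<^sub>R n)) y0 (t *\<^sub>R X) + P y0 (t *\<^sub>R n))) (at 0)"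
      by (rule has_derivative_linear_family[OF S dP p s])
    have 2: "((\<lambda>t. c (p t)) has_derivative (\<lambda>t. Df c y0 (t *\<^sub>R X))) (at 0)"
      using has_derivative_compose[OF p(1), of c] has_derivative_Df[OF dc] p(2) by auto
    show ?thesis
      by (rule has_derivative_eq_rhs[OF has_derivative_diff[OF 1 2]])
        (simp add: fun_eq_iff Df_linear(4)[OF dc] Df_linear(4)[OF dP] linear_cmul[OF S(3)[OF S(2)]]
          scaleR_add_right scaleR_diff_right)
  qed
  define c where "c t = L (p t) (w0 + t *\<^sub>R n) - a (p t)" for t
  define d where "d t = N (p t) (w0 + t *\<^sub>R n) - b (p t)" for t
  have c0: "c 0 = 0" unfolding c_def using w0 p(2) by simp
  have d0: "d 0 = 0" unfolding d_def using w0 p(2) eventually_nhds_x_imp_x[OF imp] by simp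
  have cd: "(c has_derivative (\<lambda>t. 0)) (at 0)"
    unfolding c_def using along[OF lin(1) dL da] n by simp
  have dd: "(d has_derivative (\<lambda>t. t *\<^sub>R (N y0 n + Df (\<lambda>y. N y w0) y0 X - Df b y0 X))) (at 0)"
    unfolding d_def by (rule along[OF lin(2) dN db])
  obtain C where C: "\<forall>\<^sub>F y in nhds y0. \<forall>z. \<exists>e. L y e = z \<and> norm e \<le> C * norm z"
    by (rule surj_near_surj[OF lin(1) surj])
      (use dL in \<open>auto intro: differentiable_imp_continuous_within\<close>)
  \<comment> \<open>The summand 1 makes the bound strict at y0, so that it persists nearby.\<close>
  define B where "B = (\<Sum>i\<in>Basis. norm (N y0 i)) + 1"
  have "((\<lambda>y. \<Sum>i\<in>Basis. norm (N y i)) \<longlongrightarrow> (\<Sum>i\<in>Basis. norm (N y0 i))) (nhds y0)"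
    by (intro tendsto_intros isCont_imp_tendsto_nhds differentiable_imp_continuous_within dN)
  then have B: "\<forall>\<^sub>F y in nhds y0. (\<Sum>i\<in>Basis. norm (N y i)) < B"
    unfolding B_def by (rule order_tendstoD) simp
  \<comment> \<open>Adding some e with \<open>L y e = - (L y w - a y)\<close> makes w an exact
    solution of the first equation, hence of the second; the residual of the second equation at w is
    then \<open>- N y e\<close>.\<close>
  have bound: "\<forall>\<^sub>F y in nhds y0. \<forall>w. norm (N y w - b y) \<le> (B * C) * norm (L y w - a y)"
    using C B lin imp
  proof eventually_elim
    case (elim y)
    show ?case
    proof
      fix w
      obtain e where e: "L y e = - (L y w - a y)" "norm e \<le> C * norm (- (L y w - a y))"
        using elim(1) by blast
      have "N y (w + e) = b y" using elim(5) e(1) linear_add[OF elim(3), of w e] by simp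
      then have "N y w - b y = - N y e" using linear_add[OF elim(4), of w e] by (simp add: algebra_simps)
      then have "norm (N y w - b y) = norm (N y e)" by simp
      also have "\<dots> \<le> norm e * B"
        using linear_norm_bound[OF elim(4), of e] elim(2)
        by (meson less_imp_le mult_left_mono norm_ge_zero order_trans)
      also have "\<dots> \<le> (C * norm (L y w - a y)) * B"
        using e(2) elim(2) sum_nonneg[of Basis "\<lambda>i. norm (N y0 i)"]
        by (intro mult_right_mono) (auto simp: B_def norm_minus_commute)
      finally show "norm (N y w - b y) \<le> (B * C) * norm (L y w - a y)" by (simp add: mult_ac)
    qed
  qed
  have "isCont p 0" using p(1) has_derivative_continuous by blast
  then have "filterlim p (nhds y0) (nhds 0)"
    using p(2) isCont_imp_tendsto_nhds by metis
  with bound have "\<forall>\<^sub>F t in nhds 0. \<forall>w. norm (N (p t) w - b (p t)) \<le> (B * C) * norm (L (p t) w - a (p t))"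
    by (rule eventually_compose_filterlim)
  then have dc: "\<forall>\<^sub>F t in at 0. norm (d t) / norm t \<le> (B * C) * (norm (c t) / norm t)"
    unfolding eventually_at_filter
  proof eventually_elim
    case (elim t)
    have "norm (d t) \<le> (B * C) * norm (c t)" unfolding c_def d_def using elim by blast
    then have "norm (d t) / norm t \<le> ((B * C) * norm (c t)) / norm t" by (rule divide_right_mono) simp
    then show ?case by (simp add: times_divide_eq_right)
  qed
  have "((\<lambda>t. norm (c t) / norm t) \<longlongrightarrow> 0) (at 0)"
    using cd c0 unfolding has_derivative_at by simp
  then have "((\<lambda>t. (B * C) * (norm (c t) / norm t)) \<longlongrightarrow> (B * C) * 0) (at 0)"
    by (intro tendsto_intros)
  then have lim0: "((\<lambda>t. (B * C) * (norm (c t) / norm t)) \<longlongrightarrow> 0) (at 0)" by simp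
  have "((\<lambda>t. norm (d t) / norm t) \<longlongrightarrow> 0) (at 0)"
    by (rule tendsto_sandwich[OF _ dc tendsto_const lim0]) simp
  then have "(d has_derivative (\<lambda>t. 0)) (at 0)"
    using d0 unfolding has_derivative_at by simp
  from has_derivative_unique[OF this dd] have "0 = 1 *\<^sub>R (N y0 n + Df (\<lambda>y. N y w0) y0 X - Df b y0 X)"
    by metis
  then show ?thesis by simp
qed

section \<open>Inner products\<close>

text \<open>The form is a parameter because the metric in a chart changes from point to point and
  differs from the inner product of the type.\<close>

locale inner_form =
  fixes g :: "'q::euclidean_space \<Rightarrow> 'q \<Rightarrow> real"
  assumes bil: "bilinear g" and sym: "g u v = g v u" and pos: "v \<noteq> 0 \<Longrightarrow> g v v > 0"
begin

lemmas g_simps = bilinear_ladd[OF bil] bilinear_radd[OF bil] bilinear_lmul[OF bil] bilinear_rmul[OF bil]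
  bilinear_lneg[OF bil] bilinear_rneg[OF bil] bilinear_lzero[OF bil] bilinear_rzero[OF bil]
  bilinear_lsub[OF bil] bilinear_rsub[OF bil]

lemma g_sum_left: "g (\<Sum>a\<in>A. f a) v = (\<Sum>a\<in>A. g (f a) v)"
  using bil linear_sum[of "\<lambda>u. g u v" f A] unfolding bilinear_def by blast

lemma g_sum_right: "g v (\<Sum>a\<in>A. f a) = (\<Sum>a\<in>A. g v (f a))"
  using bil linear_sum[of "g v" f A] unfolding bilinear_def by blast

lemma nondegenerate: "(\<And>z. g u z = g v z) \<Longrightarrow> u = v"
  using pos[of "u - v"] by (metis g_simps(9) cancel_comm_monoid_add_class.diff_cancel less_irrefl right_minus_eq)

definition orthonormal :: "(nat \<Rightarrow> 'q) \<Rightarrow> nat \<Rightarrow> bool" where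
  "orthonormal e n \<longleftrightarrow> (\<forall>a<n. \<forall>b<n. g (e a) (e b) = (if a = b then 1 else 0))"

lemma orthonormal_coeff:
  assumes "orthonormal e n" "b < n"
  shows "g (\<Sum>a<n. c a *\<^sub>R e a) (e b) = c b"
proof -
  have "g (\<Sum>a<n. c a *\<^sub>R e a) (e b) = (\<Sum>a<n. c a * (if a = b then 1 else 0))"
    using assms unfolding orthonormal_def by (simp add: g_sum_left g_simps)
  also have "\<dots> = c b" using assms(2) by (simp add: if_distrib[of "(*) _"] sum.If_cases cong: if_cong)
  finally show ?thesis .
qed

lemma orthonormal_inj: "orthonormal e n \<Longrightarrow> inj_on e {..<n}"
  unfolding orthonormal_def inj_on_def by (metis lessThan_iff zero_neq_one)

lemma orthonormal_independent:
  assumes "orthonormal e n"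
  shows "independent (e ` {..<n})"
proof (rule independent_if_scalars_zero)
  fix f x assume s: "(\<Sum>x\<in>e ` {..<n}. f x *\<^sub>R x) = 0" and x: "x \<in> e ` {..<n}"
  have "(\<Sum>a<n. f (e a) *\<^sub>R e a) = 0" using s by (simp add: sum.reindex[OF orthonormal_inj[OF assms]])
  with x show "f x = 0" using orthonormal_coeff[OF assms, of _ "\<lambda>a. f (e a)"] g_simps(7) by force
qed simp

lemma orthonormal_expansion:
  assumes "orthonormal e (DIM('q))"
  shows "v = (\<Sum>a<DIM('q). g v (e a) *\<^sub>R e a)"
proof -
  have "card (e ` {..<DIM('q)}) = DIM('q)" using orthonormal_inj[OF assms] by (simp add: card_image)
  then have "UNIV \<subseteq> span (e ` {..<DIM('q)})"
    using orthonormal_independent[OF assms] card_eq_dim[of "e ` {..<DIM('q)}" UNIV] by simp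
  then have "v \<in> span (e ` {..<DIM('q)})" by auto
  then obtain f where "v = (\<Sum>x\<in>e ` {..<DIM('q)}. f x *\<^sub>R x)" by (auto simp: span_finite)
  then have v: "v = (\<Sum>a<DIM('q). f (e a) *\<^sub>R e a)"
    by (simp add: sum.reindex[OF orthonormal_inj[OF assms]])
  have "(\<Sum>a<DIM('q). g v (e a) *\<^sub>R e a) = (\<Sum>a<DIM('q). f (e a) *\<^sub>R e a)"
  proof (rule sum.cong[OF refl])
    fix a assume "a \<in> {..<DIM('q)}"
    then have "g v (e a) = f (e a)"
      using orthonormal_coeff[OF assms, of a "\<lambda>a. f (e a)"] unfolding v[symmetric] by simp
    then show "g v (e a) *\<^sub>R e a = f (e a) *\<^sub>R e a" by simp
  qed
  with v show ?thesis by simp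
qed

text \<open>Gram-Schmidt: while the family is shorter than the dimension, some v lies outside its
  span, and what remains of v after removal of its components is normalised and appended.\<close>

lemma orthonormal_exists: "n \<le> DIM('q) \<Longrightarrow> \<exists>e. orthonormal e n"
proof (induction n)
  case 0
  show ?case by (simp add: orthonormal_def)
next
  case (Suc n)
  then obtain e where e: "orthonormal e n" by auto
  have "dim (e ` {..<n}) \<le> n"
    using dim_le_card'[of "e ` {..<n}"] card_image_le[of "{..<n}" e] by simp
  then have "span (e ` {..<n}) \<noteq> UNIV" using Suc.prems by (metis Suc_n_not_le_n dim_UNIV dim_span le_trans)
  then obtain v where v: "v \<notin> span (e ` {..<n})" by auto
  define w where "w = v - (\<Sum>a<n. g v (e a) *\<^sub>R e a)"
  have "(\<Sum>a<n. g v (e a) *\<^sub>R e a) \<in> span (e ` {..<n})"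
    by (intro span_sum span_scale span_base) auto
  then have "w \<noteq> 0" using v unfolding w_def by auto
  then have w: "g w w > 0" by (rule pos)
  have ort: "g w (e b) = 0" if "b < n" for b
    unfolding w_def using orthonormal_coeff[OF e that, of "\<lambda>a. g v (e a)"] by (simp add: g_simps)
  define e' where "e' a = (if a < n then e a else (1 / sqrt (g w w)) *\<^sub>R w)" for a
  have "orthonormal e' (Suc n)" using e w ort ort[unfolded sym[of w]]
    unfolding orthonormal_def e'_def by (auto simp: less_Suc_eq g_simps)
  then show ?case by blast
qed

lemma riesz:
  assumes f: "linear f"
  obtains u where "\<And>z. g u z = f z"
proof -
  obtain e where e: "orthonormal e (DIM('q))" using orthonormal_exists by blast
  have "g (\<Sum>a<DIM('q). f (e a) *\<^sub>R e a) z = f z" for z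
  proof -
    have "f z = f (\<Sum>a<DIM('q). g z (e a) *\<^sub>R e a)" using orthonormal_expansion[OF e, of z] by simp
    then show ?thesis
      by (simp add: linear_sum[OF f] linear_cmul[OF f] g_sum_left g_simps sym[of z] mult.commute)
  qed
  then show thesis by (rule that)
qed

text \<open>An orthonormal family of maximal length inside \<open>V\<close> must reproduce every
  vector of \<open>V\<close>, since a nonzero remainder could be normalised and added. It serves to
  construct horizontal representatives.\<close>

lemma orthogonal_projection:
  assumes V: "subspace V"
  obtains t where "t \<in> V" "\<And>s. s \<in> V \<Longrightarrow> g (v - t) s = 0"
proof -
  define P where "P n \<longleftrightarrow> (\<exists>e. orthonormal e n \<and> e ` {..<n} \<subseteq> V)" for n
  have "P 0" unfolding P_def orthonormal_def by simp
  have bound: "n \<le> DIM('q)" if "P n" for n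
  proof -
    obtain e where e: "orthonormal e n" using \<open>P n\<close> unfolding P_def by blast
    have "card (e ` {..<n}) = n" using orthonormal_inj[OF e] by (simp add: card_image)
    then show ?thesis using independent_bound[OF orthonormal_independent[OF e]] by simp
  qed
  obtain n where n: "P n" "\<And>m. P m \<Longrightarrow> m \<le> n"
    using GreatestI_nat[of P, OF \<open>P 0\<close>, of "DIM('q)"] Greatest_le_nat[of P _ "DIM('q)"] bound by blast
  obtain e where e: "orthonormal e n" "e ` {..<n} \<subseteq> V" using n(1) unfolding P_def by blast
  define t where "t u = (\<Sum>a<n. g u (e a) *\<^sub>R e a)" for u
  have tV: "t u \<in> V" for u unfolding t_def using e(2) V by (intro subspace_sum subspace_scale) auto
  have ort: "g (u - t u) (e b) = 0" if "b < n" for b u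
    unfolding t_def using orthonormal_coeff[OF e(1) that, of "\<lambda>a. g u (e a)"] by (simp add: g_simps)
  have exact: "t s = s" if s: "s \<in> V" for s
  proof (rule ccontr)
    assume "t s \<noteq> s"
    define w where "w = s - t s"
    have "w \<noteq> 0" "w \<in> V" unfolding w_def using \<open>t s \<noteq> s\<close> s tV V by (auto simp: subspace_diff)
    then have w: "g w w > 0" by (simp add: pos)
    define e' where "e' a = (if a < n then e a else (1 / sqrt (g w w)) *\<^sub>R w)" for a
    have "g w (e b) = 0" if "b < n" for b unfolding w_def by (rule ort[OF that])
    moreover from this have "g (e b) w = 0" if "b < n" for b using that sym[of w "e b"] by simp
    ultimately have "orthonormal e' (Suc n)" using w e(1)
      unfolding orthonormal_def e'_def by (auto simp: less_Suc_eq g_simps)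
    moreover have "e' ` {..<Suc n} \<subseteq> V" using e(2) \<open>w \<in> V\<close> V unfolding e'_def by (auto simp: subspace_scale)
    ultimately have "P (Suc n)" unfolding P_def by blast
    then show False using n(2) by fastforce
  qed
  have "g (v - t v) s = 0" if "s \<in> V" for s
  proof -
    have "g (v - t v) s = g (v - t v) (t s)" using exact[OF that] by simp
    also have "\<dots> = (\<Sum>a<n. g s (e a) * g (v - t v) (e a))" by (simp add: t_def[of s] g_sum_right g_simps)
    also have "\<dots> = 0" by (rule sum.neutral) (simp add: ort)
    finally show ?thesis .
  qed
  then show thesis by (rule that[OF tV])
qed

text \<open>The coefficients of \<open>e'\<close> in the basis e form an orthogonal matrix, by
  \<open>pars\<close>, so the double sum over e collapses to its diagonal. It will be applied to a
  frame and its image under the complex structure.\<close>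

lemma orthonormal_trace_independent:
  fixes B :: "'q \<Rightarrow> 'q \<Rightarrow> 'v::real_vector"
  assumes e: "orthonormal e (DIM('q))" and e': "orthonormal e' (DIM('q))"
    and lin: "\<And>v. linear (\<lambda>u. B u v)" "\<And>u. linear (B u)"
  shows "(\<Sum>a<DIM('q). B (e' a) (e' a)) = (\<Sum>a<DIM('q). B (e a) (e a))"
proof -
  let ?n = "DIM('q)"
  have pars: "(\<Sum>a<?n. g (e' a) (e b) * g (e' a) (e c)) = (if b = c then 1 else 0)" if "b < ?n" "c < ?n" for b c
  proof -
    have "g (e b) (e c) = g (\<Sum>a<?n. g (e b) (e' a) *\<^sub>R e' a) (e c)"
      using orthonormal_expansion[OF e', of "e b"] by simp
    also have "\<dots> = (\<Sum>a<?n. g (e' a) (e b) * g (e' a) (e c))"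
      by (simp add: g_sum_left g_simps sym[of "e b"])
    finally show ?thesis using e that unfolding orthonormal_def by auto
  qed
  have "B (e' a) (e' a) = (\<Sum>b<?n. \<Sum>c<?n. (g (e' a) (e b) * g (e' a) (e c)) *\<^sub>R B (e b) (e c))" for a
  proof -
    have "B (e' a) (e' a) = B (\<Sum>b<?n. g (e' a) (e b) *\<^sub>R e b) (\<Sum>c<?n. g (e' a) (e c) *\<^sub>R e c)"
      using orthonormal_expansion[OF e, of "e' a"] by simp
    also have "\<dots> = (\<Sum>b<?n. g (e' a) (e b) *\<^sub>R B (e b) (\<Sum>c<?n. g (e' a) (e c) *\<^sub>R e c))"
      by (simp add: linear_sum[OF lin(1)] linear_cmul[OF lin(1)])
    also have "\<dots> = (\<Sum>b<?n. \<Sum>c<?n. (g (e' a) (e b) * g (e' a) (e c)) *\<^sub>R B (e b) (e c))"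
      by (simp add: linear_sum[OF lin(2)] linear_cmul[OF lin(2)] scaleR_sum_right)
    finally show ?thesis .
  qed
  then have "(\<Sum>a<?n. B (e' a) (e' a)) = (\<Sum>a<?n. \<Sum>b<?n. \<Sum>c<?n. (g (e' a) (e b) * g (e' a) (e c)) *\<^sub>R B (e b) (e c))"
    by simp
  also have "\<dots> = (\<Sum>b<?n. \<Sum>c<?n. \<Sum>a<?n. (g (e' a) (e b) * g (e' a) (e c)) *\<^sub>R B (e b) (e c))"
  proof -
    have "(\<Sum>a<?n. \<Sum>c<?n. (g (e' a) (e b) * g (e' a) (e c)) *\<^sub>R B (e b) (e c)) =
        (\<Sum>c<?n. \<Sum>a<?n. (g (e' a) (e b) * g (e' a) (e c)) *\<^sub>R B (e b) (e c))" for b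
      by (rule sum.swap)
    then show ?thesis
      using sum.swap[of "\<lambda>a b. \<Sum>c<?n. (g (e' a) (e b) * g (e' a) (e c)) *\<^sub>R B (e b) (e c)" "{..<?n}" "{..<?n}"]
      by simp
  qed
  also have "\<dots> = (\<Sum>b<?n. \<Sum>c<?n. (if b = c then 1 else 0) *\<^sub>R B (e b) (e c))"
    by (intro sum.cong refl) (simp add: pars flip: scaleR_sum_left)
  also have "\<dots> = (\<Sum>b<?n. B (e b) (e b))"
    by (simp add: if_distrib[of "\<lambda>x. x *\<^sub>R _"] cong: if_cong)
  finally show ?thesis .
qed

end

section \<open>Hermitian metrics in a chart\<close>

text \<open>A field of inner products near one point of a chart. Away from \<open>q0\<close> only
  the algebra is kept, since the metric is differentiated once and only at
  \<open>q0\<close>.\<close>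

locale metric_germ =
  fixes g :: "'q::euclidean_space \<Rightarrow> 'q \<Rightarrow> 'q \<Rightarrow> real" and q0 :: 'q and S :: "'q set"
  assumes S: "open S" "q0 \<in> S"
    and inner_form: "q \<in> S \<Longrightarrow> inner_form (g q)"
    and dg: "(\<lambda>q. g q u v) differentiable at q0"
begin

sublocale inner_form "g q0" by (rule inner_form[OF S(2)])

lemma bilq: "q \<in> S \<Longrightarrow> bilinear (g q)"
  using inner_form inner_form.bil by blast

lemma symq: "q \<in> S \<Longrightarrow> g q u v = g q v u"
  using inner_form inner_form.sym by blast

lemma Df_cong_S: "(\<And>q. q \<in> S \<Longrightarrow> f q = h q) \<Longrightarrow> Df f q0 u = Df h q0 u"
  using S by (intro Df_cong_ev) (auto simp: eventually_nhds)

lemma Dg_sym: "Df (\<lambda>q. g q u v) q0 x = Df (\<lambda>q. g q v u) q0 x"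
  by (rule Df_cong_S) (rule symq)

lemma Dg_linear:
  "Df (\<lambda>q. g q (u + u') v) q0 x = Df (\<lambda>q. g q u v) q0 x + Df (\<lambda>q. g q u' v) q0 x"
  "Df (\<lambda>q. g q (c *\<^sub>R u) v) q0 x = c * Df (\<lambda>q. g q u v) q0 x"
proof -
  have "Df (\<lambda>q. g q (u + u') v) q0 x = Df (\<lambda>q. g q u v + g q u' v) q0 x"
    by (rule Df_cong_S) (simp add: bilinear_ladd[OF bilq])
  also have "\<dots> = Df (\<lambda>q. g q u v) q0 x + Df (\<lambda>q. g q u' v) q0 x"
    by (rule Df_eqI) (intro has_derivative_add has_derivative_Df dg)
  finally show "Df (\<lambda>q. g q (u + u') v) q0 x = Df (\<lambda>q. g q u v) q0 x + Df (\<lambda>q. g q u' v) q0 x" .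
  have "Df (\<lambda>q. g q (c *\<^sub>R u) v) q0 x = Df (\<lambda>q. c * g q u v) q0 x"
    by (rule Df_cong_S) (simp add: bilinear_lmul[OF bilq])
  also have "\<dots> = c * Df (\<lambda>q. g q u v) q0 x"
    by (rule Df_eqI) (intro has_derivative_mult_right has_derivative_Df dg)
  finally show "Df (\<lambda>q. g q (c *\<^sub>R u) v) q0 x = c * Df (\<lambda>q. g q u v) q0 x" .
qed

lemma Dg_linear_right:
  "Df (\<lambda>q. g q v (u + u')) q0 x = Df (\<lambda>q. g q v u) q0 x + Df (\<lambda>q. g q v u') q0 x"
  "Df (\<lambda>q. g q v (c *\<^sub>R u)) q0 x = c * Df (\<lambda>q. g q v u) q0 x"
  unfolding Dg_sym[of v] by (rule Dg_linear)+

text \<open>The right-hand side is linear in z, so \<open>riesz\<close> produces the vector, and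
  nondegeneracy makes it unique. This gives the definite description in \<open>christoffel\<close>
  its meaning.\<close>

lemma christoffel_exists:
  "\<exists>!\<gamma>. \<forall>z. 2 * g q0 \<gamma> z =
      Df (\<lambda>q. g q w z) q0 u + Df (\<lambda>q. g q u z) q0 w - Df (\<lambda>q. g q u w) q0 z"
proof -
  have "linear (\<lambda>z. (Df (\<lambda>q. g q w z) q0 u + Df (\<lambda>q. g q u z) q0 w - Df (\<lambda>q. g q u w) q0 z) / 2)"
    by (rule linearI)
      (simp_all add: Dg_linear_right Df_linear[OF dg] algebra_simps add_divide_distrib diff_divide_distrib)
  then obtain \<gamma> where \<gamma>: "\<And>z. g q0 \<gamma> z = (Df (\<lambda>q. g q w z) q0 u + Df (\<lambda>q. g q u z) q0 w - Df (\<lambda>q. g q u w) q0 z) / 2"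
    using riesz by blast
  show ?thesis
  proof (rule ex1I[of _ \<gamma>])
    fix \<gamma>'
    assume *: "\<forall>z. 2 * g q0 \<gamma>' z = Df (\<lambda>q. g q w z) q0 u + Df (\<lambda>q. g q u z) q0 w - Df (\<lambda>q. g q u w) q0 z"
    show "\<gamma>' = \<gamma>"
    proof (rule nondegenerate)
      fix z show "g q0 \<gamma>' z = g q0 \<gamma> z" using *[rule_format, of z] \<gamma>[of z] by simp
    qed
  qed (simp add: \<gamma>)
qed

end

text \<open>The relations of the complex structure are required on all of \<open>S\<close> because
  they get differentiated at \<open>q0\<close>. \<open>\<Gamma>\<close> is known only through the
  Koszul formula at \<open>q0\<close>, from which its symmetry and bilinearity are derived.\<close>

locale hermitian_germ = metric_germ g q0 S
  for g :: "'q::euclidean_space \<Rightarrow> 'q \<Rightarrow> 'q \<Rightarrow> real" and q0 :: 'q and S :: "'q set" +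
  fixes K :: "'q \<Rightarrow> 'q \<Rightarrow> 'q" and \<Gamma> :: "'q \<Rightarrow> 'q \<Rightarrow> 'q"
  assumes lin: "q \<in> S \<Longrightarrow> linear (K q)"
    and K_K: "q \<in> S \<Longrightarrow> K q (K q u) = - u"
    and g_K_K: "q \<in> S \<Longrightarrow> g q (K q u) (K q v) = g q u v"
    and dK: "(\<lambda>q. K q u) differentiable at q0"
    and koszul: "2 * g q0 (\<Gamma> u w) z =
      Df (\<lambda>q. g q w z) q0 u + Df (\<lambda>q. g q u z) q0 w - Df (\<lambda>q. g q u w) q0 z"
begin

lemma DK_linear:
  "Df (\<lambda>q. K q (u + v)) q0 x = Df (\<lambda>q. K q u) q0 x + Df (\<lambda>q. K q v) q0 x"
  "Df (\<lambda>q. K q (c *\<^sub>R u)) q0 x = c *\<^sub>R Df (\<lambda>q. K q u) q0 x"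
proof -
  have "Df (\<lambda>q. K q (u + v)) q0 x = Df (\<lambda>q. K q u + K q v) q0 x"
    by (rule Df_cong_S) (simp add: linear_add[OF lin])
  also have "\<dots> = Df (\<lambda>q. K q u) q0 x + Df (\<lambda>q. K q v) q0 x"
    by (rule Df_eqI) (intro has_derivative_add has_derivative_Df dK)
  finally show "Df (\<lambda>q. K q (u + v)) q0 x = Df (\<lambda>q. K q u) q0 x + Df (\<lambda>q. K q v) q0 x" .
  have "Df (\<lambda>q. K q (c *\<^sub>R u)) q0 x = Df (\<lambda>q. c *\<^sub>R K q u) q0 x"
    by (rule Df_cong_S) (simp add: linear_cmul[OF lin])
  also have "\<dots> = c *\<^sub>R Df (\<lambda>q. K q u) q0 x"
    by (rule Df_eqI) (intro has_derivative_scaleR_right has_derivative_Df dK)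
  finally show "Df (\<lambda>q. K q (c *\<^sub>R u)) q0 x = c *\<^sub>R Df (\<lambda>q. K q u) q0 x" .
qed

lemma christoffel_sym: "\<Gamma> u w = \<Gamma> w u"
proof (rule nondegenerate)
  fix z show "g q0 (\<Gamma> u w) z = g q0 (\<Gamma> w u) z"
    using koszul[of u w z] koszul[of w u z] Dg_sym[of u w z] by simp
qed

lemma christoffel_linear: "linear (\<Gamma> u)"
proof (rule linearI)
  fix v w
  show "\<Gamma> u (v + w) = \<Gamma> u v + \<Gamma> u w"
  proof (rule nondegenerate)
    fix z
    have "2 * g q0 (\<Gamma> u (v + w)) z = 2 * (g q0 (\<Gamma> u v) z + g q0 (\<Gamma> u w) z)"
      by (simp only: distrib_left koszul) (simp add: Dg_linear Dg_linear_right Df_linear[OF dg])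
    then show "g q0 (\<Gamma> u (v + w)) z = g q0 (\<Gamma> u v + \<Gamma> u w) z" by (simp add: g_simps)
  qed
next
  fix c v
  show "\<Gamma> u (c *\<^sub>R v) = c *\<^sub>R \<Gamma> u v"
  proof (rule nondegenerate)
    fix z
    have "2 * g q0 (\<Gamma> u (c *\<^sub>R v)) z = c * (2 * g q0 (\<Gamma> u v) z)"
      by (simp only: koszul) (simp add: Dg_linear Dg_linear_right Df_linear[OF dg] algebra_simps)
    then show "g q0 (\<Gamma> u (c *\<^sub>R v)) z = g q0 (c *\<^sub>R \<Gamma> u v) z" by (simp add: g_simps)
  qed
qed

lemma christoffel_linear_left: "linear (\<lambda>u. \<Gamma> u w)"
  using christoffel_linear[of w] by (subst christoffel_sym)

text \<open>Two instances of the Koszul formula, with y and z exchanged, are added; the derivatives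
  in the directions y and z cancel.\<close>

lemma metric_compatible: "Df (\<lambda>q. g q y z) q0 u = g q0 (\<Gamma> u y) z + g q0 y (\<Gamma> u z)"
proof -
  have "2 * (g q0 (\<Gamma> u y) z + g q0 (\<Gamma> u z) y) = 2 * Df (\<lambda>q. g q y z) q0 u"
    using koszul[of u y z] koszul[of u z y] Dg_sym[of y z u] by simp
  then show ?thesis using sym[of y "\<Gamma> u z"] by simp
qed

text \<open>The components in the chart of (\<nabla>_u J) y; the \<Gamma> terms come from the two
  slots of an endomorphism.\<close>

definition nabla_K :: "'q \<Rightarrow> 'q \<Rightarrow> 'q" where
  "nabla_K u y = Df (\<lambda>q. K q y) q0 u + \<Gamma> u (K q0 y) - K q0 (\<Gamma> u y)"

lemma nabla_K_linear: "linear (nabla_K u)"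
  unfolding nabla_K_def
  by (rule linearI)
    (simp_all add: DK_linear linear_add[OF christoffel_linear] linear_cmul[OF christoffel_linear]
      linear_add[OF lin[OF S(2)]] linear_cmul[OF lin[OF S(2)]] algebra_simps)

lemma nabla_K_linear_left: "linear (\<lambda>u. nabla_K u y)"
  unfolding nabla_K_def
  by (rule linearI)
    (simp_all add: Df_linear[OF dK] linear_add[OF christoffel_linear_left] linear_cmul[OF christoffel_linear_left]
      linear_add[OF lin[OF S(2)]] linear_cmul[OF lin[OF S(2)]] algebra_simps)

text \<open>By metric compatibility the derivative of \<open>g\<close> at fixed vectors is absorbed
  into the covariant derivatives of the sections along \<open>F\<close>, such as
  \<open>s' X + \<Gamma> (F' X) (s y0)\<close>, and the product rule takes its covariant
  form.\<close>

lemma has_derivative_g: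
  assumes "(F has_derivative F') (at y0)" "F y0 = q0"
    and "(s has_derivative s') (at y0)" and "(t has_derivative t') (at y0)"
  shows "((\<lambda>y. g (F y) (s y) (t y)) has_derivative
     (\<lambda>X. g q0 (s' X + \<Gamma> (F' X) (s y0)) (t y0) + g q0 (s y0) (t' X + \<Gamma> (F' X) (t y0)))) (at y0)"
proof (rule has_derivative_eq_rhs[OF has_derivative_bilinear_family[where g = g, OF S bilq dg assms]])
  show "(\<lambda>X. Df (\<lambda>q. g q (s y0) (t y0)) q0 (F' X) + g q0 (s' X) (t y0) + g q0 (s y0) (t' X)) =
    (\<lambda>X. g q0 (s' X + \<Gamma> (F' X) (s y0)) (t y0) + g q0 (s y0) (t' X + \<Gamma> (F' X) (t y0)))"
    by (rule ext) (simp only: metric_compatible g_simps(1,2) add_ac)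
qed

lemma has_derivative_K:
  assumes "(F has_derivative F') (at y0)" "F y0 = q0" and "(s has_derivative s') (at y0)"
  shows "((\<lambda>y. K (F y) (s y)) has_derivative
     (\<lambda>X. Df (\<lambda>q. K q (s y0)) q0 (F' X) + K q0 (s' X))) (at y0)"
  by (rule has_derivative_linear_family[OF S lin dK assms])

text \<open>Obtained by differentiating \<open>K q (K q y) = - y\<close>; the \<Gamma> terms of the
  two sides match because \<open>K q0\<close> squares to minus the identity.\<close>

lemma nabla_K_K: "nabla_K u (K q0 y) = - K q0 (nabla_K u y)"
proof -
  have "((\<lambda>q. K q (K q y)) has_derivative (\<lambda>u. Df (\<lambda>q. K q (K q0 y)) q0 u + K q0 (Df (\<lambda>q. K q y) q0 u))) (at q0)"
    by (rule has_derivative_K[OF has_derivative_ident refl has_derivative_Df[OF dK]])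
  then have "Df (\<lambda>q. K q (K q0 y)) q0 u + K q0 (Df (\<lambda>q. K q y) q0 u) = Df (\<lambda>q. K q (K q y)) q0 u"
    by (rule Df_eqI[symmetric])
  also have "\<dots> = Df (\<lambda>q. - y) q0 u" by (rule Df_cong_S) (rule K_K)
  also have "\<dots> = 0" by simp
  finally have "Df (\<lambda>q. K q (K q0 y)) q0 u = - K q0 (Df (\<lambda>q. K q y) q0 u)"
    by (simp add: eq_neg_iff_add_eq_0)
  then show ?thesis unfolding nabla_K_def
    by (simp add: linear_add[OF lin[OF S(2)]] linear_diff[OF lin[OF S(2)]] K_K[OF S(2)] linear_neg[OF christoffel_linear])
qed

lemma g_K_skew: "q \<in> S \<Longrightarrow> g q (K q y) z = - g q y (K q z)"
  using g_K_K[of q y "K q z"] by (simp add: K_K bilinear_rneg[OF bilq])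

text \<open>Obtained by differentiating \<open>g q (K q y) z = - g q y (K q z)\<close> with the
  covariant product rule.\<close>

lemma nabla_K_skew: "g q0 (nabla_K u y) z = - g q0 y (nabla_K u z)"
proof -
  have 1: "((\<lambda>q. g q (K q y) z) has_derivative
     (\<lambda>u. g q0 (Df (\<lambda>q. K q y) q0 u + \<Gamma> u (K q0 y)) z + g q0 (K q0 y) (0 + \<Gamma> u z))) (at q0)"
    by (rule has_derivative_g[OF has_derivative_ident refl has_derivative_Df[OF dK] has_derivative_const])
  have 2: "((\<lambda>q. g q y (K q z)) has_derivative
     (\<lambda>u. g q0 (0 + \<Gamma> u y) (K q0 z) + g q0 y (Df (\<lambda>q. K q z) q0 u + \<Gamma> u (K q0 z)))) (at q0)"
    by (rule has_derivative_g[OF has_derivative_ident refl has_derivative_const has_derivative_Df[OF dK]])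
  have "g q0 (Df (\<lambda>q. K q y) q0 u + \<Gamma> u (K q0 y)) z + g q0 (K q0 y) (0 + \<Gamma> u z)
     = Df (\<lambda>q. g q (K q y) z) q0 u" by (rule Df_eqI[OF 1, symmetric])
  also have "\<dots> = Df (\<lambda>q. - g q y (K q z)) q0 u" by (rule Df_cong_S) (rule g_K_skew)
  also have "\<dots> = - (g q0 (0 + \<Gamma> u y) (K q0 z) + g q0 y (Df (\<lambda>q. K q z) q0 u + \<Gamma> u (K q0 z)))"
    by (rule Df_eqI[OF has_derivative_minus[OF 2]])
  finally show ?thesis using g_K_skew[OF S(2), of y "\<Gamma> u z"] g_K_skew[OF S(2), of "\<Gamma> u y" z]
    unfolding nabla_K_def by (simp add: g_simps)
qed

text \<open>The derivatives of the sections s and t cancel against the two correction terms, so that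
  \<nabla>F depends on the extensions only through their values at y0.\<close>

lemma nabla_fundamental_chart:
  assumes F: "(F has_derivative F') (at y0)" "F y0 = q0"
    and s: "(s has_derivative s') (at y0)" and t: "(t has_derivative t') (at y0)"
  shows "Df (\<lambda>y. g (F y) (K (F y) (s y)) (t y)) y0 X
      - g q0 (K q0 (s' X + \<Gamma> (F' X) (s y0))) (t y0) - g q0 (K q0 (s y0)) (t' X + \<Gamma> (F' X) (t y0))
    = g q0 (nabla_K (F' X) (s y0)) (t y0)"
  using Df_eqI[OF has_derivative_g[OF F has_derivative_K[OF F s] t], of X] F(2)
  unfolding nabla_K_def by (simp add: g_simps linear_add[OF lin[OF S(2)]])

end

section \<open>The vanishing of the trace in charts\<close>

text \<open>\<open>N X Y\<close> stands for \<nabla>_X Y, of which only the image under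
  \<open>Df F y0\<close> is determined. In \<open>hol\<close> the vector w represents J v and may
  depend on y without any regularity; \<open>cos\<close> and \<open>symp\<close> are the conditions
  on source and target in the paired form in which J X accompanies X.\<close>

theorem holomorphic_trace_zero:
  fixes F :: "'e::euclidean_space \<Rightarrow> 'q::euclidean_space" and H :: "'e \<Rightarrow> 'r::euclidean_space"
    and g :: "'q \<Rightarrow> 'q \<Rightarrow> 'q \<Rightarrow> real" and g' :: "'r \<Rightarrow> 'r \<Rightarrow> 'r \<Rightarrow> real"
  assumes T: "hermitian_germ g q0 S K \<Gamma>" and T': "hermitian_germ g' r0 S' K' \<Gamma>'"
    and F2: "twice_differentiable_at F y0" "F y0 = q0" and H2: "twice_differentiable_at H y0" "H y0 = r0"
    and surj: "surj (Df F y0)"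
    and ker: "\<forall>\<^sub>F y in nhds y0. \<forall>w. Df F y w = 0 \<longrightarrow> Df H y w = 0"
    and hol: "\<forall>\<^sub>F y in nhds y0. \<forall>v. \<exists>w. Df F y w = K (F y) (Df F y v) \<and> Df H y w = K' (H y) (Df H y v)"
    and N: "\<And>X Y. Df F y0 (N X Y) = D2f F y0 X Y + \<Gamma> (Df F y0 X) (Df F y0 Y)"
    and e: "inner_form.orthonormal (g q0) (\<lambda>a. Df F y0 (e a)) (DIM('q))"
    and cos: "(\<Sum>a<DIM('q). hermitian_germ.nabla_K q0 K \<Gamma> (Df F y0 (e a)) (Df F y0 (e a))
        + hermitian_germ.nabla_K q0 K \<Gamma> (K q0 (Df F y0 (e a))) (K q0 (Df F y0 (e a)))) = 0"
    and symp: "\<And>\<xi>. hermitian_germ.nabla_K r0 K' \<Gamma>' \<xi> \<xi>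
        + hermitian_germ.nabla_K r0 K' \<Gamma>' (K' r0 \<xi>) (K' r0 \<xi>) = 0"
  shows "(\<Sum>a<DIM('q). D2f H y0 (e a) (e a) + \<Gamma>' (Df H y0 (e a)) (Df H y0 (e a)) - Df H y0 (N (e a) (e a))) = 0"
proof -
  interpret T: hermitian_germ g q0 S K \<Gamma> by (rule T)
  interpret T': hermitian_germ g' r0 S' K' \<Gamma>' by (rule T')
  have F1: "F differentiable at y0" and H1: "H differentiable at y0"
    using F2 H2 by (auto intro: twice_differentiable_imp_differentiable)
  have ev: "\<forall>\<^sub>F y in nhds y0. F differentiable at y" "\<forall>\<^sub>F y in nhds y0. H differentiable at y"
    using F2(1) H2(1) unfolding twice_differentiable_at_def by auto
  have evF: "\<forall>\<^sub>F y in nhds y0. linear (Df F y)" and evH: "\<forall>\<^sub>F y in nhds y0. linear (Df H y)"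
    using ev by (auto elim: eventually_mono intro: linear_frechet_derivative)
  have dF: "(\<lambda>y. Df F y w) differentiable at y0" and dH: "(\<lambda>y. Df H y w) differentiable at y0" for w
    using F2 H2 unfolding twice_differentiable_at_def by auto
  have linF: "linear (Df F y0)" and linH: "linear (Df H y0)"
    using F1 H1 by (auto intro: linear_frechet_derivative)
  obtain R where R: "linear R" "Df F y0 \<circ> R = id"
    using linear_surjective_right_inverse[OF linF surj] by blast
  have LR: "Df F y0 (R u) = u" for u using R(2) by (metis comp_apply id_apply)
  \<comment> \<open>\<open>A\<close> is the induced map between normal spaces: since
    \<open>Df H y0\<close> kills the kernel of \<open>Df F y0\<close>, the choice of the right
    inverse \<open>R\<close> does not matter.\<close>
  define A where "A u = Df H y0 (R u)" for u
  have linA: "linear A" unfolding A_def using linear_compose[OF R(1) linH] by (simp add: o_def)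
  have A: "Df H y0 v = A (Df F y0 v)" for v
  proof -
    have "Df F y0 (v - R (Df F y0 v)) = 0" by (simp add: linear_diff[OF linF] LR)
    then have "Df H y0 (v - R (Df F y0 v)) = 0" using eventually_nhds_x_imp_x[OF ker] by blast
    then show ?thesis unfolding A_def by (simp add: linear_diff[OF linH])
  qed
  define \<beta> where "\<beta> X Y = D2f H y0 X Y + \<Gamma>' (Df H y0 X) (Df H y0 Y)
     - A (D2f F y0 X Y + \<Gamma> (Df F y0 X) (Df F y0 Y))" for X Y
  have symD: "D2f F y0 X Y = D2f F y0 Y X" "D2f H y0 X Y = D2f H y0 Y X" for X Y
    using F2(1) H2(1) by (auto intro: symmetric_second_derivative)
  have sym: "\<beta> X Y = \<beta> Y X" for X Y
    unfolding \<beta>_def using symD[of X Y] T.christoffel_sym[of "Df F y0 X"] T'.christoffel_sym[of "Df H y0 X"]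
    by simp
  have lin1: "linear (\<lambda>X. \<beta> X Y)" for Y
    unfolding \<beta>_def
    by (rule linearI)
      (simp_all add: Df_linear[OF dH] Df_linear[OF dF] Df_linear[OF F1] Df_linear[OF H1]
        linear_add[OF linA] linear_cmul[OF linA] linear_add[OF T.christoffel_linear_left]
        linear_add[OF T'.christoffel_linear_left] linear_cmul[OF T.christoffel_linear_left]
        linear_cmul[OF T'.christoffel_linear_left] algebra_simps)
  have lin2: "linear (\<beta> X)" for X using lin1[of X] by (subst (asm) sym)
  have tens: "\<beta> X k = 0" if k: "Df F y0 k = 0" for X k
  proof -
    \<comment> \<open>The inclusion of kernels near y0, an implication with zero right-hand sides,
      is followed from k in the direction X. The vector \<open>R (- D2f F y0 X k)\<close> is the
      velocity that keeps \<open>Df F y w = 0\<close> to first order.\<close>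
    have "Df H y0 (R (- D2f F y0 X k)) + D2f H y0 X k = Df (\<lambda>y. 0) y0 X"
      by (rule implicit_variation[OF evF evH ker surj dF dH])
        (simp_all add: k LR)
    then show ?thesis unfolding \<beta>_def using k
      by (simp add: A linear_0[OF linA] linear_0[OF T.christoffel_linear] linear_0[OF T'.christoffel_linear]
          LR linear_neg[OF linA])
  qed
  have tens2: "\<beta> X Y = \<beta> X' Y'" if "Df F y0 X = Df F y0 X'" "Df F y0 Y = Df F y0 Y'" for X Y X' Y'
  proof -
    have "\<beta> X (Y - Y') = 0" by (rule tens) (use that in \<open>simp add: linear_diff[OF linF]\<close>)
    moreover have "\<beta> Y' (X - X') = 0" by (rule tens) (use that in \<open>simp add: linear_diff[OF linF]\<close>)
    ultimately show ?thesis using sym[of Y' X] sym[of Y' X']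
      by (simp add: linear_diff[OF lin2])
  qed
  define J where "J Y = R (K q0 (Df F y0 Y))" for Y
  have LJ: "Df F y0 (J Y) = K q0 (Df F y0 Y)" for Y unfolding J_def by (rule LR)
  have AK: "A (K q0 u) = K' r0 (A u)" for u
  proof -
    obtain w where "Df F y0 w = K q0 u" "Df H y0 w = K' r0 (Df H y0 (R u))"
      using eventually_nhds_x_imp_x[OF hol] F2(2) H2(2) LR by metis
    then show ?thesis unfolding A_def using A[of w] by (simp add: A_def)
  qed
  have shift: "\<beta> X (J Y) = T'.nabla_K (A (Df F y0 X)) (A (Df F y0 Y)) + K' r0 (\<beta> X Y)
      - A (T.nabla_K (Df F y0 X) (Df F y0 Y))" for X Y
  proof -
    define a where "a y = K (F y) (Df F y Y)" for y
    define b where "b y = K' (H y) (Df H y Y)" for y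
    have imp: "\<forall>\<^sub>F y in nhds y0. \<forall>w. Df F y w = a y \<longrightarrow> Df H y w = b y"
      using hol ker evF evH
    proof eventually_elim
      case (elim y)
      show ?case
      proof (intro allI impI)
        fix w assume w: "Df F y w = a y"
        obtain v where v: "Df F y v = a y" "Df H y v = b y" using elim(1) unfolding a_def b_def by blast
        have "Df F y (w - v) = 0" using v w by (simp add: linear_diff[OF elim(3)])
        then have "Df H y (w - v) = 0" using elim(2) by blast
        then show "Df H y w = b y" using v by (simp add: linear_diff[OF elim(4)])
      qed
    qed
    have a': "(a has_derivative (\<lambda>X. Df (\<lambda>q. K q (Df F y0 Y)) q0 (Df F y0 X) + K q0 (D2f F y0 X Y))) (at y0)"
      unfolding a_def by (rule T.has_derivative_K[OF has_derivative_Df[OF F1] F2(2) has_derivative_Df[OF dF]])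
    have a0: "a y0 = K q0 (Df F y0 Y)" unfolding a_def F2(2) ..
    have b': "(b has_derivative (\<lambda>X. Df (\<lambda>q. K' q (Df H y0 Y)) r0 (Df H y0 X) + K' r0 (D2f H y0 X Y))) (at y0)"
      unfolding b_def by (rule T'.has_derivative_K[OF has_derivative_Df[OF H1] H2(2) has_derivative_Df[OF dH]])
    \<comment> \<open>The velocity of a solution w of \<open>Df F y w = a y\<close> that starts at
      \<open>J Y\<close>; its image under \<open>Df H y0\<close> is then computed through
      \<open>A\<close>.\<close>
    define n where "n = R (Df a y0 X - D2f F y0 X (J Y))"
    have "Df H y0 n + D2f H y0 X (J Y) = Df b y0 X"
      by (rule implicit_variation[OF evF evH imp surj dF dH])
        (use differentiableI[OF a'] differentiableI[OF b'] a0 in \<open>simp_all add: LJ n_def LR\<close>)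
    then have "D2f H y0 X (J Y) = Df b y0 X - A (Df a y0 X - D2f F y0 X (J Y))"
      unfolding n_def by (simp add: A LR algebra_simps)
    then show ?thesis
      unfolding \<beta>_def T.nabla_K_def T'.nabla_K_def Df_eqI[OF a'] Df_eqI[OF b']
      by (simp add: A LJ AK linear_add[OF linA] linear_diff[OF linA] linear_add[OF T'.lin[OF T'.S(2)]]
          linear_diff[OF T'.lin[OF T'.S(2)]] linear_add[OF T.lin[OF T.S(2)]] algebra_simps)
  qed
  \<comment> \<open>\<open>shift\<close> is applied twice, with the symmetry of \<beta> moving the
    first \<open>J\<close> to the other slot in between; the two factors \<open>K' r0\<close> then
    yield \<open>- \<beta> X X\<close>. Anticommutation of \<open>nabla_K\<close> with the complex
    structure gathers the remaining terms into the sums that occur in \<open>symp\<close> and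
    \<open>cos\<close>.\<close>
  have pair: "\<beta> (J X) (J X) + \<beta> X X = - A (K q0 (T.nabla_K (Df F y0 X) (Df F y0 X)
      + T.nabla_K (K q0 (Df F y0 X)) (K q0 (Df F y0 X))))" for X
  proof -
    let ?x = "Df F y0 X" and ?\<xi> = "A (Df F y0 X)"
    have "\<beta> (J X) X = T'.nabla_K ?\<xi> ?\<xi> + K' r0 (\<beta> X X) - A (T.nabla_K ?x ?x)"
      using shift[of X X] sym by simp
    moreover have "\<beta> (J X) (J X) = T'.nabla_K (K' r0 ?\<xi>) ?\<xi> + K' r0 (\<beta> (J X) X) - A (T.nabla_K (K q0 ?x) ?x)"
      using shift[of "J X" X] by (simp add: LJ AK)
    ultimately have "\<beta> (J X) (J X) + \<beta> X X = T'.nabla_K (K' r0 ?\<xi>) ?\<xi> + K' r0 (T'.nabla_K ?\<xi> ?\<xi>)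
        - A (T.nabla_K (K q0 ?x) ?x + K q0 (T.nabla_K ?x ?x))"
      by (simp add: linear_add[OF T'.lin[OF T'.S(2)]] linear_diff[OF T'.lin[OF T'.S(2)]] T'.K_K[OF T'.S(2)]
          linear_add[OF linA] AK)
    moreover have "T'.nabla_K (K' r0 ?\<xi>) ?\<xi> + K' r0 (T'.nabla_K ?\<xi> ?\<xi>)
        = K' r0 (T'.nabla_K ?\<xi> ?\<xi> + T'.nabla_K (K' r0 ?\<xi>) (K' r0 ?\<xi>))"
      by (simp add: linear_add[OF T'.lin[OF T'.S(2)]] linear_diff[OF T'.lin[OF T'.S(2)]] T'.nabla_K_K linear_neg[OF T'.lin[OF T'.S(2)]] T'.K_K[OF T'.S(2)])
    moreover have "T.nabla_K (K q0 ?x) ?x + K q0 (T.nabla_K ?x ?x)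
        = K q0 (T.nabla_K ?x ?x + T.nabla_K (K q0 ?x) (K q0 ?x))"
      by (simp add: linear_add[OF T.lin[OF T.S(2)]] linear_diff[OF T.lin[OF T.S(2)]] T.nabla_K_K linear_neg[OF T.lin[OF T.S(2)]] T.K_K[OF T.S(2)])
    ultimately show ?thesis using symp[of ?\<xi>]
      by (simp only: linear_0[OF T'.lin[OF T'.S(2)]] diff_0)
  qed
  \<comment> \<open>By \<open>tens2\<close> the form descends to the normal space, where the frame
    and its image under \<open>K q0\<close> are orthonormal bases, so that both have the same
    trace.\<close>
  define B where "B u v = \<beta> (R u) (R v)" for u v
  have B: "\<beta> X Y = B (Df F y0 X) (Df F y0 Y)" for X Y
    unfolding B_def by (rule tens2) (simp_all add: LR)
  have linB: "linear (\<lambda>u. B u v)" "linear (B u)" for u v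
    unfolding B_def using linear_compose[OF R(1) lin1] linear_compose[OF R(1) lin2] by (simp_all add: o_def)
  have e': "T.orthonormal (\<lambda>a. K q0 (Df F y0 (e a))) (DIM('q))"
    using e unfolding T.orthonormal_def by (simp add: T.g_K_K[OF T.S(2)])
  have inv: "(\<Sum>a<DIM('q). \<beta> (J (e a)) (J (e a))) = (\<Sum>a<DIM('q). \<beta> (e a) (e a))"
    unfolding B LJ using T.orthonormal_trace_independent[where B = B, OF e e' linB] .
  have "(\<Sum>a<DIM('q). \<beta> (J (e a)) (J (e a))) + (\<Sum>a<DIM('q). \<beta> (e a) (e a)) = - A (K q0 (\<Sum>a<DIM('q).
      T.nabla_K (Df F y0 (e a)) (Df F y0 (e a)) + T.nabla_K (K q0 (Df F y0 (e a))) (K q0 (Df F y0 (e a)))))"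
    by (simp only: linear_sum[OF T.lin[OF T.S(2)]] linear_sum[OF linA] flip: sum.distrib sum_negf)
      (simp only: pair)
  also have "\<dots> = 0" unfolding cos by (simp add: linear_0[OF linA] linear_0[OF T.lin[OF T.S(2)]])
  finally have "(\<Sum>a<DIM('q). \<beta> (J (e a)) (J (e a))) + (\<Sum>a<DIM('q). \<beta> (e a) (e a)) = 0" .
  then have "2 *\<^sub>R (\<Sum>a<DIM('q). \<beta> (e a) (e a)) = 0" unfolding inv by (simp only: scaleR_2)
  then have "(\<Sum>a<DIM('q). \<beta> (e a) (e a)) = 0" by simp
  then show ?thesis unfolding \<beta>_def by (simp add: A N)
qed

section \<open>Leaves and fibres\<close>

text \<open>A member of the cover that meets the set of points reachable from x contains no
  unreachable point of \<open>C\<close>. The unions of the members meeting either part would thus be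
  two open sets separating \<open>C\<close>.\<close>

lemma connectedin_chain:
  assumes conn: "connectedin X C" and op: "\<And>V. V \<in> \<V> \<Longrightarrow> openin X V" and cov: "C \<subseteq> \<Union>\<V>"
    and R: "\<And>V p q. \<lbrakk>V \<in> \<V>; p \<in> V \<inter> C; q \<in> V \<inter> C\<rbrakk> \<Longrightarrow> (p, q) \<in> R"
    and xy: "x \<in> C" "y \<in> C"
  shows "(x, y) \<in> R\<^sup>*"
proof (rule ccontr)
  assume n: "(x, y) \<notin> R\<^sup>*"
  define A where "A = {p \<in> C. (x, p) \<in> R\<^sup>*}"
  define E1 where "E1 = \<Union>{V \<in> \<V>. V \<inter> A \<noteq> {}}"
  define E2 where "E2 = \<Union>{V \<in> \<V>. V \<inter> (C - A) \<noteq> {}}"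
  have A_closed: "V \<inter> C \<subseteq> A" if "V \<in> \<V>" "V \<inter> A \<noteq> {}" for V
  proof -
    obtain p where p: "p \<in> V" "p \<in> A" using \<open>V \<inter> A \<noteq> {}\<close> by blast
    show ?thesis
    proof
      fix q assume "q \<in> V \<inter> C"
      then have "(p, q) \<in> R" using R[OF that(1)] p unfolding A_def by blast
      then show "q \<in> A" using p(2) \<open>q \<in> V \<inter> C\<close> unfolding A_def by (auto intro: rtrancl_into_rtrancl)
    qed
  qed
  have 1: "E1 \<inter> C \<subseteq> A" unfolding E1_def using A_closed by blast
  have 2: "E2 \<inter> A = {}"
  proof -
    have "V \<inter> A = {}" if "V \<in> \<V>" "V \<inter> (C - A) \<noteq> {}" for V using A_closed[OF that(1)] that(2) by blast
    then show ?thesis unfolding E2_def by blast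
  qed
  have 3: "A \<subseteq> E1" "C - A \<subseteq> E2" unfolding E1_def E2_def using cov A_def by blast+
  have "openin X E1" "openin X E2" unfolding E1_def E2_def using op by auto
  moreover have "x \<in> A" "y \<in> C - A" using xy n unfolding A_def by auto
  then have "E1 \<inter> C \<noteq> {}" "E2 \<inter> C \<noteq> {}" using 3 xy by blast+
  moreover have "C \<subseteq> E1 \<union> E2" using 3 by blast
  moreover have "E1 \<inter> E2 \<inter> C = {}" using 1 2 by blast
  ultimately show False using conn unfolding connectedin by metis
qed

text \<open>Induction on the length of a chain. A plaque is recorded as an index with a value; by
  \<open>tr\<close>, the plaque of i entered from a given plaque of j is the same wherever the
  overlap is crossed. So the plaques reached after one more step are indexed by \<open>I\<close>
  times the earlier ones.\<close>

lemma countable_chain_values: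
  fixes I :: "('a set \<times> ('a \<Rightarrow> 't)) set"
  assumes I: "countable I"
    and tr: "\<And>U f V h p q. \<lbrakk>(U, f) \<in> I; (V, h) \<in> I; p \<in> U \<inter> V; q \<in> U \<inter> V; f p = f q\<rbrakk> \<Longrightarrow> h p = h q"
  shows "countable {(i, snd i p) | i p. i \<in> I \<and> p \<in> fst i \<and>
    (x, p) \<in> {(p, q). \<exists>(U, f)\<in>I. p \<in> U \<and> q \<in> U \<and> f p = f q}\<^sup>*}" (is "countable {(i, snd i p) | i p. i \<in> I \<and> p \<in> fst i \<and> (x, p) \<in> ?R\<^sup>*}")
proof -
  define E where "E n = {(i, snd i p) | i p. i \<in> I \<and> p \<in> fst i \<and> (x, p) \<in> ?R ^^ n}" for n
  have "countable (E n)" for n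
  proof (induction n)
    case 0
    have "E 0 \<subseteq> (\<lambda>i. (i, snd i x)) ` I" unfolding E_def by auto
    then show ?case using I countable_subset by blast
  next
    case (Suc n)
    define \<Phi> where "\<Phi> = (\<lambda>(i :: 'a set \<times> ('a \<Rightarrow> 't), j :: 'a set \<times> ('a \<Rightarrow> 't), c). (i, snd i (SOME p. p \<in> fst i \<inter> fst j \<and> snd j p = (c::'t))))"
    have "E (Suc n) \<subseteq> \<Phi> ` (I \<times> E n)"
    proof
      fix z assume "z \<in> E (Suc n)"
      then obtain i p where z: "z = (i, snd i p)" "i \<in> I" "p \<in> fst i" "(x, p) \<in> ?R ^^ Suc n"
        unfolding E_def by blast
      then obtain q where q: "(x, q) \<in> ?R ^^ n" "(q, p) \<in> ?R" by auto
      then obtain j where j: "j \<in> I" "q \<in> fst j" "p \<in> fst j" "snd j q = snd j p" by auto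
      define p' where "p' = (SOME p'. p' \<in> fst i \<inter> fst j \<and> snd j p' = snd j q)"
      have "\<exists>p'. p' \<in> fst i \<inter> fst j \<and> snd j p' = snd j q" using z(3) j by auto
      then have p': "p' \<in> fst i \<inter> fst j" "snd j p' = snd j q" unfolding p'_def by (metis (mono_tags, lifting) someI_ex)+
      have "snd i p' = snd i p"
        by (rule tr[of "fst j" "snd j" "fst i" "snd i"]) (use z j p' in auto)
      then have "z = \<Phi> (i, j, snd j q)" unfolding z(1) \<Phi>_def p'_def by simp
      moreover have "(j, snd j q) \<in> E n" unfolding E_def using j q by blast
      ultimately show "z \<in> \<Phi> ` (I \<times> E n)" using z(2) by blast
    qed
    moreover have "countable (\<Phi> ` (I \<times> E n))" using I Suc by simp
    ultimately show ?case by (rule countable_subset)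
  qed
  then have "countable (\<Union>n. E n)" by simp
  moreover have "{(i, snd i p) | i p. i \<in> I \<and> p \<in> fst i \<and> (x, p) \<in> ?R\<^sup>*} \<subseteq> (\<Union>n. E n)"
  proof
    fix z assume "z \<in> {(i, snd i p) | i p. i \<in> I \<and> p \<in> fst i \<and> (x, p) \<in> ?R\<^sup>*}"
    then obtain i p where z: "z = (i, snd i p)" "i \<in> I" "p \<in> fst i" and "(x, p) \<in> ?R\<^sup>*" by auto
    from rtrancl_imp_relpow[OF this(4)] obtain n where "(x, p) \<in> ?R ^^ n" ..
    with z have "z \<in> E n" unfolding E_def by (intro CollectI exI conjI)
    then show "z \<in> (\<Union>n. E n)" by (rule UN_I[OF UNIV_I])
  qed
  ultimately show ?thesis by (rule countable_subset[rotated])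
qed

lemma cocycleD:
  assumes "foliated_riemannian S" "(U, f) \<in> cocycle S"
  shows "riemannian_submersion S (model S) U f" "openin (mtop (model S)) (f ` U)"
    "x \<in> U \<Longrightarrow> connectedin (mtop S) {p \<in> U. f p = f x}"
proof -
  have "\<forall>(U, f)\<in>cocycle S. riemannian_submersion S (model S) U f \<and>
        openin (mtop (model S)) (f ` U) \<and>
        (\<forall>x\<in>U. connectedin (mtop S) {p \<in> U. f p = f x})"
    using assms(1) unfolding foliated_riemannian_def by (elim conjE)
  from bspec[OF this assms(2)] show "riemannian_submersion S (model S) U f" "openin (mtop (model S)) (f ` U)"
    "x \<in> U \<Longrightarrow> connectedin (mtop S) {p \<in> U. f p = f x}"
    by simp_all
qed

lemma cocycle_smooth_map:
  assumes "foliated_riemannian S" "(U, f) \<in> cocycle S"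
  shows "smooth_map S (model S) U f"
  using cocycleD(1)[OF assms] unfolding riemannian_submersion_def by (elim conjE)

lemma cocycle_openin:
  assumes "foliated_riemannian S" "(U, f) \<in> cocycle S"
  shows "openin (mtop S) U"
  using cocycle_smooth_map[OF assms] unfolding smooth_map_def by (elim conjE)

lemma cocycle_transition:
  assumes "foliated_riemannian S" "(U, f) \<in> cocycle S" "(V, h) \<in> cocycle S"
    "p \<in> U \<inter> V" "q \<in> U \<inter> V" "f p = f q"
  shows "h p = h q"
proof -
  have "\<forall>(U, f)\<in>cocycle S. \<forall>(V, h)\<in>cocycle S. \<exists>\<gamma>.
        local_isometry (model S) (f ` (U \<inter> V)) \<gamma> \<and> (\<forall>x\<in>U \<inter> V. h x = \<gamma> (f x))"
    using assms(1) unfolding foliated_riemannian_def by (elim conjE)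
  from bspec[OF this assms(2)] have "\<forall>(V, h)\<in>cocycle S. \<exists>\<gamma>.
        local_isometry (model S) (f ` (U \<inter> V)) \<gamma> \<and> (\<forall>x\<in>U \<inter> V. h x = \<gamma> (f x))" by simp
  from bspec[OF this assms(3)] obtain \<gamma> where "\<forall>x\<in>U \<inter> V. h x = \<gamma> (f x)" by auto
  then show ?thesis using assms(4-6) by metis
qed

text \<open>A plaque meets at most one plaque of each other submersion, and countably many submersions
  already generate the leaves.\<close>

lemma countable_leaf_plaques:
  fixes S :: "('a, 'e::euclidean_space, 't, 'q::euclidean_space, 'z) foliated_scheme"
  assumes S: "foliated_riemannian S" and Uf: "(U, f) \<in> cocycle S"
  shows "countable (f ` (leaf S x \<inter> U))"
proof -
  have cov: "(\<Union>(U, f)\<in>cocycle S. U) = topspace (mtop S)"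
    and "riemannian_manifold S"
    using S unfolding foliated_riemannian_def by simp_all
  note conn = cocycleD(3)[OF S]
  have "second_countable (mtop S)"
    using \<open>riemannian_manifold S\<close> unfolding riemannian_manifold_def smooth_manifold_def by simp
  then have "Lindelof_space (mtop S)" by (rule second_countable_imp_Lindelof_space)
  moreover have "\<And>V. V \<in> fst ` cocycle S \<Longrightarrow> openin (mtop S) V" using cocycle_openin[OF S] by auto
  moreover have "\<Union>(fst ` cocycle S) = topspace (mtop S)" using cov by (simp add: case_prod_unfold)
  ultimately obtain \<V> where \<V>: "countable \<V>" "\<V> \<subseteq> fst ` cocycle S" "\<Union>\<V> = topspace (mtop S)"
    by (metis (no_types, lifting) Lindelof_spaceD)
  obtain I where I: "countable I" "I \<subseteq> cocycle S" "\<V> = fst ` I"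
    using \<V>(1,2) by (meson countable_subset_image)
  have Icov: "\<Union>(fst ` I) = topspace (mtop S)" using \<V>(3) I(3) by simp
  define R where "R = {(p, q). \<exists>(U, f)\<in>I. p \<in> U \<and> q \<in> U \<and> f p = f q}"
  \<comment> \<open>A plaque of an arbitrary submersion is connected and covered by the countably
    many selected domains, and its points inside one such domain lie in a single plaque there.
    \<open>connectedin_chain\<close> thus replaces one step by a finite chain of selected
    plaques.\<close>
  have "same_plaque S \<subseteq> R\<^sup>*"
  proof
    fix z assume "z \<in> same_plaque S"
    then obtain p q V h where z: "z = (p, q)" and V: "(V, h) \<in> cocycle S" "p \<in> V" "q \<in> V" "h p = h q"
      unfolding same_plaque_def by auto
    have "(p, q) \<in> R\<^sup>*"
    proof (rule connectedin_chain[OF conn[OF V(1,2)], of "fst ` I"])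
      show "openin (mtop S) W" if "W \<in> fst ` I" for W using that I(2) cocycle_openin[OF S] by auto
      show "{r \<in> V. h r = h p} \<subseteq> \<Union>(fst ` I)"
        unfolding Icov using openin_subset[OF cocycle_openin[OF S V(1)]] by auto
      fix W r s assume "W \<in> fst ` I" and r: "r \<in> W \<inter> {r \<in> V. h r = h p}" and s: "s \<in> W \<inter> {r \<in> V. h r = h p}"
      then obtain k where k: "(W, k) \<in> I" by auto
      have "k r = k s" by (rule cocycle_transition[OF S V(1), of W k]) (use k I(2) r s in auto)
      then show "(r, s) \<in> R" unfolding R_def using k r s by auto
    qed (use V in auto)
    then show "z \<in> R\<^sup>*" unfolding z .
  qed
  then have leaf: "leaf S x \<subseteq> {y. (x, y) \<in> R\<^sup>*}"
    unfolding leaf_def using rtrancl_subset_rtrancl by blast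
  define E where "E = {(i, snd i p) | i p. i \<in> I \<and> p \<in> fst i \<and> (x, p) \<in> R\<^sup>*}"
  have E: "countable E" unfolding E_def R_def
    by (rule countable_chain_values[OF I(1)]) (use I(2) cocycle_transition[OF S] in blast)
  \<comment> \<open>\<open>(U, f)\<close> need not belong to \<open>I\<close>, so the values of f
    are read off from the selected plaques through a point common to both domains.\<close>
  define \<Phi> where "\<Phi> = (\<lambda>(j :: 'a set \<times> ('a \<Rightarrow> 't), c). f (SOME p. p \<in> U \<inter> fst j \<and> snd j p = c))"
  have "f ` (leaf S x \<inter> U) \<subseteq> \<Phi> ` E"
  proof
    fix c assume "c \<in> f ` (leaf S x \<inter> U)"
    then obtain p where p: "c = f p" "(x, p) \<in> R\<^sup>*" "p \<in> U" using leaf by blast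
    have "p \<in> topspace (mtop S)" using p(3) openin_subset[OF cocycle_openin[OF S Uf]] by auto
    then obtain j where j: "j \<in> I" "p \<in> fst j"
      unfolding Icov[symmetric] by (elim UnionE imageE) (simp add: that)
    define p' where "p' = (SOME p'. p' \<in> U \<inter> fst j \<and> snd j p' = snd j p)"
    have "\<exists>p'. p' \<in> U \<inter> fst j \<and> snd j p' = snd j p" using p(3) j by auto
    then have p': "p' \<in> U \<inter> fst j" "snd j p' = snd j p" unfolding p'_def by (metis (mono_tags, lifting) someI_ex)+
    have "f p' = f p"
      by (rule cocycle_transition[OF S, of "fst j" "snd j" U f]) (use I(2) j p p' Uf in auto)
    then have "c = \<Phi> (j, snd j p)" unfolding \<Phi>_def p'_def p(1) by simp
    moreover have "(j, snd j p) \<in> E" unfolding E_def using j p(2) by blast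
    ultimately show "c \<in> \<Phi> ` E" by blast
  qed
  then show ?thesis by (rule countable_subset) (rule countable_image[OF E])
qed

text \<open>If \<open>DH(y)\<close> did not vanish on the kernel of \<open>DF(y)\<close>, a component of \<open>H\<close> together with \<open>F\<close>
  would be an open map, and would take an interval of values on a fibre of \<open>F\<close>.\<close>

lemma kernel_inclusion_of_countable_fibre_image:
  fixes F :: "'e::euclidean_space \<Rightarrow> 'q::euclidean_space" and H :: "'e \<Rightarrow> 'r::euclidean_space"
  assumes W: "open W" "y \<in> W" and cont: "continuous_on W F" "continuous_on W H"
    and dF: "F differentiable at y" and dH: "H differentiable at y" and surj: "surj (Df F y)"
    and count: "countable (H ` {z \<in> W. F z = F y})"
    and k: "Df F y k = 0"
  shows "Df H y k = 0"
proof (rule ccontr)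
  assume "Df H y k \<noteq> 0"
  \<comment> \<open>Pairing with \<open>Df H y k\<close> itself gives a component of
    \<open>H\<close> whose derivative along k is the squared norm of that vector, hence
    nonzero.\<close>
  define b where "b = Df H y k"
  define c where "c = Df H y k \<bullet> b"
  have c: "c \<noteq> 0" unfolding c_def b_def using \<open>_ \<noteq> 0\<close> by simp
  define G where "G z = (F z, H z \<bullet> b)" for z
  define G' where "G' v = (Df F y v, Df H y v \<bullet> b)" for v
  have linF: "linear (Df F y)" and linH: "linear (Df H y)"
    using dF dH by (auto intro: linear_frechet_derivative)
  obtain R where R: "linear R" "Df F y \<circ> R = id"
    using linear_surjective_right_inverse[OF linF surj] by blast
  \<comment> \<open>A right inverse of \<open>G'\<close>: \<open>R\<close> attains the first
    component, and the second is corrected along k, which \<open>Df F y\<close> kills.\<close>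
  define g where "g = (\<lambda>(u, s). R u + ((s - Df H y (R u) \<bullet> b) / c) *\<^sub>R k)"
  have "linear g" unfolding g_def
    by (rule linearI)
      (auto simp: linear_add[OF R(1)] linear_cmul[OF R(1)] linear_add[OF linH] linear_cmul[OF linH]
        inner_add_left algebra_simps add_divide_distrib diff_divide_distrib)
  then have g: "bounded_linear g" by (rule linear_conv_bounded_linear[THEN iffD1])
  have "G' (g p) = p" for p
  proof (cases p)
    case (Pair u s)
    have "Df F y (R u) = u" using R(2) by (metis comp_apply id_apply)
    then show ?thesis unfolding Pair G'_def g_def using c
      by (simp add: linear_add[OF linF] linear_cmul[OF linF] k linear_add[OF linH] linear_cmul[OF linH] inner_add_left
          flip: c_def)
  qed
  then have G'g: "G' \<circ> g = id" by auto
  have G: "(G has_derivative G') (at y)"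
    unfolding G_def G'_def
    by (intro has_derivative_Pair has_derivative_inner_left has_derivative_Df dF dH)
  have "continuous_on W G" unfolding G_def using cont by (intro continuous_intros)
  \<comment> \<open>Openness at the single value \<open>G y\<close> follows from continuity on
    \<open>W\<close> and the right invertible derivative at y.\<close>
  then have "G y \<in> interior (G ` W)"
    by (rule sussmann_open_mapping[OF W(1) _ W(2) G g G'g order_refl]) (simp add: W interior_open)
  then obtain r where r: "r > 0" "ball (G y) r \<subseteq> G ` W" unfolding mem_interior by blast
  have "{H y \<bullet> b <..< H y \<bullet> b + r} \<subseteq> (\<lambda>v. v \<bullet> b) ` (H ` {z \<in> W. F z = F y})"
  proof
    fix s assume s: "s \<in> {H y \<bullet> b <..< H y \<bullet> b + r}"
    then have "(F y, s) \<in> ball (G y) r" unfolding G_def by (simp add: dist_Pair_Pair dist_real_def)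
    then obtain z where "z \<in> W" "G z = (F y, s)" using r(2) by force
    then show "s \<in> (\<lambda>v. v \<bullet> b) ` (H ` {z \<in> W. F z = F y})" unfolding G_def by force
  qed
  then have "countable {H y \<bullet> b <..< H y \<bullet> b + r}"
    by (rule countable_subset) (intro countable_image count)
  then show False using uncountable_open_interval[of "H y \<bullet> b" "H y \<bullet> b + r"] r(1) by simp
qed

section \<open>The component D2 of the derivative of the fundamental 2-vector\<close>

lemma tensor_wedgeE:
  assumes "t \<in> tensor_wedge S x A B"
  obtains n u v w where "t = (\<lambda>X Y Z. \<Sum>k<n. gQ_C S x (u k) X *
         (gQ_C S x (v k) Y * gQ_C S x (w k) Z - gQ_C S x (v k) Z * gQ_C S x (w k) Y))"
    and "\<forall>k<(n::nat). u k \<in> A \<and> v k \<in> B \<and> w k \<in> B"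
  using assms unfolding tensor_wedge_def by (elim CollectE exE conjE) (rule that)

lemma tensor_wedge_zero: "(\<lambda>X Y Z. 0) \<in> tensor_wedge S x A B"
  unfolding tensor_wedge_def by (rule CollectI, rule exI[of _ 0]) simp

lemma tensor_wedge_single:
  assumes "u \<in> A" "v \<in> B" "w \<in> B"
  shows "(\<lambda>X Y Z. gQ_C S x u X * (gQ_C S x v Y * gQ_C S x w Z - gQ_C S x v Z * gQ_C S x w Y))
    \<in> tensor_wedge S x A B"
  unfolding tensor_wedge_def
  by (rule CollectI, rule exI[of _ 1], rule exI[of _ "\<lambda>_. u"], rule exI[of _ "\<lambda>_. v"], rule exI[of _ "\<lambda>_. w"])
    (simp add: assms)

text \<open>Tensors are sums with an explicit number of terms, so the families of the two sums are
  concatenated, the second one shifted by n.\<close>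

lemma tensor_wedge_add:
  fixes A B :: "('e::euclidean_space \<times> 'e) set"
  assumes "s \<in> tensor_wedge S x A B" "t \<in> tensor_wedge S x A B"
  shows "(\<lambda>X Y Z. s X Y Z + t X Y Z) \<in> tensor_wedge S x A B"
proof -
  let ?f = "\<lambda>u v w X Y Z. gQ_C S x u X * (gQ_C S x v Y * gQ_C S x w Z - gQ_C S x v Z * gQ_C S x w Y)"
  obtain n :: nat and u v w where s: "s = (\<lambda>X Y Z. \<Sum>k<n. ?f (u k) (v k) (w k) X Y Z)"
    and ns: "\<forall>k<n. u k \<in> A \<and> v k \<in> B \<and> w k \<in> B"
    using tensor_wedgeE[OF assms(1)] .
  obtain m :: nat and u' v' w' where t: "t = (\<lambda>X Y Z. \<Sum>k<m. ?f (u' k) (v' k) (w' k) X Y Z)"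
    and nt: "\<forall>k<m. u' k \<in> A \<and> v' k \<in> B \<and> w' k \<in> B"
    using tensor_wedgeE[OF assms(2)] .
  define j where "j p q k = (if k < n then p k else q (k - n))" for p q :: "nat \<Rightarrow> 'e \<times> 'e" and k
  have "(\<Sum>k<n+m. ?f (j u u' k) (j v v' k) (j w w' k) X Y Z) = s X Y Z + t X Y Z" for X Y Z
  proof -
    have "(\<Sum>k<n+m. ?f (j u u' k) (j v v' k) (j w w' k) X Y Z) =
        (\<Sum>k<n. ?f (j u u' k) (j v v' k) (j w w' k) X Y Z) + (\<Sum>k<m. ?f (j u u' (n + k)) (j v v' (n + k)) (j w w' (n + k)) X Y Z)"
      by (induction m) (simp_all add: add.assoc)
    also have "\<dots> = s X Y Z + t X Y Z" unfolding s t j_def by simp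
    finally show ?thesis .
  qed
  then have "(\<lambda>X Y Z. s X Y Z + t X Y Z) = (\<lambda>X Y Z. \<Sum>k<n+m. ?f (j u u' k) (j v v' k) (j w w' k) X Y Z)"
    by (simp add: fun_eq_iff)
  moreover have "\<forall>k<n+m. j u u' k \<in> A \<and> j v v' k \<in> B \<and> j w w' k \<in> B"
    using ns nt unfolding j_def by auto
  ultimately show ?thesis unfolding tensor_wedge_def by blast
qed

lemma tensor_wedge_sum:
  assumes "finite I" "\<And>i. i \<in> I \<Longrightarrow> t i \<in> tensor_wedge S x A B"
  shows "(\<lambda>X Y Z. \<Sum>i\<in>I. t i X Y Z) \<in> tensor_wedge S x A B"
  using assms
proof (induction I)
  case empty
  show ?case by (simp add: tensor_wedge_zero)
next
  case (insert i I)
  then show ?case using tensor_wedge_add[of "t i" S x A B "\<lambda>X Y Z. \<Sum>i\<in>I. t i X Y Z"] by simp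
qed

section \<open>Linear algebra on one normal space\<close>

text \<open>\<open>L\<close> plays the role of the differential of a submersion: it identifies the
  normal space with \<open>'q\<close>, so that tensors given on representatives become tensors on
  \<open>'q\<close> composed with \<open>L\<close>.\<close>

locale hermitian_fibre =
  fixes S :: "('a, 'e::euclidean_space, 't, 'q::euclidean_space, 'z) trans_hermitian_scheme" and x :: 'a
    and L :: "'e \<Rightarrow> 'q" and h :: "'q \<Rightarrow> 'q \<Rightarrow> real" and K :: "'q \<Rightarrow> 'q"
  assumes linL: "linear L" and surjL: "surj L" and h: "inner_form h" and linK: "linear K"
    and K_K: "K (K u) = - u" and h_K_K: "h (K u) (K v) = h u v"
    and gQ: "gQ S x X Y = h (L X) (L Y)" and L_acs: "L (acs S x X) = K (L X)"
    and normal_class: "normal_class S x X = normal_class S x Y \<longleftrightarrow> L X = L Y"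
begin

sublocale inner_form h by (rule h)

lemma h_K: "h (K u) v = - h u (K v)"
  using h_K_K[of u "K v"] by (simp add: K_K g_simps)

text \<open>\<open>Q\<^sup>1\<^sup>,\<^sup>0\<close> for \<open>\<sigma> = 1\<close> and \<open>Q\<^sup>0\<^sup>,\<^sup>1\<close> for \<open>\<sigma> = -1\<close>.\<close>

definition Qs :: "real \<Rightarrow> ('e \<times> 'e) set" where
  "Qs \<sigma> = {(a, b). K (L a) = - \<sigma> *\<^sub>R L b \<and> K (L b) = \<sigma> *\<^sub>R L a}"

lemma Q10_Qs: "Q10 S x = Qs 1" and Q01_Qs: "Q01 S x = Qs (- 1)"
  unfolding Q10_def Q01_def Qs_def by (auto simp: normal_class L_acs linear_neg[OF linL])

text \<open>J is skew for \<open>h\<close>, so the eigenvalue i \<sigma> of u reappears with the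
  opposite sign when J acts on the other argument.\<close>

lemma gQ_C_acs:
  assumes "u \<in> Qs \<sigma>"
  shows "gQ_C S x u (acs S x X) = - (\<i> * of_real \<sigma>) * gQ_C S x u X"
proof -
  obtain a b where u: "u = (a, b)" by (cases u)
  have "K (L a) = - \<sigma> *\<^sub>R L b" "K (L b) = \<sigma> *\<^sub>R L a" using assms unfolding u Qs_def by auto
  then have "h (L a) (K (L X)) = \<sigma> * h (L b) (L X)" "h (L b) (K (L X)) = - \<sigma> * h (L a) (L X)"
    using h_K[of "L a" "L X"] h_K[of "L b" "L X"] by (auto simp: g_simps)
  then show ?thesis unfolding u gQ_C_def by (simp add: gQ L_acs complex_eq_iff)
qed

text \<open>The two slots contribute (-i \<sigma>)(-i \<rho>) = - \<sigma> \<rho>. Hence both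
  summands of the type of \<open>D2\<close> have eigenvalue 1 and both summands of the type of
  \<open>D1\<close> have eigenvalue -1, which is how the components are told apart.\<close>

lemma tensor_wedge_acs:
  assumes "t \<in> tensor_wedge S x (Qs \<sigma>) (Qs \<rho>)"
  shows "t (acs S x X) (acs S x Y) Z = - of_real (\<sigma> * \<rho>) * t X Y Z"
proof -
  obtain n :: nat and u v w where t: "t = (\<lambda>X Y Z. \<Sum>k<n. gQ_C S x (u k) X *
         (gQ_C S x (v k) Y * gQ_C S x (w k) Z - gQ_C S x (v k) Z * gQ_C S x (w k) Y))"
    and n: "\<forall>k<n. u k \<in> Qs \<sigma> \<and> v k \<in> Qs \<rho> \<and> w k \<in> Qs \<rho>"
    using tensor_wedgeE[OF assms] .
  show ?thesis unfolding t sum_distrib_left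
  proof (rule sum.cong[OF refl])
    fix k assume "k \<in> {..<n}"
    then have m: "u k \<in> Qs \<sigma>" "v k \<in> Qs \<rho>" "w k \<in> Qs \<rho>" using n by auto
    show "gQ_C S x (u k) (acs S x X) * (gQ_C S x (v k) (acs S x Y) * gQ_C S x (w k) Z
          - gQ_C S x (v k) Z * gQ_C S x (w k) (acs S x Y)) =
      - of_real (\<sigma> * \<rho>) * (gQ_C S x (u k) X * (gQ_C S x (v k) Y * gQ_C S x (w k) Z
          - gQ_C S x (v k) Z * gQ_C S x (w k) Y))"
      unfolding gQ_C_acs[OF m(1)] gQ_C_acs[OF m(2)] gQ_C_acs[OF m(3)]
      by (simp add: algebra_simps)
  qed
qed

text \<open>The component in \<open>Qs \<sigma>\<close> of the vector \<open>c E\<close>.\<close>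

definition proj :: "real \<Rightarrow> complex \<Rightarrow> 'e \<Rightarrow> 'e \<times> 'e" where
  "proj \<sigma> c E = ((Re c / 2) *\<^sub>R E + (\<sigma> * Im c / 2) *\<^sub>R acs S x E,
     (Im c / 2) *\<^sub>R E - (\<sigma> * Re c / 2) *\<^sub>R acs S x E)"

lemma proj_in:
  assumes "\<sigma>\<^sup>2 = 1"
  shows "proj \<sigma> c E \<in> Qs \<sigma>"
  using assms unfolding proj_def Qs_def
  by (simp add: linear_add[OF linL] linear_diff[OF linL] linear_cmul[OF linL] linear_add[OF linK]
      linear_diff[OF linK] linear_cmul[OF linK] L_acs K_K scaleR_add_right scaleR_diff_right power2_eq_square
      flip: mult.assoc)

text \<open>The pairing of u with the eigencomponent (e - i \<sigma> K e) / 2 of e, with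
  \<open>K\<close> moved over to u by skewness.\<close>

definition cof :: "real \<Rightarrow> 'q \<Rightarrow> 'q \<Rightarrow> complex" where
  "cof \<sigma> e u = (of_real (h e u) + \<i> * of_real \<sigma> * of_real (h e (K u))) / 2"

lemma gQ_C_proj: "gQ_C S x (proj \<sigma> c E) X = c * cof \<sigma> (L E) (L X)"
  unfolding gQ_C_def proj_def cof_def
  by (simp add: gQ linear_add[OF linL] linear_diff[OF linL] linear_cmul[OF linL] L_acs g_simps h_K complex_eq_iff
      field_simps)

text \<open>A linear map is the combination of the forms \<open>h (e a)\<close> with coefficients
  \<open>f (e a)\<close>. Adding i \<sigma> times the expansion at \<open>K u\<close> to that at u
  turns the pairings into \<open>cof\<close>, and the eigenvalue condition makes each half equal to
  f u / 2.\<close>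

lemma cof_expansion:
  assumes e: "orthonormal e (DIM('q))" and s: "\<sigma>\<^sup>2 = 1" and f: "linear f"
    and fK: "\<And>u. f (K u) = - (\<i> * of_real \<sigma>) * f u"
  shows "(\<Sum>a<DIM('q). f (e a) * cof \<sigma> (e a) u) = f u"
proof -
  have ex: "(\<Sum>a<DIM('q). f (e a) * of_real (h (e a) v)) = f v" for v
  proof -
    have "f v = f (\<Sum>a<DIM('q). h v (e a) *\<^sub>R e a)" using orthonormal_expansion[OF e, of v] by simp
    also have "\<dots> = (\<Sum>a<DIM('q). f (e a) * of_real (h (e a) v))"
      by (simp add: linear_sum[OF f] linear_cmul[OF f] scaleR_conv_of_real mult.commute sym[of v])
    finally show ?thesis by simp
  qed
  have "(\<Sum>a<DIM('q). f (e a) * cof \<sigma> (e a) u) =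
     ((\<Sum>a<DIM('q). f (e a) * of_real (h (e a) u)) +
       \<i> * of_real \<sigma> * (\<Sum>a<DIM('q). f (e a) * of_real (h (e a) (K u)))) / 2"
    unfolding cof_def
    by (simp add: sum_distrib_left sum.distrib sum_divide_distrib add_divide_distrib algebra_simps)
  also have "\<dots> = (f u + of_real (\<sigma>\<^sup>2) * f u) / 2"
    unfolding ex fK by (simp add: power2_eq_square algebra_simps)
  finally show ?thesis using s by simp
qed

text \<open>Expanding each slot by \<open>cof_expansion\<close> writes \<tau> as a combination of
  products of projected basis vectors. The third slot inherits the eigenvalue of the second by
  alternation.\<close>

lemma tensor_wedge_memI:
  assumes s: "\<sigma>\<^sup>2 = 1" "\<rho>\<^sup>2 = 1"
    and lin: "\<And>v w. linear (\<lambda>u. \<tau> u v w)" "\<And>u w. linear (\<lambda>v. \<tau> u v w)" "\<And>u v. linear (\<tau> u v)"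
    and alt: "\<And>u v w. \<tau> u v w = - \<tau> u w v"
    and eig: "\<And>u v w. \<tau> (K u) v w = - (\<i> * of_real \<sigma>) * \<tau> u v w"
      "\<And>u v w. \<tau> u (K v) w = - (\<i> * of_real \<rho>) * \<tau> u v w"
  shows "(\<lambda>X Y Z. \<tau> (L X) (L Y) (L Z)) \<in> tensor_wedge S x (Qs \<sigma>) (Qs \<rho>)"
proof -
  obtain e where e: "orthonormal e (DIM('q))" using orthonormal_exists by blast
  define E where "E a = inv L (e a)" for a
  have LE: "L (E a) = e a" for a unfolding E_def by (rule surj_f_inv_f[OF surjL])
  have eig3: "\<tau> u v (K w) = - (\<i> * of_real \<rho>) * \<tau> u v w" for u v w
    using alt[of u v "K w"] alt[of u v w] eig(2)[of u w v] by simp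
  let ?n = "DIM('q)"
  \<comment> \<open>The coefficient is halved because the wedge has two terms, which alternation
    makes equal after summation.\<close>
  define T where "T a b c = (\<lambda>X Y Z. gQ_C S x (proj \<sigma> (\<tau> (e a) (e b) (e c) / 2) (E a)) X *
      (gQ_C S x (proj \<rho> 1 (E b)) Y * gQ_C S x (proj \<rho> 1 (E c)) Z
       - gQ_C S x (proj \<rho> 1 (E b)) Z * gQ_C S x (proj \<rho> 1 (E c)) Y))" for a b c
  have mem: "(\<lambda>X Y Z. \<Sum>a<?n. \<Sum>b<?n. \<Sum>c<?n. T a b c X Y Z) \<in> tensor_wedge S x (Qs \<sigma>) (Qs \<rho>)"
    unfolding T_def by (intro tensor_wedge_sum tensor_wedge_single proj_in s finite_lessThan)
  have full: "(\<Sum>a<?n. \<Sum>b<?n. \<Sum>c<?n. \<tau> (e a) (e b) (e c) * cof \<sigma> (e a) u * cof \<rho> (e b) v * cof \<rho> (e c) w) = \<tau> u v w"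
    for u v w
  proof -
    have "(\<Sum>a<?n. \<Sum>b<?n. \<Sum>c<?n. \<tau> (e a) (e b) (e c) * cof \<sigma> (e a) u * cof \<rho> (e b) v * cof \<rho> (e c) w)
      = (\<Sum>a<?n. (\<Sum>b<?n. (\<Sum>c<?n. \<tau> (e a) (e b) (e c) * cof \<rho> (e c) w) * cof \<rho> (e b) v) * cof \<sigma> (e a) u)"
      by (simp add: sum_distrib_left sum_distrib_right mult_ac)
    also have "\<dots> = (\<Sum>a<?n. (\<Sum>b<?n. \<tau> (e a) (e b) w * cof \<rho> (e b) v) * cof \<sigma> (e a) u)"
      by (intro sum.cong refl arg_cong2[of _ _ _ _ "(*)"] cof_expansion[OF e s(2) lin(3) eig3])
    also have "\<dots> = (\<Sum>a<?n. \<tau> (e a) v w * cof \<sigma> (e a) u)"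
      by (intro sum.cong refl arg_cong2[of _ _ _ _ "(*)"] cof_expansion[OF e s(2) lin(2) eig(2)])
    also have "\<dots> = \<tau> u v w" by (rule cof_expansion[OF e s(1) lin(1) eig(1)])
    finally show ?thesis .
  qed
  have "(\<Sum>a<?n. \<Sum>b<?n. \<Sum>c<?n. T a b c X Y Z) = \<tau> (L X) (L Y) (L Z)" for X Y Z
  proof -
    have "T a b c X Y Z = (\<tau> (e a) (e b) (e c) * cof \<sigma> (e a) (L X) * cof \<rho> (e b) (L Y) * cof \<rho> (e c) (L Z)) / 2
       - (\<tau> (e a) (e b) (e c) * cof \<sigma> (e a) (L X) * cof \<rho> (e b) (L Z) * cof \<rho> (e c) (L Y)) / 2" for a b c
      unfolding T_def gQ_C_proj LE by (simp add: algebra_simps)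
    then have "(\<Sum>a<?n. \<Sum>b<?n. \<Sum>c<?n. T a b c X Y Z) = \<tau> (L X) (L Y) (L Z) / 2 - \<tau> (L X) (L Z) (L Y) / 2"
      by (simp add: sum_subtractf full flip: sum_divide_distrib)
    then show ?thesis using alt[of "L X" "L Z" "L Y"] by simp
  qed
  then show ?thesis using mem by simp
qed

text \<open>The first slot is split into its two eigencomponents. As \<open>K\<close> in the first
  two slots multiplies by s, the eigenvalue in the second slot is then forced: \<rho> = - s
  \<sigma>. The value s = 1 serves \<open>D2\<close> and s = -1 serves \<open>D1\<close>.\<close>

lemma of_real_mem_tensor_sum:
  assumes s: "s\<^sup>2 = 1"
    and lin: "\<And>v w. linear (\<lambda>u. d u v w)" "\<And>u w. linear (\<lambda>v. d u v w)" "\<And>u v. linear (d u v)"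
    and alt: "\<And>u v w. d u v w = - d u w v"
    and eig: "\<And>u v w. d (K u) (K v) w = s * d u v w"
  shows "(\<lambda>X Y Z. complex_of_real (d (L X) (L Y) (L Z))) \<in>
    tensor_sum (tensor_wedge S x (Qs 1) (Qs (- s))) (tensor_wedge S x (Qs (- 1)) (Qs s))"
proof -
  define \<tau> where "\<tau> \<sigma> u v w = (of_real (d u v w) + \<i> * of_real \<sigma> * of_real (d (K u) v w)) / 2"
    for \<sigma> :: real and u v w
  have d2: "d u (K v) w = - s * d (K u) v w" for u v w
    using eig[of "- K u" v w] by (simp add: linear_neg[OF linK] linear_neg[OF lin(1)] K_K)
  have mem: "(\<lambda>X Y Z. \<tau> \<sigma> (L X) (L Y) (L Z)) \<in> tensor_wedge S x (Qs \<sigma>) (Qs \<rho>)"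
    if \<sigma>: "\<sigma>\<^sup>2 = 1" and \<rho>: "\<rho> = - s * \<sigma>" for \<sigma> \<rho> :: real
  proof (rule tensor_wedge_memI[OF \<sigma>])
    have ss: "\<sigma> * \<sigma> = 1" using \<sigma> by (simp add: power2_eq_square)
    show "\<rho>\<^sup>2 = 1" using \<sigma> \<rho> s by (simp add: power_mult_distrib)
    show "linear (\<lambda>u. \<tau> \<sigma> u v w)" for v w
      unfolding \<tau>_def
      by (rule linearI) (simp_all add: linear_add[OF lin(1)] linear_cmul[OF lin(1)] linear_add[OF linK]
          linear_cmul[OF linK] complex_eq_iff algebra_simps add_divide_distrib)
    show "linear (\<lambda>v. \<tau> \<sigma> u v w)" for u w
      unfolding \<tau>_def
      by (rule linearI) (simp_all add: linear_add[OF lin(2)] linear_cmul[OF lin(2)]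
          complex_eq_iff algebra_simps add_divide_distrib)
    show "linear (\<tau> \<sigma> u v)" for u v
      unfolding \<tau>_def
      by (rule linearI) (simp_all add: linear_add[OF lin(3)] linear_cmul[OF lin(3)]
          complex_eq_iff algebra_simps add_divide_distrib)
    show "\<tau> \<sigma> u v w = - \<tau> \<sigma> u w v" for u v w
      unfolding \<tau>_def using alt[of u v w] alt[of "K u" v w] by (simp add: complex_eq_iff)
    show "\<tau> \<sigma> (K u) v w = - (\<i> * of_real \<sigma>) * \<tau> \<sigma> u v w" for u v w
      unfolding \<tau>_def using ss by (simp add: K_K linear_neg[OF lin(1)] complex_eq_iff flip: mult.assoc)
    show "\<tau> \<sigma> u (K v) w = - (\<i> * of_real \<rho>) * \<tau> \<sigma> u v w" for u v w
    proof -
      have "d (K u) (K v) w = s * d u v w" by (rule eig)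
      then show ?thesis unfolding \<tau>_def \<rho> d2[of u] using ss by (simp add: complex_eq_iff flip: mult.assoc)
    qed
  qed
  have 1: "(\<lambda>X Y Z. \<tau> 1 (L X) (L Y) (L Z)) \<in> tensor_wedge S x (Qs 1) (Qs (- s))"
    by (rule mem) simp_all
  have 2: "(\<lambda>X Y Z. \<tau> (- 1) (L X) (L Y) (L Z)) \<in> tensor_wedge S x (Qs (- 1)) (Qs s)"
    by (rule mem) simp_all
  have "(\<lambda>X Y Z. complex_of_real (d (L X) (L Y) (L Z))) =
     (\<lambda>X Y Z. \<tau> 1 (L X) (L Y) (L Z) + \<tau> (- 1) (L X) (L Y) (L Z))"
    unfolding \<tau>_def by (simp add: fun_eq_iff complex_eq_iff)
  then show ?thesis unfolding tensor_sum_def by (intro CollectI exI conjI) (assumption | rule 1 2)+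
qed

lemma tensor_sum_acs:
  assumes "D \<in> tensor_sum (tensor_wedge S x (Qs 1) (Qs (- s))) (tensor_wedge S x (Qs (- 1)) (Qs s))"
  shows "D (acs S x X) (acs S x Y) Z = of_real s * D X Y Z"
proof -
  obtain t1 t2 where D: "D = (\<lambda>X Y Z. t1 X Y Z + t2 X Y Z)"
    and t: "t1 \<in> tensor_wedge S x (Qs 1) (Qs (- s))" "t2 \<in> tensor_wedge S x (Qs (- 1)) (Qs s)"
    using assms unfolding tensor_sum_def by blast
  show ?thesis unfolding D tensor_wedge_acs[OF t(1)] tensor_wedge_acs[OF t(2)] by (simp add: algebra_simps)
qed

text \<open>Half the sum and half the difference of \<open>T u v w\<close> and
  \<open>T (K u) (K v) w\<close> have eigenvalues 1 and -1, which gives existence. For uniqueness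
  the decomposition is evaluated at (X, Y) and at (J X, J Y): adding the two identities cancels
  \<open>D1\<close>.\<close>

lemma D2_fundamental_eq:
  assumes N: "\<And>X Y Z. nabla_fundamental S x X Y Z = T (L X) (L Y) (L Z)"
    and lin: "\<And>v w. linear (\<lambda>u. T u v w)" "\<And>u w. linear (\<lambda>v. T u v w)" "\<And>u v. linear (T u v)"
    and alt: "\<And>u v w. T u v w = - T u w v"
    and anti: "\<And>u v w. T u (K v) (K w) = - T u v w"
  shows "D2_fundamental S x X Y Z =
    complex_of_real ((T (L X) (L Y) (L Z) + T (K (L X)) (K (L Y)) (L Z)) / 2)"
proof -
  define d where "d s u v w = (T u v w + s * T (K u) (K v) w) / 2" for s :: real and u v w
  have mem: "(\<lambda>X Y Z. complex_of_real (d s (L X) (L Y) (L Z))) \<in>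
    tensor_sum (tensor_wedge S x (Qs 1) (Qs (- s))) (tensor_wedge S x (Qs (- 1)) (Qs s))"
    if s: "s\<^sup>2 = 1" for s
  proof (rule of_real_mem_tensor_sum[OF s])
    show "linear (\<lambda>u. d s u v w)" for v w
      unfolding d_def
      by (rule linearI) (simp_all add: linear_add[OF lin(1)] linear_cmul[OF lin(1)] linear_add[OF linK]
          linear_cmul[OF linK] algebra_simps add_divide_distrib)
    show "linear (\<lambda>v. d s u v w)" for u w
      unfolding d_def
      by (rule linearI) (simp_all add: linear_add[OF lin(2)] linear_cmul[OF lin(2)] linear_add[OF linK]
          linear_cmul[OF linK] algebra_simps add_divide_distrib)
    show "linear (d s u v)" for u v
      unfolding d_def
      by (rule linearI) (simp_all add: linear_add[OF lin(3)] linear_cmul[OF lin(3)]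
          algebra_simps add_divide_distrib)
    show "d s u v w = - d s u w v" for u v w
    proof -
      \<comment> \<open>\<open>anti\<close> lets \<open>K\<close> pass between the last two slots,
        and this keeps both eigenparts alternating.\<close>
      have sw: "T p (K q) r = T p q (K r)" for p q r
        using anti[of p q "- K r"] by (simp add: linear_neg[OF linK] K_K linear_neg[OF lin(3)])
      have "T (K u) (K v) w = - T (K u) (K w) v" using sw[of "K u" v w] alt[of "K u" v "K w"] by simp
      then show ?thesis unfolding d_def using alt[of u v w] by (simp add: field_simps)
    qed
    show "d s (K u) (K v) w = s * d s u v w" for u v w
      unfolding d_def using s
      by (simp add: K_K linear_neg[OF lin(1)] linear_neg[OF lin(2)] power2_eq_square algebra_simps flip: mult.assoc)
  qed
  let ?D2 = "\<lambda>X Y Z. complex_of_real (d 1 (L X) (L Y) (L Z))"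
  have "D2_fundamental S x = ?D2"
    unfolding D2_fundamental_def Q10_Qs Q01_Qs
  proof (rule the_equality, intro conjI bexI allI)
    show "?D2 \<in> tensor_sum (tensor_wedge S x (Qs 1) (Qs (- 1))) (tensor_wedge S x (Qs (- 1)) (Qs 1))"
      by (rule mem) simp
    show "(\<lambda>X Y Z. complex_of_real (d (- 1) (L X) (L Y) (L Z))) \<in>
      tensor_sum (tensor_wedge S x (Qs 1) (Qs 1)) (tensor_wedge S x (Qs (- 1)) (Qs (- 1)))"
      using mem[of "- 1"] by simp
    show "complex_of_real (nabla_fundamental S x X Y Z) =
      complex_of_real (d (- 1) (L X) (L Y) (L Z)) + ?D2 X Y Z" for X Y Z
    proof -
      have "nabla_fundamental S x X Y Z = d (- 1) (L X) (L Y) (L Z) + d 1 (L X) (L Y) (L Z)"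
        unfolding N d_def by (simp add: field_simps)
      then show ?thesis by simp
    qed
  next
    fix D2
    assume "D2 \<in> tensor_sum (tensor_wedge S x (Qs 1) (Qs (- 1))) (tensor_wedge S x (Qs (- 1)) (Qs 1)) \<and>
     (\<exists>D1\<in>tensor_sum (tensor_wedge S x (Qs 1) (Qs 1)) (tensor_wedge S x (Qs (- 1)) (Qs (- 1))).
        \<forall>X Y Z. complex_of_real (nabla_fundamental S x X Y Z) = D1 X Y Z + D2 X Y Z)"
    then obtain D1 where D2: "D2 \<in> tensor_sum (tensor_wedge S x (Qs 1) (Qs (- 1))) (tensor_wedge S x (Qs (- 1)) (Qs 1))"
      and D1: "D1 \<in> tensor_sum (tensor_wedge S x (Qs 1) (Qs 1)) (tensor_wedge S x (Qs (- 1)) (Qs (- 1)))"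
      and eq: "\<And>X Y Z. complex_of_real (nabla_fundamental S x X Y Z) = D1 X Y Z + D2 X Y Z"
      by blast
    have "D2 X Y Z = ?D2 X Y Z" for X Y Z
      using eq[of X Y Z] eq[of "acs S x X" "acs S x Y" Z] tensor_sum_acs[of D2 1 X Y Z] tensor_sum_acs[of D1 "- 1" X Y Z]
        D1 D2 unfolding N d_def by (simp add: L_acs)
    then show "D2 = ?D2" by (simp add: fun_eq_iff)
  qed
  then show ?thesis unfolding d_def by simp
qed

end

section \<open>Maps in charts\<close>

lemma eventually_nhds_eventually: "\<forall>\<^sub>F y in nhds a. P y \<Longrightarrow> \<forall>\<^sub>F y in nhds a. \<forall>\<^sub>F z in nhds y. P z"
  by (simp add: eventually_eventually)

lemma twice_differentiable_at_cong:
  assumes e: "\<forall>\<^sub>F y in nhds a. f y = h y" and f: "twice_differentiable_at f a"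
  shows "twice_differentiable_at h a"
proof -
  have ev: "\<forall>\<^sub>F y in nhds a. f differentiable at y" and d: "\<And>v. (\<lambda>y. Df f y v) differentiable at a"
    using f unfolding twice_differentiable_at_def by auto
  have "\<forall>\<^sub>F y in nhds a. h differentiable at y"
    using ev eventually_nhds_eventually[OF e]
    by eventually_elim (rule differentiable_cong_ev)
  moreover have "\<forall>\<^sub>F y in nhds a. Df f y v = Df h y v" for v
    using eventually_nhds_eventually[OF e] by eventually_elim (rule Df_cong_ev)
  then have "(\<lambda>y. Df h y v) differentiable at a" for v by (rule differentiable_cong_ev) (rule d)
  ultimately show ?thesis unfolding twice_differentiable_at_def by blast
qed

lemma twice_differentiable_at_comp:
  fixes f :: "'a::euclidean_space \<Rightarrow> 'b::euclidean_space" and h :: "'b \<Rightarrow> 'c::euclidean_space"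
  assumes f: "twice_differentiable_at f a" and h: "twice_differentiable_at h (f a)"
  shows "twice_differentiable_at (h \<circ> f) a"
proof -
  have evf: "\<forall>\<^sub>F y in nhds a. f differentiable at y" and df: "\<And>v. (\<lambda>y. Df f y v) differentiable at a"
    using f unfolding twice_differentiable_at_def by auto
  have evh: "\<forall>\<^sub>F y in nhds (f a). h differentiable at y" and dh: "\<And>v. (\<lambda>y. Df h y v) differentiable at (f a)"
    using h unfolding twice_differentiable_at_def by auto
  have f1: "f differentiable at a" using f by (rule twice_differentiable_imp_differentiable)
  have "isCont f a" using f1 by (rule differentiable_imp_continuous_within)
  then have "filterlim f (nhds (f a)) (nhds a)" by (rule isCont_imp_tendsto_nhds)
  from eventually_compose_filterlim[OF evh this] have evhf: "\<forall>\<^sub>F y in nhds a. h differentiable at (f y)" .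
  obtain S where S: "open S" "f a \<in> S" "\<And>y. y \<in> S \<Longrightarrow> linear (Df h y)"
    using evh unfolding eventually_nhds by (metis linear_frechet_derivative)
  have "\<forall>\<^sub>F y in nhds a. h \<circ> f differentiable at y"
    using evf evhf by eventually_elim (rule differentiable_chain_at)
  moreover have "(\<lambda>y. Df (h \<circ> f) y v) differentiable at a" for v
  proof (rule differentiable_cong_ev)
    show "\<forall>\<^sub>F y in nhds a. Df h (f y) (Df f y v) = Df (h \<circ> f) y v"
      using evf evhf by eventually_elim (simp add: frechet_derivative_compose)
    show "(\<lambda>y. Df h (f y) (Df f y v)) differentiable at a"
      using has_derivative_linear_family[OF S dh has_derivative_Df[OF f1] refl has_derivative_Df[OF df]]
      by (rule differentiableI)
  qed
  ultimately show ?thesis unfolding twice_differentiable_at_def by blast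
qed

context
  fixes M :: "('a, 'e::euclidean_space, 'z) manifold_scheme"
  assumes M: "smooth_manifold M"
begin

lemma atlas_is_chart: "C \<in> atlas M \<Longrightarrow> is_chart (mtop M) C"
  using M unfolding smooth_manifold_def by blast

lemma chart_openin: "C \<in> atlas M \<Longrightarrow> openin (mtop M) (fst C)"
  using atlas_is_chart unfolding is_chart_def by blast

lemma chart_inj: "C \<in> atlas M \<Longrightarrow> inj_on (snd C) (fst C)"
proof -
  assume "C \<in> atlas M"
  then have h: "homeomorphic_map (subtopology (mtop M) (fst C)) (top_of_set (snd C ` fst C)) (snd C)"
    and o: "openin (mtop M) (fst C)"
    using atlas_is_chart unfolding is_chart_def by auto
  have "topspace (subtopology (mtop M) (fst C)) = fst C" using openin_subset[OF o] by auto
  then show ?thesis using homeomorphic_imp_injective_map[OF h] by simp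
qed

lemma chart_inv_chart: "C \<in> atlas M \<Longrightarrow> p \<in> fst C \<Longrightarrow> chart_inv C (snd C p) = p"
  unfolding chart_inv_def by (rule inv_into_f_f[OF chart_inj])

lemma chart_open_image:
  assumes C: "C \<in> atlas M" and W: "openin (mtop M) W"
  shows "open (snd C ` (W \<inter> fst C))"
proof -
  have h: "homeomorphic_map (subtopology (mtop M) (fst C)) (top_of_set (snd C ` fst C)) (snd C)"
    and o: "open (snd C ` fst C)"
    using atlas_is_chart[OF C] unfolding is_chart_def by auto
  have "openin (subtopology (mtop M) (fst C)) (W \<inter> fst C)"
    using W by (auto simp: openin_subtopology)
  then have "openin (top_of_set (snd C ` fst C)) (snd C ` (W \<inter> fst C))"
    using homeomorphic_imp_open_map[OF h] unfolding open_map_def by blast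
  then show ?thesis using o openin_open_trans by blast
qed

lemma eventually_chart:
  assumes C: "C \<in> atlas M" "x \<in> fst C" and W: "openin (mtop M) W" "x \<in> W"
    and P: "\<And>p. p \<in> W \<Longrightarrow> p \<in> fst C \<Longrightarrow> P (snd C p)"
  shows "\<forall>\<^sub>F y in nhds (snd C x). P y"
  unfolding eventually_nhds
  by (rule exI[of _ "snd C ` (W \<inter> fst C)"]) (use chart_open_image[OF C(1) W(1)] C W P in auto)

lemma chart_at:
  assumes "x \<in> topspace (mtop M)"
  shows "chart_at M x \<in> atlas M" "x \<in> fst (chart_at M x)"
proof -
  have "\<Union>(fst ` atlas M) = topspace (mtop M)"
    using M unfolding smooth_manifold_def by simp
  then have "\<exists>C. C \<in> atlas M \<and> x \<in> fst C" using assms by blast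
  from someI_ex[OF this] show "chart_at M x \<in> atlas M" "x \<in> fst (chart_at M x)"
    unfolding chart_at_def by auto
qed

end

section \<open>Differentials in arbitrary charts\<close>

definition rep :: "'a set \<times> ('a \<Rightarrow> 'e) \<Rightarrow> 'b set \<times> ('b \<Rightarrow> 'f) \<Rightarrow> ('a \<Rightarrow> 'b) \<Rightarrow> 'e \<Rightarrow> 'f" where
  "rep C D h = (\<lambda>y. snd D (h (chart_inv C y)))"

text \<open>\<open>tangent_map\<close>, \<open>chart_deriv\<close> and \<open>chart_lift\<close> are
  all instances, the last two for the identity map, so that the chain rule \<open>tang_comp\<close>
  also covers changes of charts.\<close>

definition tang :: "'a set \<times> ('a \<Rightarrow> 'e::euclidean_space) \<Rightarrow> 'b set \<times> ('b \<Rightarrow> 'f::euclidean_space) \<Rightarrow>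
   ('a \<Rightarrow> 'b) \<Rightarrow> 'a \<Rightarrow> 'e \<Rightarrow> 'f" where
  "tang C D h p = Df (rep C D h) (snd C p)"

text \<open>The part of smoothness that the argument consumes, in a form that passes to composites:
  open preimages provide room to insert an intermediate chart.\<close>

definition C2_map ::
  "('a, 'e::euclidean_space, 'z) manifold_scheme \<Rightarrow> ('b, 'f::euclidean_space, 'y) manifold_scheme \<Rightarrow>
   'a set \<Rightarrow> ('a \<Rightarrow> 'b) \<Rightarrow> bool" where
  "C2_map M N U h \<longleftrightarrow> openin (mtop M) U \<and> h ` U \<subseteq> topspace (mtop N) \<and>
     (\<forall>W. openin (mtop N) W \<longrightarrow> openin (mtop M) (U \<inter> h -` W)) \<and>
     (\<forall>x\<in>U. \<forall>C\<in>atlas M. \<forall>D\<in>atlas N. x \<in> fst C \<longrightarrow> h x \<in> fst D \<longrightarrow>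
        twice_differentiable_at (rep C D h) (snd C x))"

lemma C2_mapD:
  assumes "C2_map M N U h"
  shows "openin (mtop M) U" "x \<in> U \<Longrightarrow> h x \<in> topspace (mtop N)"
    "openin (mtop N) W \<Longrightarrow> openin (mtop M) (U \<inter> h -` W)"
    "\<lbrakk>x \<in> U; C \<in> atlas M; D \<in> atlas N; x \<in> fst C; h x \<in> fst D\<rbrakk> \<Longrightarrow>
       twice_differentiable_at (rep C D h) (snd C x)"
  using assms unfolding C2_map_def by auto

lemma C2_map_differentiable:
  "\<lbrakk>C2_map M N U h; x \<in> U; C \<in> atlas M; D \<in> atlas N; x \<in> fst C; h x \<in> fst D\<rbrakk> \<Longrightarrow>
       rep C D h differentiable at (snd C x)"
  by (rule twice_differentiable_imp_differentiable[OF C2_mapD(4)])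

lemma smooth_map_C2:
  assumes M: "smooth_manifold M" and N: "smooth_manifold N" and h: "smooth_map M N U h"
  shows "C2_map M N U h"
proof -
  have U: "openin (mtop M) U" and cont: "continuous_map (subtopology (mtop M) U) (mtop N) h"
    and sm: "\<And>C D. C \<in> atlas M \<Longrightarrow> D \<in> atlas N \<Longrightarrow>
        smooth_on (snd D \<circ> h \<circ> chart_inv C) (snd C ` (U \<inter> fst C \<inter> h -` fst D))"
    using h unfolding smooth_map_def by auto
  have ts: "topspace (subtopology (mtop M) U) = U" using openin_subset[OF U] by auto
  have pre: "openin (mtop M) (U \<inter> h -` W)" if "openin (mtop N) W" for W
  proof -
    have "openin (subtopology (mtop M) U) {x \<in> topspace (subtopology (mtop M) U). h x \<in> W}"
      using cont that by (rule openin_continuous_map_preimage)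
    then have "openin (subtopology (mtop M) U) (U \<inter> h -` W)" unfolding ts by (simp add: vimage_def Collect_conj_eq)
    then show ?thesis using openin_open_subtopology[OF U] by blast
  qed
  show ?thesis
    unfolding C2_map_def
  proof (intro conjI allI impI ballI)
    show "h ` U \<subseteq> topspace (mtop N)"
      using continuous_map_image_subset_topspace[OF cont] unfolding ts .
    fix x C D assume x: "x \<in> U" "x \<in> fst C" "h x \<in> fst D" and C: "C \<in> atlas M" and D: "D \<in> atlas N"
    have "open (snd C ` ((U \<inter> h -` fst D) \<inter> fst C))"
      by (rule chart_open_image[OF M C pre[OF chart_openin[OF N D]]])
    then have "open (snd C ` (U \<inter> fst C \<inter> h -` fst D))" by (simp add: Int_ac)
    from smooth_on_imp_twice_differentiable_at[OF sm[OF C D] this, of "snd C x"] x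
    show "twice_differentiable_at (rep C D h) (snd C x)"
      unfolding rep_def by (simp add: o_def)
  qed (use U pre in auto)
qed

lemma C2_map_ident:
  assumes M: "smooth_manifold M"
  shows "C2_map M M (topspace (mtop M)) (\<lambda>p. p)"
  unfolding C2_map_def
proof (intro conjI allI impI ballI)
  fix W assume "openin (mtop M) W"
  then show "openin (mtop M) (topspace (mtop M) \<inter> (\<lambda>p. p) -` W)"
    by (simp add: openin_Int)
next
  fix x C D assume x: "x \<in> fst C" "x \<in> fst D" and C: "C \<in> atlas M" and D: "D \<in> atlas M"
  have "open (snd C ` (fst D \<inter> fst C))" by (rule chart_open_image[OF M C chart_openin[OF M D]])
  then have o: "open (snd C ` (fst C \<inter> fst D))" by (simp add: Int_ac)
  have "smooth_on (snd D \<circ> chart_inv C) (snd C ` (fst C \<inter> fst D))"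
    using M C D unfolding smooth_manifold_def by blast
  from smooth_on_imp_twice_differentiable_at[OF this o, of "snd C x"] x
  show "twice_differentiable_at (rep C D (\<lambda>p. p)) (snd C x)"
    unfolding rep_def by (simp add: o_def)
qed auto

lemma rep_comp_eventually:
  assumes M: "smooth_manifold M" and N: "smooth_manifold N"
    and h: "C2_map M N U h" and x: "x \<in> U"
    and C: "C \<in> atlas M" "x \<in> fst C" and D: "D \<in> atlas N" "h x \<in> fst D"
  shows "\<forall>\<^sub>F y in nhds (snd C x). (rep D E k \<circ> rep C D h) y = rep C E (\<lambda>p. k (h p)) y"
proof (rule eventually_chart[OF M C, of "U \<inter> h -` fst D"])
  show "openin (mtop M) (U \<inter> h -` fst D)" by (rule C2_mapD(3)[OF h chart_openin[OF N D(1)]])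
  fix p assume "p \<in> U \<inter> h -` fst D" "p \<in> fst C"
  then show "(rep D E k \<circ> rep C D h) (snd C p) = rep C E (\<lambda>p. k (h p)) (snd C p)"
    unfolding rep_def by (simp add: chart_inv_chart[OF M C(1)] chart_inv_chart[OF N D(1)])
qed (use x D in auto)

lemma rep_at: "\<lbrakk>smooth_manifold M; C \<in> atlas M; x \<in> fst C\<rbrakk> \<Longrightarrow> rep C D h (snd C x) = snd D (h x)"
  unfolding rep_def by (simp add: chart_inv_chart)

lemma C2_map_comp:
  assumes M: "smooth_manifold M" and N: "smooth_manifold N"
    and h: "C2_map M N U h" and k: "C2_map N P V k"
  shows "C2_map M P (U \<inter> h -` V) (\<lambda>p. k (h p))"
  unfolding C2_map_def
proof (intro conjI allI impI ballI)
  show "openin (mtop M) (U \<inter> h -` V)" by (rule C2_mapD(3)[OF h C2_mapD(1)[OF k]])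
  show "(\<lambda>p. k (h p)) ` (U \<inter> h -` V) \<subseteq> topspace (mtop P)" using C2_mapD(2)[OF k] by auto
  fix W assume W: "openin (mtop P) W"
  have "openin (mtop M) (U \<inter> h -` (V \<inter> k -` W))" by (intro C2_mapD(3)[OF h] C2_mapD(3)[OF k] W)
  moreover have "U \<inter> h -` (V \<inter> k -` W) = U \<inter> h -` V \<inter> (\<lambda>p. k (h p)) -` W" by auto
  ultimately show "openin (mtop M) (U \<inter> h -` V \<inter> (\<lambda>p. k (h p)) -` W)" by simp
next
  fix x C E assume x: "x \<in> U \<inter> h -` V" and C: "C \<in> atlas M" "x \<in> fst C" and E: "E \<in> atlas P" "k (h x) \<in> fst E"
  obtain D where D: "D \<in> atlas N" "h x \<in> fst D"
    using chart_at[OF N C2_mapD(2)[OF h]] x by blast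
  show "twice_differentiable_at (rep C E (\<lambda>p. k (h p))) (snd C x)"
  proof (rule twice_differentiable_at_cong)
    show "\<forall>\<^sub>F y in nhds (snd C x). (rep D E k \<circ> rep C D h) y = rep C E (\<lambda>p. k (h p)) y"
      by (rule rep_comp_eventually[OF M N h _ C D]) (use x in auto)
    show "twice_differentiable_at (rep D E k \<circ> rep C D h) (snd C x)"
      using C2_mapD(4)[OF h, of x C D] C2_mapD(4)[OF k, of "h x" D E] x C D E
      by (intro twice_differentiable_at_comp) (auto simp: rep_at[OF M])
  qed
qed

lemma tang_comp:
  assumes M: "smooth_manifold M" and N: "smooth_manifold N"
    and h: "C2_map M N U h" "p \<in> U" and k: "C2_map N P V k" "h p \<in> V"
    and C: "C \<in> atlas M" "p \<in> fst C" and D: "D \<in> atlas N" "h p \<in> fst D"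
    and E: "E \<in> atlas P" "k (h p) \<in> fst E"
  shows "tang D E k (h p) (tang C D h p v) = tang C E (\<lambda>p. k (h p)) p v"
proof -
  have 1: "rep C D h differentiable at (snd C p)"
    by (rule C2_map_differentiable[OF h C(1) D(1) C(2) D(2)])
  have "rep D E k differentiable at (snd D (h p))"
    by (rule C2_map_differentiable[OF k D(1) E(1) D(2) E(2)])
  then have "frechet_derivative (rep D E k \<circ> rep C D h) (at (snd C p)) v = tang D E k (h p) (tang C D h p v)"
    unfolding tang_def using frechet_derivative_compose[OF 1, of "rep D E k"] by (simp add: rep_at[OF M C])
  moreover have "frechet_derivative (rep D E k \<circ> rep C D h) (at (snd C p)) v = tang C E (\<lambda>p. k (h p)) p v"
    unfolding tang_def by (rule Df_cong_ev[OF rep_comp_eventually[OF M N h C D]])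
  ultimately show ?thesis by simp
qed

lemma tang_cong:
  assumes M: "smooth_manifold M" and C: "C \<in> atlas M" "p \<in> fst C"
    and W: "openin (mtop M) W" "p \<in> W" and eq: "\<And>q. q \<in> W \<Longrightarrow> h q = k q"
  shows "tang C D h p v = tang C D k p v"
  unfolding tang_def
  by (rule Df_cong_ev, rule eventually_chart[OF M C W]) (simp add: rep_def chart_inv_chart[OF M C(1)] eq)

lemma tang_ident:
  assumes M: "smooth_manifold M" and C: "C \<in> atlas M" "p \<in> fst C"
  shows "tang C C (\<lambda>p. p) p v = v"
proof -
  have "tang C C (\<lambda>p. p) p v = Df (\<lambda>y. y) (snd C p) v"
    unfolding tang_def
    by (rule Df_cong_ev, rule eventually_chart[OF M C chart_openin[OF M C(1)] C(2)])
      (simp add: rep_def chart_inv_chart[OF M C(1)])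
  then show ?thesis by simp
qed

lemma tang_linear:
  "\<lbrakk>C2_map M N U h; x \<in> U; C \<in> atlas M; D \<in> atlas N; x \<in> fst C; h x \<in> fst D\<rbrakk> \<Longrightarrow> linear (tang C D h x)"
  unfolding tang_def by (rule linear_frechet_derivative[OF C2_map_differentiable])

lemma tangent_map_tang: "tangent_map M N f x = tang (chart_at M x) (chart_at N (f x)) f x"
  unfolding tangent_map_def dir_deriv_def tang_def rep_def coord_def coord_inv_def by (simp add: o_def)

lemma chart_deriv_tang: "chart_deriv M C x = tang (chart_at M x) C (\<lambda>p. p) x"
  unfolding chart_deriv_def dir_deriv_def tang_def rep_def coord_def coord_inv_def by (simp add: o_def)

lemma chart_lift_tang:
  assumes "smooth_manifold M" "C \<in> atlas M" "p \<in> fst C"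
  shows "chart_lift M C (snd C p) = tang C (chart_at M p) (\<lambda>p. p) p"
  unfolding chart_lift_def tang_def rep_def coord_def by (simp add: o_def chart_inv_chart[OF assms])

lemma const_ext_eq: "const_ext M x w p = chart_lift M (chart_at M x) (snd (chart_at M x) p) w"
  unfolding const_ext_def coord_def ..

context
  fixes M :: "('a, 'e::euclidean_space, 'z) manifold_scheme"
  assumes M: "smooth_manifold M"
begin

lemma chart_topspace: "C \<in> atlas M \<Longrightarrow> p \<in> fst C \<Longrightarrow> p \<in> topspace (mtop M)"
  using openin_subset[OF chart_openin[OF M]] by blast

lemma chart_deriv_lift:
  assumes C: "C \<in> atlas M" "p \<in> fst C"
  shows "chart_deriv M C p (chart_lift M C (snd C p) u) = u" "chart_lift M C (snd C p) (chart_deriv M C p u) = u"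
proof -
  have t: "p \<in> topspace (mtop M)" by (rule chart_topspace[OF C])
  note I = C2_map_ident[OF M] and D = chart_at[OF M t]
  show "chart_deriv M C p (chart_lift M C (snd C p) u) = u"
    unfolding chart_lift_tang[OF M C] chart_deriv_tang
    using tang_comp[OF M M I t I t C D C] tang_ident[OF M C] by simp
  show "chart_lift M C (snd C p) (chart_deriv M C p u) = u"
    unfolding chart_lift_tang[OF M C] chart_deriv_tang
    using tang_comp[OF M M I t I t D C D] tang_ident[OF M D] by simp
qed

lemma chart_deriv_linear:
  assumes C: "C \<in> atlas M" "p \<in> fst C"
  shows "linear (chart_deriv M C p)" "linear (chart_lift M C (snd C p))"
proof -
  have t: "p \<in> topspace (mtop M)" by (rule chart_topspace[OF C])
  note I = C2_map_ident[OF M] and D = chart_at[OF M t]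
  show "linear (chart_deriv M C p)" unfolding chart_deriv_tang using tang_linear[OF I t D(1) C(1) D(2) C(2)] .
  show "linear (chart_lift M C (snd C p))"
    unfolding chart_lift_tang[OF M C] using tang_linear[OF I t C(1) D(1) C(2) D(2)] .
qed

lemma const_ext_at: "x \<in> topspace (mtop M) \<Longrightarrow> const_ext M x w x = w"
  unfolding const_ext_eq using chart_at[OF M] by (simp add: chart_lift_tang[OF M] tang_ident[OF M])

text \<open>Passing from \<open>C\<close> to the chart selected at p, and from the chart selected at
  \<open>h p\<close> to \<open>D\<close>, are differentials of the identity; by
  \<open>tang_comp\<close> the selected charts drop out.\<close>

lemma chart_deriv_tangent_map:
  assumes N: "smooth_manifold N" and h: "C2_map M N U h" "p \<in> U"
    and C: "C \<in> atlas M" "p \<in> fst C" and D: "D \<in> atlas N" "h p \<in> fst D"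
  shows "chart_deriv N D (h p) (tangent_map M N h p (chart_lift M C (snd C p) u)) = tang C D h p u"
proof -
  have t: "p \<in> topspace (mtop M)" by (rule chart_topspace[OF C])
  have t': "h p \<in> topspace (mtop N)" by (rule C2_mapD(2)[OF h])
  note I = C2_map_ident[OF M] C2_map_ident[OF N] and E = chart_at[OF M t] and E' = chart_at[OF N t']
  show ?thesis
    unfolding chart_lift_tang[OF M C] chart_deriv_tang tangent_map_tang
    using tang_comp[OF M M I(1) t h C E, of "chart_at N (h p)" u] E'
      tang_comp[OF M N h I(2) t' C E' D, of u] by simp
qed

end

lemma tangent_map_comp:
  assumes M: "smooth_manifold M" and N: "smooth_manifold N" and P: "smooth_manifold P"
    and h: "C2_map M N U h" "p \<in> U" and k: "C2_map N P V k" "h p \<in> V"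
  shows "tangent_map N P k (h p) (tangent_map M N h p v) = tangent_map M P (\<lambda>p. k (h p)) p v"
proof -
  have "p \<in> topspace (mtop M)" using openin_subset[OF C2_mapD(1)[OF h(1)]] h(2) by blast
  then show ?thesis
    unfolding tangent_map_tang using C2_mapD(2)[OF h] C2_mapD(2)[OF k]
    by (intro tang_comp[OF M N h k] chart_at[OF M] chart_at[OF N] chart_at[OF P])
qed

section \<open>The normal bundle through a submersion\<close>

lemma riemannian_manifoldD:
  assumes "riemannian_manifold T"
  shows "smooth_manifold T" "p \<in> topspace (mtop T) \<Longrightarrow> inner_form (metric T p)"
    "C \<in> atlas T \<Longrightarrow> smooth_on (\<lambda>y. metric_in_chart T C y u v) (snd C ` fst C)"
  using assms unfolding riemannian_manifold_def inner_form_def by auto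

lemma metric_in_chart_at:
  assumes "smooth_manifold T" "B \<in> atlas T" "p \<in> fst B"
  shows "metric_in_chart T B (snd B p) u v = metric T p (chart_lift T B (snd B p) u) (chart_lift T B (snd B p) v)"
  unfolding metric_in_chart_def by (simp add: chart_inv_chart[OF assms])

lemma metric_chart_deriv:
  assumes "smooth_manifold T" "B \<in> atlas T" "p \<in> fst B"
  shows "metric T p u v = metric_in_chart T B (snd B p) (chart_deriv T B p u) (chart_deriv T B p v)"
  by (simp add: metric_in_chart_at[OF assms] chart_deriv_lift[OF assms])

lemma inner_form_linear_image:
  assumes "inner_form g" "linear l" "\<And>u. l u = 0 \<Longrightarrow> u = 0"
  shows "inner_form (\<lambda>u v. g (l u) (l v))"
proof -
  interpret inner_form g by (rule assms(1))
  show ?thesis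
    using assms(2,3) sym pos
    by unfold_locales
      (auto simp: bilinear_def linear_iff g_simps)
qed

lemma metric_germ_chart:
  assumes T: "riemannian_manifold T" and B: "B \<in> atlas T" "t \<in> fst B" and W: "openin (mtop T) W" "t \<in> W"
  shows "metric_germ (metric_in_chart T B) (snd B t) (snd B ` (W \<inter> fst B))"
proof (rule metric_germ.intro)
  note M = riemannian_manifoldD(1)[OF T]
  show "open (snd B ` (W \<inter> fst B))" by (rule chart_open_image[OF M B(1) W(1)])
  show "snd B t \<in> snd B ` (W \<inter> fst B)" using B W by auto
  show "inner_form (metric_in_chart T B q)" if "q \<in> snd B ` (W \<inter> fst B)" for q
  proof -
    obtain p where p: "p \<in> fst B" "q = snd B p" using \<open>q \<in> _\<close> by auto
    have "inner_form (\<lambda>u v. metric T p (chart_lift T B q u) (chart_lift T B q v))"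
    proof (rule inner_form_linear_image)
      show "inner_form (metric T p)"
        by (rule riemannian_manifoldD(2)[OF T chart_topspace[OF M B(1) p(1)]])
      show "linear (chart_lift T B q)" unfolding p(2) by (rule chart_deriv_linear[OF M B(1) p(1)])
      fix u assume "chart_lift T B q u = 0"
      then show "u = 0"
        using chart_deriv_lift(1)[OF M B(1) p(1), of u] linear_0[OF chart_deriv_linear(1)[OF M B(1) p(1)]]
        unfolding p(2) by simp
    qed
    moreover have "metric_in_chart T B q = (\<lambda>u v. metric T p (chart_lift T B q u) (chart_lift T B q v))"
      unfolding p(2) by (simp add: fun_eq_iff metric_in_chart_at[OF M B(1) p(1)])
    ultimately show ?thesis by simp
  qed
  show "(\<lambda>q. metric_in_chart T B q u v) differentiable at (snd B t)" for u v
    by (rule smooth_on_differentiable[OF riemannian_manifoldD(3)[OF T B(1)]]) (use B in auto)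
qed

lemma christoffel_koszul:
  assumes T: "riemannian_manifold T" and B: "B \<in> atlas T" "t \<in> fst B"
  shows "2 * metric_in_chart T B (snd B t) (christoffel T B (snd B t) u w) z =
    Df (\<lambda>q. metric_in_chart T B q w z) (snd B t) u + Df (\<lambda>q. metric_in_chart T B q u z) (snd B t) w
    - Df (\<lambda>q. metric_in_chart T B q u w) (snd B t) z"
proof -
  note M = riemannian_manifoldD(1)[OF T]
  interpret metric_germ "metric_in_chart T B" "snd B t" "snd B ` (fst B \<inter> fst B)"
    by (rule metric_germ_chart[OF T B chart_openin[OF M B(1)] B(2)])
  from theI'[OF christoffel_exists[of w u]] show ?thesis unfolding christoffel_def by blast
qed

definition endo_in_chart ::
  "('a, 'e::euclidean_space, 'z) manifold_scheme \<Rightarrow> 'a set \<times> ('a \<Rightarrow> 'e) \<Rightarrow> ('a \<Rightarrow> 'e \<Rightarrow> 'e) \<Rightarrow> 'e \<Rightarrow> 'e \<Rightarrow> 'e" where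
  "endo_in_chart M C K y u = chart_deriv M C (chart_inv C y) (K (chart_inv C y) (chart_lift M C y u))"

lemma endo_in_chart_deriv:
  assumes "smooth_manifold T" "B \<in> atlas T" "p \<in> fst B"
  shows "endo_in_chart T B K (snd B p) (chart_deriv T B p u) = chart_deriv T B p (K p u)"
  unfolding endo_in_chart_def by (simp add: chart_inv_chart[OF assms] chart_deriv_lift[OF assms])

lemma hermitian_germ_chart:
  assumes T: "riemannian_manifold T" and B: "B \<in> atlas T" "t \<in> fst B"
    and K: "smooth_endo_field T V K" and t: "t \<in> V"
    and KK: "\<And>p u. p \<in> V \<Longrightarrow> K p (K p u) = - u"
    and gKK: "\<And>p u v. p \<in> V \<Longrightarrow> metric T p (K p u) (K p v) = metric T p u v"
  shows "hermitian_germ (metric_in_chart T B) (snd B t) (snd B ` (V \<inter> fst B)) (endo_in_chart T B K)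
    (christoffel T B (snd B t))"
proof -
  note M = riemannian_manifoldD(1)[OF T]
  have V: "openin (mtop T) V" and lin: "\<And>p. p \<in> V \<Longrightarrow> linear (K p)"
    and sm: "\<And>u. smooth_on (\<lambda>y. endo_in_chart T B K y u) (snd B ` (V \<inter> fst B))"
    using K B unfolding smooth_endo_field_def endo_in_chart_def by auto
  have at: "endo_in_chart T B K (snd B p) u = chart_deriv T B p (K p (chart_lift T B (snd B p) u))"
    if "p \<in> fst B" for p u
    using endo_in_chart_deriv[OF M B(1) that, of K "chart_lift T B (snd B p) u"]
    by (simp add: chart_deriv_lift[OF M B(1) that])
  interpret metric_germ "metric_in_chart T B" "snd B t" "snd B ` (V \<inter> fst B)"
    by (rule metric_germ_chart[OF T B V t])
  show ?thesis
  proof (rule hermitian_germ.intro[OF metric_germ_axioms hermitian_germ_axioms.intro])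
    fix q u v assume "q \<in> snd B ` (V \<inter> fst B)"
    then obtain p where p: "p \<in> V" "p \<in> fst B" and q: "q = snd B p" by auto
    note cl = chart_deriv_lift[OF M B(1) p(2)] and li = chart_deriv_linear[OF M B(1) p(2)]
    show "linear (endo_in_chart T B K q)"
      unfolding q at[OF p(2), abs_def]
      by (rule linearI) (simp_all add: linear_add[OF li(1)] linear_add[OF li(2)] linear_add[OF lin[OF p(1)]]
          linear_cmul[OF li(1)] linear_cmul[OF li(2)] linear_cmul[OF lin[OF p(1)]])
    show "endo_in_chart T B K q (endo_in_chart T B K q u) = - u"
      unfolding q at[OF p(2)] by (simp add: cl KK[OF p(1)] linear_neg[OF li(1)])
    show "metric_in_chart T B q (endo_in_chart T B K q u) (endo_in_chart T B K q v) = metric_in_chart T B q u v"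
      unfolding q at[OF p(2)] by (simp add: metric_in_chart_at[OF M B(1) p(2)] cl gKK[OF p(1)])
  next
    fix u show "(\<lambda>q. endo_in_chart T B K q u) differentiable at (snd B t)"
      by (rule smooth_on_differentiable[OF sm]) (use B t in auto)
  next
    fix u w z
    show "2 * metric_in_chart T B (snd B t) (christoffel T B (snd B t) u w) z =
      Df (\<lambda>q. metric_in_chart T B q w z) (snd B t) u + Df (\<lambda>q. metric_in_chart T B q u z) (snd B t) w
      - Df (\<lambda>q. metric_in_chart T B q u w) (snd B t) z"
      by (rule christoffel_koszul[OF T B])
  qed
qed

section \<open>Normal spaces and their metric seen through a submersion of the cocycle\<close>

lemma foliated_riemannianD:
  assumes "foliated_riemannian S"
  shows "riemannian_manifold S" "riemannian_manifold (model S)" "smooth_manifold S" "smooth_manifold (model S)"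
    "x \<in> topspace (mtop S) \<Longrightarrow> \<exists>U f. (U, f) \<in> cocycle S \<and> x \<in> U"
proof -
  show 1: "riemannian_manifold S" "riemannian_manifold (model S)"
    using assms unfolding foliated_riemannian_def by simp_all
  show "smooth_manifold S" "smooth_manifold (model S)" using 1 by (auto intro: riemannian_manifoldD)
  have cov: "(\<Union>(U, f)\<in>cocycle S. U) = topspace (mtop S)"
    using assms unfolding foliated_riemannian_def by (elim conjE)
  assume "x \<in> topspace (mtop S)"
  then have "x \<in> (\<Union>(U, f)\<in>cocycle S. U)" unfolding cov .
  then obtain z where "z \<in> cocycle S" "x \<in> (case z of (U, f) \<Rightarrow> U)" by (rule UN_E)
  then show "\<exists>U f. (U, f) \<in> cocycle S \<and> x \<in> U" by (cases z) auto
qed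

context
  fixes S :: "('a, 'e::euclidean_space, 't, 'q::euclidean_space, 'z) foliated_scheme" and U f
  assumes S: "foliated_riemannian S" and Uf: "(U, f) \<in> cocycle S"
begin

lemma cocycle_C2: "C2_map S (model S) U f"
  by (rule smooth_map_C2[OF foliated_riemannianD(3,4)[OF S] cocycle_smooth_map[OF S Uf]])

lemma cocycle_topspace: "x \<in> U \<Longrightarrow> x \<in> topspace (mtop S)"
  using openin_subset[OF cocycle_openin[OF S Uf]] by blast

lemma tangent_map_cocycle_linear:
  assumes "x \<in> U" shows "linear (tangent_map S (model S) f x)"
  unfolding tangent_map_tang
  using tang_linear[OF cocycle_C2 assms chart_at(1)[OF foliated_riemannianD(3)[OF S] cocycle_topspace[OF assms]]
      chart_at(1)[OF foliated_riemannianD(4)[OF S] C2_mapD(2)[OF cocycle_C2 assms]]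
      chart_at(2)[OF foliated_riemannianD(3)[OF S] cocycle_topspace[OF assms]]
      chart_at(2)[OF foliated_riemannianD(4)[OF S] C2_mapD(2)[OF cocycle_C2 assms]]] .

lemma tangent_map_cocycle_surj: "x \<in> U \<Longrightarrow> surj (tangent_map S (model S) f x)"
  using cocycleD(1)[OF S Uf] unfolding riemannian_submersion_def by blast

text \<open>Near x one has \<open>h = \<gamma> \<circ> f\<close>, so the differential of h factors
  through that of f. Hence \<open>leaf_tangent\<close>, an intersection over all submersions at x,
  will be the kernel of any one of them.\<close>

lemma tangent_map_cocycle_kernel:
  assumes Vh: "(V, h) \<in> cocycle S" and x: "x \<in> U" "x \<in> V" and v: "tangent_map S (model S) f x v = 0"
  shows "tangent_map S (model S) h x v = 0"
proof -
  let ?T = "model S"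
  note M = foliated_riemannianD(3,4)[OF S]
  have "\<forall>(U, f)\<in>cocycle S. \<forall>(V, h)\<in>cocycle S. \<exists>\<gamma>.
        local_isometry (model S) (f ` (U \<inter> V)) \<gamma> \<and> (\<forall>x\<in>U \<inter> V. h x = \<gamma> (f x))"
    using S unfolding foliated_riemannian_def by (elim conjE)
  from bspec[OF this Uf] have "\<forall>(V, h)\<in>cocycle S. \<exists>\<gamma>.
        local_isometry (model S) (f ` (U \<inter> V)) \<gamma> \<and> (\<forall>x\<in>U \<inter> V. h x = \<gamma> (f x))" by simp
  from bspec[OF this Vh] obtain \<gamma> where "local_isometry ?T (f ` (U \<inter> V)) \<gamma>"
    and eq: "\<And>x. x \<in> U \<inter> V \<Longrightarrow> h x = \<gamma> (f x)" by auto
  then have "smooth_map ?T ?T (f ` (U \<inter> V)) \<gamma>" unfolding local_isometry_def by (elim conjE)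
  then have g: "C2_map ?T ?T (f ` (U \<inter> V)) \<gamma>" by (rule smooth_map_C2[OF M(2,2)])
  have fx: "f x \<in> f ` (U \<inter> V)" using x by blast
  note C = chart_at[OF M(1) cocycle_topspace[OF x(1)]]
  have W: "openin (mtop S) (U \<inter> V)" "x \<in> U \<inter> V"
    using cocycle_openin[OF S Uf] cocycle_openin[OF S Vh] x by auto
  have "tangent_map S ?T h x v = tangent_map S ?T (\<lambda>p. \<gamma> (f p)) x v"
    unfolding tangent_map_tang eq[OF W(2)] by (rule tang_cong[OF M(1) C W eq])
  also have "\<dots> = tangent_map ?T ?T \<gamma> (f x) (tangent_map S ?T f x v)"
    by (rule tangent_map_comp[OF M(1,2,2) cocycle_C2 x(1) g fx, symmetric])
  also have "\<dots> = 0"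
  proof -
    have a: "f x \<in> topspace (mtop ?T)" "\<gamma> (f x) \<in> topspace (mtop ?T)"
      using C2_mapD(2)[OF cocycle_C2 x(1)] C2_mapD(2)[OF g fx] by auto
    have "linear (tangent_map ?T ?T \<gamma> (f x))"
      unfolding tangent_map_tang
      by (rule tang_linear[OF g fx chart_at(1)[OF M(2) a(1)] chart_at(1)[OF M(2) a(2)]
          chart_at(2)[OF M(2) a(1)] chart_at(2)[OF M(2) a(2)]])
    then show ?thesis unfolding v by (rule linear_0)
  qed
  finally show ?thesis .
qed

lemma leaf_tangent_eq:
  assumes x: "x \<in> U"
  shows "leaf_tangent S x = {v. tangent_map S (model S) f x v = 0}"
proof
  show "leaf_tangent S x \<subseteq> {v. tangent_map S (model S) f x v = 0}"
  proof
    fix v assume "v \<in> leaf_tangent S x"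
    then have "\<forall>(U, f)\<in>cocycle S. x \<in> U \<longrightarrow> tangent_map S (model S) f x v = 0"
      unfolding leaf_tangent_def by (rule CollectD)
    from bspec[OF this Uf] x show "v \<in> {v. tangent_map S (model S) f x v = 0}" by simp
  qed
  show "{v. tangent_map S (model S) f x v = 0} \<subseteq> leaf_tangent S x"
  proof
    fix v assume v: "v \<in> {v. tangent_map S (model S) f x v = 0}"
    have "case z of (V, h) \<Rightarrow> x \<in> V \<longrightarrow> tangent_map S (model S) h x v = 0" if "z \<in> cocycle S" for z
      using tangent_map_cocycle_kernel[of "fst z" "snd z"] that x v by (cases z) auto
    then show "v \<in> leaf_tangent S x" unfolding leaf_tangent_def by blast
  qed
qed

text \<open>Classes are cosets of the kernel, that is, fibres of the differential. Through this all
  later statements about normal classes become equations in the model.\<close>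

lemma normal_class_eq:
  assumes x: "x \<in> U"
  shows "normal_class S x v = normal_class S x w \<longleftrightarrow> tangent_map S (model S) f x v = tangent_map S (model S) f x w"
proof -
  note lin = tangent_map_cocycle_linear[OF x]
  have cl: "normal_class S x v = {u. tangent_map S (model S) f x u = tangent_map S (model S) f x v}" for v
  proof -
    have "u \<in> normal_class S x v \<longleftrightarrow> u - v \<in> leaf_tangent S x" for u
    proof
      assume "u \<in> normal_class S x v"
      then show "u - v \<in> leaf_tangent S x" unfolding normal_class_def by auto
    next
      assume "u - v \<in> leaf_tangent S x"
      then show "u \<in> normal_class S x v"
        unfolding normal_class_def by (intro CollectI exI[of _ "u - v"]) simp
    qed
    then show ?thesis unfolding leaf_tangent_eq[OF x] by (auto simp: linear_diff[OF lin])
  qed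
  show ?thesis unfolding cl by (metis (mono_tags) mem_Collect_eq)
qed

text \<open>Horizontal representatives exist by orthogonal projection and are unique by positivity,
  so \<open>horizontal\<close> is meaningful. A Riemannian submersion is isometric on horizontal
  vectors, and its differential does not see the removed vertical part.\<close>

lemma gQ_eq:
  assumes x: "x \<in> U"
  shows "gQ S x v w = metric (model S) (f x) (tangent_map S (model S) f x v) (tangent_map S (model S) f x w)"
proof -
  let ?L = "tangent_map S (model S) f x"
  note lin = tangent_map_cocycle_linear[OF x]
  interpret inner_form "metric S x"
    by (rule riemannian_manifoldD(2)[OF foliated_riemannianD(1)[OF S] cocycle_topspace[OF x]])
  have sub: "subspace (leaf_tangent S x)"
    unfolding leaf_tangent_eq[OF x] by (rule linear_subspace_kernel[OF lin])
  have hor: "?L (horizontal S x v) = ?L v \<and> (\<forall>t\<in>leaf_tangent S x. metric S x (horizontal S x v) t = 0)" for v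
  proof -
    obtain t where t: "t \<in> leaf_tangent S x" "\<And>s. s \<in> leaf_tangent S x \<Longrightarrow> metric S x (v - t) s = 0"
      using orthogonal_projection[OF sub] by blast
    have "\<exists>!h. h \<in> normal_class S x v \<and> (\<forall>t\<in>leaf_tangent S x. metric S x h t = 0)"
    proof (rule ex1I[of _ "v - t"])
      have "v - t = v + (- t)" "- t \<in> leaf_tangent S x" using t(1) sub by (auto simp: subspace_neg)
      then have "v - t \<in> normal_class S x v" unfolding normal_class_def by blast
      then show "v - t \<in> normal_class S x v \<and> (\<forall>s\<in>leaf_tangent S x. metric S x (v - t) s = 0)" using t(2) by blast
      fix h assume h: "h \<in> normal_class S x v \<and> (\<forall>t\<in>leaf_tangent S x. metric S x h t = 0)"
      then obtain s where s: "h = v + s" "s \<in> leaf_tangent S x" unfolding normal_class_def by blast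
      then have d: "h - (v - t) = s + t" by simp
      have st: "s + t \<in> leaf_tangent S x" using s(2) t(1) sub by (rule subspace_add[rotated])
      have "metric S x (h - (v - t)) (s + t) = 0" using h t(2)[OF st] st by (simp only: g_simps(9))
      then have "s + t = 0" unfolding d using pos[of "s + t"] by fastforce
      then show "h = v - t" using d by simp
    qed
    from theI'[OF this] have h: "horizontal S x v \<in> normal_class S x v"
      "\<forall>t\<in>leaf_tangent S x. metric S x (horizontal S x v) t = 0"
      unfolding horizontal_def by auto
    from h(1) obtain s where "horizontal S x v = v + s" "s \<in> leaf_tangent S x" unfolding normal_class_def by blast
    then have "?L (horizontal S x v) = ?L v" by (simp add: leaf_tangent_eq[OF x] linear_add[OF lin])
    with h(2) show ?thesis by blast
  qed
  have iso: "metric (model S) (f x) (?L v) (?L w) = metric S x v w"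
    if "\<And>t. ?L t = 0 \<Longrightarrow> metric S x v t = 0 \<and> metric S x w t = 0" for v w
    using cocycleD(1)[OF S Uf] x that unfolding riemannian_submersion_def by blast
  have "metric (model S) (f x) (?L (horizontal S x v)) (?L (horizontal S x w))
      = metric S x (horizontal S x v) (horizontal S x w)"
    by (rule iso) (use hor leaf_tangent_eq[OF x] in auto)
  then show ?thesis unfolding gQ_def using hor by simp
qed

end

lemma submersion_at:
  assumes "foliated_riemannian S" "x \<in> topspace (mtop S)"
  obtains U where "(U, submersion_at S x) \<in> cocycle S" "x \<in> U"
proof -
  have "\<exists>f U. (U, f) \<in> cocycle S \<and> x \<in> U" using foliated_riemannianD(5)[OF assms] by blast
  from someI_ex[OF this] show thesis unfolding submersion_at_def[symmetric] using that by blast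
qed

text \<open>In charts the section is represented by \<open>Df H y Y\<close>, whose derivative in the
  direction X is the second derivative of \<open>H\<close>. With the identity as \<psi> this
  computes the connection of the source, with the given foliated map as \<psi> the connection along
  it.\<close>

lemma normal_conn_along_eq:
  fixes M :: "('c, 'd::euclidean_space, 'y) manifold_scheme"
    and S :: "('a, 'e::euclidean_space, 't, 'q::euclidean_space, 'z) foliated_scheme"
  assumes M: "smooth_manifold M" and S: "foliated_riemannian S"
    and Uf: "(U, f) \<in> cocycle S" "\<psi> x \<in> U" and f: "f = submersion_at S (\<psi> x)"
    and \<psi>: "C2_map M S V \<psi>" "x \<in> V"
    and s: "\<And>p. p \<in> V \<Longrightarrow> \<psi> p \<in> U \<Longrightarrow> p \<in> fst (chart_at M x) \<Longrightarrow>
       tangent_map S (model S) f (\<psi> p) (s p) = tangent_map M (model S) (\<lambda>p. f (\<psi> p)) p (const_ext M x Y p)"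
  defines "B \<equiv> chart_at (model S) (f (\<psi> x))"
  defines "H \<equiv> rep (chart_at M x) B (\<lambda>p. f (\<psi> p))" and "y0 \<equiv> snd (chart_at M x) x"
  shows "tangent_map S (model S) f (\<psi> x) (normal_conn_along M S \<psi> s x X) =
     D2f H y0 X Y + christoffel (model S) B (snd B (f (\<psi> x))) (Df H y0 X) (Df H y0 Y)"
proof -
  let ?T = "model S" and ?C = "chart_at M x" and ?h = "\<lambda>p. f (\<psi> p)"
  let ?L = "tangent_map S ?T f (\<psi> x)"
  let ?v = "pullback_lc M ?T (f \<circ> \<psi>) (\<lambda>p. tangent_map S ?T f (\<psi> p) (s p)) x X"
  note N = foliated_riemannianD(3,4)[OF S]
  have x: "x \<in> topspace (mtop M)" using openin_subset[OF C2_mapD(1)[OF \<psi>(1)]] \<psi>(2) by blast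
  note C = chart_at[OF M x]
  have h: "C2_map M ?T (V \<inter> \<psi> -` U) ?h" by (rule C2_map_comp[OF M N(1) \<psi>(1) cocycle_C2[OF S Uf(1)]])
  have xh: "x \<in> V \<inter> \<psi> -` U" using \<psi>(2) Uf(2) by simp
  have B: "B \<in> atlas ?T" "f (\<psi> x) \<in> fst B"
    unfolding B_def using chart_at[OF N(2) C2_mapD(2)[OF h xh]] by auto
  \<comment> \<open>The selected vector is determined only up to the kernel of \<open>?L\<close>;
    surjectivity ensures that a vector with this image exists.\<close>
  have "\<exists>w. ?L w = ?v" using tangent_map_cocycle_surj[OF S Uf] by (metis surjD)
  then have "?L (SOME w. ?L w = ?v) = ?v" by (rule someI_ex)
  then have 1: "?L (normal_conn_along M S \<psi> s x X) = ?v"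
    unfolding normal_conn_along_def Let_def f[symmetric] .
  have tm: "tangent_map M ?T ?h x = Df H y0"
    unfolding tangent_map_tang tang_def H_def y0_def B_def ..
  have sx: "?L (s x) = Df H y0 Y"
    using s[OF \<psi>(2) Uf(2) C(2)] by (simp add: const_ext_at[OF M x] tm)
  let ?G = "\<lambda>p. chart_deriv ?T B (f (\<psi> p)) (tangent_map S ?T f (\<psi> p) (s p))"
  have "dir_deriv M ?G x X = D2f H y0 X Y"
  proof -
    have "dir_deriv M ?G x X = Df (?G \<circ> chart_inv ?C) y0 X"
      unfolding dir_deriv_def coord_def coord_inv_def y0_def ..
    also have "\<dots> = D2f H y0 X Y"
    proof (rule Df_cong_ev, unfold y0_def, rule eventually_chart[OF M C])
      show "openin (mtop M) ((V \<inter> \<psi> -` U) \<inter> ?h -` fst B)" by (rule C2_mapD(3)[OF h chart_openin[OF N(2) B(1)]])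
      show "x \<in> (V \<inter> \<psi> -` U) \<inter> ?h -` fst B" using xh B by simp
      fix p assume p: "p \<in> (V \<inter> \<psi> -` U) \<inter> ?h -` fst B" and pC: "p \<in> fst ?C"
      have "(?G \<circ> chart_inv ?C) (snd ?C p) = ?G p" by (simp add: chart_inv_chart[OF M C(1) pC])
      also have "\<dots> = chart_deriv ?T B (?h p) (tangent_map M ?T ?h p (chart_lift M ?C (snd ?C p) Y))"
        using s[of p] p pC by (simp add: const_ext_eq)
      also have "\<dots> = tang ?C B ?h p Y"
        by (rule chart_deriv_tangent_map[OF M N(2) h]) (use p pC C B in auto)
      finally show "(?G \<circ> chart_inv ?C) (snd ?C p) = Df H (snd ?C p) Y" unfolding tang_def H_def .
    qed
    finally show ?thesis .
  qed
  moreover have "?v = dir_deriv M ?G x X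
      + christoffel ?T B (snd B (f (\<psi> x))) (tangent_map M ?T ?h x X) (?L (s x))"
    unfolding pullback_lc_def coord_def B_def o_def ..
  ultimately show ?thesis unfolding 1 tm sx by (simp only:)
qed

section \<open>The transverse structure near one point, read in charts\<close>

text \<open>The submersion has to be the one selected by \<open>submersion_at\<close>, since the
  connection is computed with it; \<open>W\<close> is a neighbourhood on which J descends to an
  endomorphism field of the model.\<close>

locale hermitian_foliation_point =
  fixes S :: "('a, 'e::euclidean_space, 't, 'q::euclidean_space, 'z) trans_hermitian_scheme"
    and x :: 'a and U W :: "'a set" and f :: "'a \<Rightarrow> 't" and K :: "'t \<Rightarrow> 'q \<Rightarrow> 'q"
  assumes S: "transversely_almost_hermitian S"
    and Uf: "(U, f) \<in> cocycle S" and f: "f = submersion_at S x"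
    and W: "openin (mtop S) W" "x \<in> W" "W \<subseteq> U"
    and K: "smooth_endo_field (model S) (f ` W) K"
    and tangent_map_acs: "p \<in> W \<Longrightarrow>
      tangent_map S (model S) f p (acs S p v) = K (f p) (tangent_map S (model S) f p v)"
begin

definition "T = model S"
definition "C = chart_at S x"
definition "B = chart_at T (f x)"
definition "F = rep C B f"
definition "y0 = snd C x"
definition "q0 = snd B (f x)"
definition "g = metric_in_chart T B"
definition "Kc = endo_in_chart T B K"
definition "\<Gamma> = christoffel T B q0"
definition "G = W \<inter> (U \<inter> f -` fst B)"
abbreviation "Tf \<equiv> tangent_map S T f"

lemma fol: "foliated_riemannian S"
  using S unfolding transversely_almost_hermitian_def by blast

lemma acs_facts:
  assumes "p \<in> topspace (mtop S)"
  shows "normal_class S p (acs S p (acs S p v)) = normal_class S p (- v)"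
    "gQ S p (acs S p v) (acs S p w) = gQ S p v w"
  using S assms unfolding transversely_almost_hermitian_def by blast+

lemmas M = foliated_riemannianD(3)[OF fol]
lemmas N = foliated_riemannianD(4)[OF fol, folded T_def]
lemmas RT = foliated_riemannianD(2)[OF fol, folded T_def]
lemmas C2f = cocycle_C2[OF fol Uf, folded T_def]

lemma xU: "x \<in> U" using W by blast

lemma x_top: "x \<in> topspace (mtop S)" by (rule cocycle_topspace[OF fol Uf xU])

lemmas C = chart_at[OF M x_top, folded C_def]
lemmas B = chart_at[OF N C2_mapD(2)[OF C2f xU], folded B_def]

lemmas Tf_linear = tangent_map_cocycle_linear[OF fol Uf, folded T_def]
lemmas Tf_surj = tangent_map_cocycle_surj[OF fol Uf, folded T_def]
lemmas normal_class_Tf = normal_class_eq[OF fol Uf, folded T_def]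
lemmas gQ_Tf = gQ_eq[OF fol Uf, folded T_def]
lemmas Tf_acs = tangent_map_acs[folded T_def]

lemma WU: "p \<in> W \<Longrightarrow> p \<in> U" using W by blast

text \<open>The relations for J hold between normal classes, and every tangent vector of the model
  at \<open>f p\<close> is an image under the surjective differential, so they descend to
  \<open>K\<close>.\<close>

lemma K_facts:
  assumes p: "p \<in> W"
  shows "K (f p) (K (f p) u) = - u" "metric T (f p) (K (f p) u) (K (f p) v) = metric T (f p) u v"
proof -
  have t: "p \<in> topspace (mtop S)" by (rule cocycle_topspace[OF fol Uf WU[OF p]])
  obtain u' v' where u': "Tf p u' = u" and v': "Tf p v' = v" using Tf_surj[OF WU[OF p]] by (metis surjD)
  have "Tf p (acs S p (acs S p u')) = Tf p (- u')" using acs_facts(1)[OF t] normal_class_Tf[OF WU[OF p]] by blast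
  then show "K (f p) (K (f p) u) = - u" by (simp add: Tf_acs[OF p] u' linear_neg[OF Tf_linear[OF WU[OF p]]])
  show "metric T (f p) (K (f p) u) (K (f p) v) = metric T (f p) u v"
    using acs_facts(2)[OF t, of u' v'] unfolding gQ_Tf[OF WU[OF p]] Tf_acs[OF p] u' v' .
qed

text \<open>Openness of the image of \<open>W\<close> is part of \<open>smooth_endo_field\<close>;
  this provides the open set on which the relations of the complex structure can be
  differentiated.\<close>

sublocale germ: hermitian_germ g q0 "snd B ` (f ` W \<inter> fst B)" Kc \<Gamma>
  unfolding g_def q0_def Kc_def \<Gamma>_def
proof (rule hermitian_germ_chart[OF RT B K[folded T_def]])
  show "f x \<in> f ` W" using W(2) by blast
qed (use K_facts in auto)

lemma F_twice: "twice_differentiable_at F y0"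
  unfolding F_def y0_def by (rule C2_mapD(4)[OF C2f xU C(1) B(1) C(2) B(2)])

lemma F_chart: "p \<in> fst C \<Longrightarrow> F (snd C p) = snd B (f p)"
  unfolding F_def by (rule rep_at[OF M C(1)])

lemma F_y0: "F y0 = q0"
  unfolding y0_def q0_def by (rule F_chart[OF C(2)])

lemma DF: "Df F y0 = Tf x"
  unfolding tangent_map_tang tang_def F_def y0_def C_def B_def ..

lemma DF_linear: "linear (Df F y0)" and DF_surj: "surj (Df F y0)"
  unfolding DF by (rule Tf_linear[OF xU], rule Tf_surj[OF xU])

lemma G: "openin (mtop S) G" "x \<in> G"
  unfolding G_def using W xU B C2_mapD(3)[OF C2f chart_openin[OF N B(1)]] by auto

lemma DF_chart:
  assumes "p \<in> G" "p \<in> fst C"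
  shows "Df F (snd C p) u = chart_deriv T B (f p) (Tf p (chart_lift S C (snd C p) u))"
proof -
  have p: "p \<in> U" "f p \<in> fst B" using assms unfolding G_def by auto
  show ?thesis
    using chart_deriv_tangent_map[OF M N C2f p(1) C(1) assms(2) B(1) p(2)]
    unfolding tang_def F_def by simp
qed

lemma chart_deriv_f: "p \<in> fst B \<Longrightarrow> p = f x \<Longrightarrow> chart_deriv T B p u = u"
  unfolding chart_deriv_tang B_def[symmetric] by (simp add: tang_ident[OF N B] flip: B_def)

lemma gQ_germ: "gQ S x v w = g q0 (Df F y0 v) (Df F y0 w)"
  unfolding gQ_Tf[OF xU] DF g_def q0_def by (simp add: metric_chart_deriv[OF N B] chart_deriv_f[OF B(2)])

lemma L_acs: "Df F y0 (acs S x v) = Kc q0 (Df F y0 v)"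
  using endo_in_chart_deriv[OF N B, of K "Tf x v"]
  unfolding DF Tf_acs[OF W(2)] Kc_def q0_def chart_deriv_f[OF B(2) refl] by simp

lemma normal_class_germ: "normal_class S x v = normal_class S x w \<longleftrightarrow> Df F y0 v = Df F y0 w"
  unfolding DF by (rule normal_class_Tf[OF xU])

sublocale fibre: hermitian_fibre S x "Df F y0" "g q0" "Kc q0"
  by (rule hermitian_fibre.intro[OF DF_linear DF_surj germ.inner_form_axioms germ.lin[OF germ.S(2)]
      germ.K_K[OF germ.S(2)] germ.g_K_K[OF germ.S(2)] gQ_germ L_acs normal_class_germ])

lemma normal_conn_DF:
  "Df F y0 (normal_conn S (const_ext S x Y) x X) = D2f F y0 X Y + \<Gamma> (Df F y0 X) (Df F y0 Y)"
proof -
  have "Tf x (normal_conn S (const_ext S x Y) x X) = D2f F y0 X Y + \<Gamma> (Df F y0 X) (Df F y0 Y)"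
    using normal_conn_along_eq[OF M fol Uf _ f C2_map_ident[OF M] x_top refl, of Y X] xU
    unfolding normal_conn_def F_def \<Gamma>_def q0_def B_def C_def y0_def T_def by simp
  then show ?thesis unfolding DF .
qed

lemma fundamental_chart:
  assumes "p \<in> G" "p \<in> fst C"
  shows "fundamental S p (chart_lift S C (snd C p) Y) (chart_lift S C (snd C p) Z) =
    g (F (snd C p)) (Kc (F (snd C p)) (Df F (snd C p) Y)) (Df F (snd C p) Z)"
proof -
  have p: "p \<in> U" "p \<in> W" "f p \<in> fst B" using assms unfolding G_def by auto
  show ?thesis
    unfolding fundamental_def gQ_Tf[OF p(1)] metric_chart_deriv[OF N B(1) p(3)] Tf_acs[OF p(2)]
      F_chart[OF assms(2)] g_def Kc_def DF_chart[OF assms] endo_in_chart_deriv[OF N B(1) p(3)] ..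
qed

lemma fundamental_germ: "fundamental S x Y Z = g q0 (Kc q0 (Df F y0 Y)) (Df F y0 Z)"
  unfolding fundamental_def gQ_germ L_acs ..

lemma nabla_fundamental_germ:
  "nabla_fundamental S x X Y Z = g q0 (germ.nabla_K (Df F y0 X) (Df F y0 Y)) (Df F y0 Z)"
proof -
  let ?\<omega> = "\<lambda>p. fundamental S p (const_ext S x Y p) (const_ext S x Z p)"
  have F1: "F differentiable at y0" by (rule twice_differentiable_imp_differentiable[OF F_twice])
  have F2: "(\<lambda>y. Df F y v) differentiable at y0" for v
    using F_twice unfolding twice_differentiable_at_def by blast
  have "dir_deriv S ?\<omega> x X = Df (?\<omega> \<circ> chart_inv C) y0 X"
    unfolding dir_deriv_def coord_def coord_inv_def y0_def C_def ..
  also have "\<dots> = Df (\<lambda>y. g (F y) (Kc (F y) (Df F y Y)) (Df F y Z)) y0 X"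
    unfolding y0_def
  proof (rule Df_cong_ev, rule eventually_chart[OF M C G])
    fix p assume p: "p \<in> G" "p \<in> fst C"
    show "(?\<omega> \<circ> chart_inv C) (snd C p) =
        g (F (snd C p)) (Kc (F (snd C p)) (Df F (snd C p) Y)) (Df F (snd C p) Z)"
      using fundamental_chart[OF p] by (simp add: chart_inv_chart[OF M C(1) p(2)] const_ext_eq flip: C_def)
  qed
  finally show ?thesis
    using germ.nabla_fundamental_chart[OF has_derivative_Df[OF F1] F_y0 has_derivative_Df[OF F2] has_derivative_Df[OF F2], of Y Z X]
    unfolding nabla_fundamental_def fundamental_germ normal_conn_DF by simp
qed

text \<open>Alternation of \<nabla>F in its last two slots is the skewness of \<nabla>J, and its
  change of sign under J in both slots comes from the anticommutation of \<nabla>J with J.\<close>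

lemma D2_germ:
  "D2_fundamental S x X Y Z = complex_of_real (g q0 (germ.nabla_K (Df F y0 X) (Df F y0 Y)
     + germ.nabla_K (Kc q0 (Df F y0 X)) (Kc q0 (Df F y0 Y))) (Df F y0 Z) / 2)"
proof -
  have "D2_fundamental S x X Y Z = complex_of_real ((g q0 (germ.nabla_K (Df F y0 X) (Df F y0 Y)) (Df F y0 Z)
     + g q0 (germ.nabla_K (Kc q0 (Df F y0 X)) (Kc q0 (Df F y0 Y))) (Df F y0 Z)) / 2)"
  proof (rule fibre.D2_fundamental_eq[where T = "\<lambda>u v w. g q0 (germ.nabla_K u v) w"])
    show "nabla_fundamental S x X Y Z = g q0 (germ.nabla_K (Df F y0 X) (Df F y0 Y)) (Df F y0 Z)" for X Y Z
      by (rule nabla_fundamental_germ)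
    show "linear (\<lambda>u. g q0 (germ.nabla_K u v) w)" for v w
      by (rule linearI) (simp_all add: linear_add[OF germ.nabla_K_linear_left] linear_cmul[OF germ.nabla_K_linear_left] germ.g_simps)
    show "linear (\<lambda>v. g q0 (germ.nabla_K u v) w)" for u w
      by (rule linearI) (simp_all add: linear_add[OF germ.nabla_K_linear] linear_cmul[OF germ.nabla_K_linear] germ.g_simps)
    show "linear (g q0 (germ.nabla_K u v))" for u v
      by (rule linearI) (simp_all add: germ.g_simps)
    show "g q0 (germ.nabla_K u v) w = - g q0 (germ.nabla_K u w) v" for u v w
      using germ.nabla_K_skew[of u v w] germ.sym[of v] by simp
    show "g q0 (germ.nabla_K u (Kc q0 v)) (Kc q0 w) = - g q0 (germ.nabla_K u v) w" for u v w
      by (simp add: germ.nabla_K_K germ.g_simps germ.g_K_K[OF germ.S(2)])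
  qed
  then show ?thesis by (simp add: germ.g_simps)
qed

text \<open>An orthonormal basis of the model lifts through the surjective differential, so the
  choice in \<open>normal_frame\<close> succeeds.\<close>

lemma frame_orthonormal: "germ.orthonormal (\<lambda>a. Df F y0 (normal_frame S x a)) (DIM('q))"
proof -
  obtain e where e: "germ.orthonormal e (DIM('q))" using germ.orthonormal_exists by blast
  have "\<forall>a<DIM('q). \<forall>b<DIM('q). gQ S x (inv (Df F y0) (e a)) (inv (Df F y0) (e b)) = (if a = b then 1 else 0)"
    using e unfolding gQ_germ surj_f_inv_f[OF DF_surj] germ.orthonormal_def .
  then have "\<exists>e. \<forall>a<DIM('q). \<forall>b<DIM('q). gQ S x (e a) (e b) = (if a = b then 1 else 0)"
    by (rule exI[of _ "\<lambda>a. inv (Df F y0) (e a)"])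
  from someI_ex[OF this, folded normal_frame_def] show ?thesis
    unfolding germ.orthonormal_def gQ_germ .
qed

text \<open>Every z is the image of some Z, so the traced condition says that the sum is orthogonal
  to all z; nondegeneracy then removes the test vector.\<close>

lemma cosymplectic_germ:
  assumes "transversely_cosymplectic S"
  shows "(\<Sum>a<DIM('q). germ.nabla_K (Df F y0 (normal_frame S x a)) (Df F y0 (normal_frame S x a))
    + germ.nabla_K (Kc q0 (Df F y0 (normal_frame S x a))) (Kc q0 (Df F y0 (normal_frame S x a)))) = 0" (is "?s = 0")
proof (rule germ.nondegenerate)
  fix z
  obtain Z where Z: "Df F y0 Z = z" using DF_surj by (metis surjD)
  have "normal_trace S x (\<lambda>X Y. D2_fundamental S x X Y Z) = 0"
    using assms x_top unfolding transversely_cosymplectic_def by blast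
  then have "complex_of_real (g q0 ?s z / 2) = 0"
    unfolding normal_trace_def D2_germ Z germ.g_sum_left by (simp only: of_real_sum sum_divide_distrib)
  then have "g q0 ?s z / 2 = 0" by (simp only: of_real_eq_0_iff)
  then show "g q0 ?s z = g q0 0 z" by (simp add: germ.g_simps(7))
qed

lemma symplectic_germ:
  assumes "transversely_12_symplectic S"
  shows "germ.nabla_K \<xi> \<xi> + germ.nabla_K (Kc q0 \<xi>) (Kc q0 \<xi>) = 0" (is "?s = 0")
proof (rule germ.nondegenerate)
  fix z
  obtain Z X where Z: "Df F y0 Z = z" "Df F y0 X = \<xi>" using DF_surj by (metis surjD)
  have "D2_fundamental S x X X Z = 0"
    using assms x_top unfolding transversely_12_symplectic_def by blast
  then have "complex_of_real (g q0 ?s z / 2) = 0" unfolding D2_germ Z .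
  then have "g q0 ?s z / 2 = 0" by (simp only: of_real_eq_0_iff)
  then show "g q0 ?s z = g q0 0 z" by (simp add: germ.g_simps(7))
qed

end

section \<open>The theorem\<close>

lemma hermitian_foliation_point_exists:
  assumes S: "transversely_almost_hermitian S" and x: "x \<in> topspace (mtop S)"
  obtains U W K where "hermitian_foliation_point S x U W (submersion_at S x) K"
proof -
  have fol: "foliated_riemannian S" and J: "foliated_endo S (acs S)"
    using S unfolding transversely_almost_hermitian_def by simp_all
  obtain U where U: "(U, submersion_at S x) \<in> cocycle S" "x \<in> U" by (rule submersion_at[OF fol x])
  from bspec[OF J[unfolded foliated_endo_def] U(1)] U(2)
  obtain W K where "openin (mtop S) W \<and> x \<in> W \<and> W \<subseteq> U \<and>
     smooth_endo_field (model S) (submersion_at S x ` W) K \<and>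
     (\<forall>p\<in>W. \<forall>v. tangent_map S (model S) (submersion_at S x) p (acs S p v) =
        K (submersion_at S x p) (tangent_map S (model S) (submersion_at S x) p v))"
    by auto
  with S U(1) have "hermitian_foliation_point S x U W (submersion_at S x) K"
    by (intro hermitian_foliation_point.intro) simp_all
  then show thesis by (rule that)
qed

theorem theorem5p5:
  fixes M :: "('a, 'e::euclidean_space, 't, 'q::euclidean_space) trans_hermitian"
    and M' :: "('b, 'f::euclidean_space, 's, 'r::euclidean_space) trans_hermitian"
    and \<phi> :: "'a \<Rightarrow> 'b"
  assumes "transversely_almost_hermitian M"
    and "transversely_almost_hermitian M'"
    and "transversely_cosymplectic M"
    and "transversely_12_symplectic M'"
    and "transversely_holomorphic M M' \<phi>"
  shows "transversely_harmonic M M' \<phi>"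
  unfolding transversely_harmonic_def
proof
  fix x assume x: "x \<in> topspace (mtop M)"
  have \<phi>: "smooth_map M M' (topspace (mtop M)) \<phi>"
    and leaf: "\<And>p. p \<in> topspace (mtop M) \<Longrightarrow> \<phi> ` leaf M p \<subseteq> leaf M' (\<phi> p)"
    and hol: "\<And>p v. p \<in> topspace (mtop M) \<Longrightarrow>
        normal_class M' (\<phi> p) (tangent_map M M' \<phi> p (acs M p v)) =
        normal_class M' (\<phi> p) (acs M' (\<phi> p) (tangent_map M M' \<phi> p v))"
    using assms(5) unfolding transversely_holomorphic_def foliated_map_def by simp_all
  obtain U W f K where "hermitian_foliation_point M x U W f K"
    using hermitian_foliation_point_exists[OF assms(1) x] .
  then interpret P: hermitian_foliation_point M x U W f K .
  have "smooth_manifold M'"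
    using assms(2) foliated_riemannianD(3) unfolding transversely_almost_hermitian_def by blast
  then have C2\<phi>: "C2_map M M' (topspace (mtop M)) \<phi>" by (rule smooth_map_C2[OF P.M _ \<phi>])
  obtain U' W' f' K' where "hermitian_foliation_point M' (\<phi> x) U' W' f' K'"
    using hermitian_foliation_point_exists[OF assms(2) C2_mapD(2)[OF C2\<phi> x]] .
  then interpret P': hermitian_foliation_point M' "\<phi> x" U' W' f' K' .
  define h where "h p = f' (\<phi> p)" for p
  define V where "V = topspace (mtop M) \<inter> \<phi> -` U'"
  have h: "C2_map M P'.T V h" unfolding V_def h_def by (rule C2_map_comp[OF P.M P'.M C2\<phi> P'.C2f])
  define H where "H = rep P.C P'.B h"
  have xV: "x \<in> V" unfolding V_def using x P'.xU by simp
  \<comment> \<open>On \<open>O'\<close> all chart formulas hold at once: J descends on source and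
    target, and f and h take values in the charts \<open>P.B\<close> and
    \<open>P'.B\<close>.\<close>
  define O' where "O' = P.G \<inter> (topspace (mtop M) \<inter> \<phi> -` W') \<inter> (V \<inter> h -` fst P'.B)"
  have O': "openin (mtop M) O'" "x \<in> O'"
    unfolding O'_def h_def using P.G C2_mapD(3)[OF C2\<phi> P'.W(1)] C2_mapD(3)[OF h chart_openin[OF P'.N P'.B(1)]]
      x P'.W(2) xV P'.B(2) by (auto simp: h_def[abs_def])
  have O'D: "p \<in> P.G" "p \<in> W" "p \<in> U" "f p \<in> fst P.B" "p \<in> topspace (mtop M)" "\<phi> p \<in> W'" "\<phi> p \<in> U'" "p \<in> V"
    "h p \<in> fst P'.B" if "p \<in> O'" for p
    using that P.W(3) unfolding O'_def P.G_def V_def by auto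
  have tm_h: "tangent_map M P'.T h p v = P'.Tf (\<phi> p) (tangent_map M M' \<phi> p v)" if "p \<in> V" for p v
    using that tangent_map_comp[OF P.M P'.M P'.N C2\<phi> _ P'.C2f, of p v] unfolding V_def h_def by simp
  have DH: "Df H (snd P.C p) u = chart_deriv P'.T P'.B (h p) (tangent_map M P'.T h p (chart_lift M P.C (snd P.C p) u))"
    if p: "p \<in> O'" "p \<in> fst P.C" for p u
    using chart_deriv_tangent_map[OF P.M P'.N h O'D(8)[OF p(1)] P.C(1) p(2) P'.B(1) O'D(9)[OF p(1)]]
    unfolding tang_def H_def by simp
  have H_chart: "H (snd P.C p) = snd P'.B (h p)" if "p \<in> fst P.C" for p
    unfolding H_def by (rule rep_at[OF P.M P.C(1) that])
  have Bh: "h x \<in> fst P'.B" using P'.B(2) unfolding h_def .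
  have H2: "twice_differentiable_at H P.y0" "H P.y0 = P'.q0"
    unfolding P.y0_def H_chart[OF P.C(2)] P'.q0_def
    using C2_mapD(4)[OF h xV P.C(1) P'.B(1) P.C(2) Bh, folded H_def] by (simp_all add: h_def)
  have dF: "P.F differentiable at (snd P.C p)" and dH: "H differentiable at (snd P.C p)"
    if p: "p \<in> O'" "p \<in> fst P.C" for p
    using C2_map_differentiable[OF P.C2f O'D(3)[OF p(1)] P.C(1) P.B(1) p(2) O'D(4)[OF p(1)]]
      C2_map_differentiable[OF h O'D(8)[OF p(1)] P.C(1) P'.B(1) p(2) O'D(9)[OF p(1)]]
    by (simp_all add: P.F_def H_def)
  have ker: "\<forall>\<^sub>F y in nhds P.y0. \<forall>w. Df P.F y w = 0 \<longrightarrow> Df H y w = 0"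
    unfolding P.y0_def
  proof (rule eventually_chart[OF P.M P.C O'], intro allI impI)
    fix p w assume p: "p \<in> O'" "p \<in> fst P.C" and w: "Df P.F (snd P.C p) w = 0"
    let ?W = "snd P.C ` (O' \<inter> fst P.C)"
    show "Df H (snd P.C p) w = 0"
    proof (rule kernel_inclusion_of_countable_fibre_image[of ?W])
      show "open ?W" by (rule chart_open_image[OF P.M P.C(1) O'(1)])
      show "snd P.C p \<in> ?W" using p by blast
      show "continuous_on ?W P.F" "continuous_on ?W H"
        using dF dH by (auto intro!: continuous_at_imp_continuous_on differentiable_imp_continuous_within)
      show "P.F differentiable at (snd P.C p)" "H differentiable at (snd P.C p)" using dF[OF p] dH[OF p] .
      show "surj (Df P.F (snd P.C p))"
      proof (rule surjI)
        fix u
        have "P.Tf p (inv (P.Tf p) v) = v" for v by (rule surj_f_inv_f[OF P.Tf_surj[OF O'D(3)[OF p(1)]]])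
        then show "Df P.F (snd P.C p) (chart_deriv M P.C p (inv (P.Tf p) (chart_lift P.T P.B (snd P.B (f p)) u))) = u"
          unfolding P.DF_chart[OF O'D(1)[OF p(1)] p(2)]
          by (simp only: chart_deriv_lift[OF P.M P.C(1) p(2)] chart_deriv_lift[OF P.N P.B(1) O'D(4)[OF p(1)]])
      qed
      show "Df P.F (snd P.C p) w = 0" by (rule w)
      have "H ` {z \<in> ?W. P.F z = P.F (snd P.C p)} \<subseteq> snd P'.B ` (f' ` (leaf M' (\<phi> p) \<inter> U'))"
      proof
        fix c assume "c \<in> H ` {z \<in> ?W. P.F z = P.F (snd P.C p)}"
        then obtain p' where p': "p' \<in> O'" "p' \<in> fst P.C" "P.F (snd P.C p') = P.F (snd P.C p)" "c = H (snd P.C p')"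
          by auto
        have "snd P.B (f p') = snd P.B (f p)" using p'(3) unfolding P.F_chart[OF p'(2)] P.F_chart[OF p(2)] .
        then have "f p = f p'"
          using inj_onD[OF chart_inj[OF P.N P.B(1)] _ O'D(4)[OF p'(1)] O'D(4)[OF p(1)]] by simp
        then have "(p, p') \<in> same_plaque M"
          unfolding same_plaque_def using P.Uf O'D(3)[OF p(1)] O'D(3)[OF p'(1)] by auto
        then have "p' \<in> leaf M p" unfolding leaf_def by auto
        then have "\<phi> p' \<in> leaf M' (\<phi> p)" using leaf[OF O'D(5)[OF p(1)]] by blast
        moreover have "\<phi> p' \<in> U'" by (rule O'D(7)[OF p'(1)])
        moreover have "c = snd P'.B (f' (\<phi> p'))" unfolding p'(4) H_chart[OF p'(2)] h_def ..
        ultimately show "c \<in> snd P'.B ` (f' ` (leaf M' (\<phi> p) \<inter> U'))" by blast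
      qed
      then show "countable (H ` {z \<in> ?W. P.F z = P.F (snd P.C p)})"
        by (rule countable_subset) (intro countable_image countable_leaf_plaques[OF P'.fol P'.Uf])
    qed
  qed
  have hol': "\<forall>\<^sub>F y in nhds P.y0. \<forall>v. \<exists>w. Df P.F y w = P.Kc (P.F y) (Df P.F y v) \<and> Df H y w = P'.Kc (H y) (Df H y v)"
    unfolding P.y0_def
  proof (rule eventually_chart[OF P.M P.C O'], rule allI)
    fix p v assume p: "p \<in> O'" "p \<in> fst P.C"
    let ?l = "chart_lift M P.C (snd P.C p) v"
    \<comment> \<open>One witness serves both equations: the components of J applied to the vector
      with components v. The equation for \<open>P.F\<close> holds because J descends, the one for
      \<open>H\<close> by holomorphy.\<close>
    let ?w = "chart_deriv M P.C p (acs M p ?l)"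
    note pO = O'D[OF p(1)]
    have "Df P.F (snd P.C p) ?w = P.Kc (P.F (snd P.C p)) (Df P.F (snd P.C p) v)"
      unfolding P.DF_chart[OF pO(1) p(2)] chart_deriv_lift[OF P.M P.C(1) p(2)] P.Tf_acs[OF pO(2)]
        P.F_chart[OF p(2)] P.Kc_def endo_in_chart_deriv[OF P.N P.B(1) pO(4)] ..
    moreover have "P'.Tf (\<phi> p) (tangent_map M M' \<phi> p (acs M p ?l)) = K' (f' (\<phi> p)) (P'.Tf (\<phi> p) (tangent_map M M' \<phi> p ?l))"
      using hol[OF pO(5), of ?l] unfolding P'.normal_class_Tf[OF pO(7)] P'.Tf_acs[OF pO(6)] .
    then have "Df H (snd P.C p) ?w = P'.Kc (H (snd P.C p)) (Df H (snd P.C p) v)"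
      unfolding DH[OF p] chart_deriv_lift[OF P.M P.C(1) p(2)] tm_h[OF pO(8)]
        H_chart[OF p(2)] P'.Kc_def endo_in_chart_deriv[OF P'.N P'.B(1) pO(9)] by (simp add: h_def)
    ultimately show "\<exists>w. Df P.F (snd P.C p) w = P.Kc (P.F (snd P.C p)) (Df P.F (snd P.C p) v)
       \<and> Df H (snd P.C p) w = P'.Kc (H (snd P.C p)) (Df H (snd P.C p) v)" by blast
  qed
  define N where "N X Y = normal_conn M (const_ext M x Y) x X" for X Y
  let ?L' = "P'.Tf (\<phi> x)"
  have DHx: "?L' (tangent_map M M' \<phi> x v) = Df H P.y0 v" for v
    unfolding tm_h[OF xV, symmetric] unfolding tangent_map_tang tang_def H_def P.y0_def P.C_def P'.B_def h_def ..
  have conn: "?L' (normal_conn_along M M' \<phi> (\<lambda>p. tangent_map M M' \<phi> p (const_ext M x Y p)) x X)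
      = D2f H P.y0 X Y + P'.\<Gamma> (Df H P.y0 X) (Df H P.y0 Y)" for X Y
    unfolding H_def P.y0_def P.C_def P'.B_def P'.\<Gamma>_def P'.q0_def P'.T_def h_def[abs_def]
  proof (rule normal_conn_along_eq[OF P.M P'.fol P'.Uf P'.xU P'.f C2\<phi> x])
    fix p assume "p \<in> topspace (mtop M)" "\<phi> p \<in> U'"
    then have "p \<in> V" unfolding V_def by simp
    from tm_h[OF this] show "tangent_map M' (model M') f' (\<phi> p) (tangent_map M M' \<phi> p (const_ext M x Y p)) =
        tangent_map M (model M') (\<lambda>p. f' (\<phi> p)) p (const_ext M x Y p)"
      unfolding P'.T_def h_def[abs_def] by simp
  qed
  note lin = P'.Tf_linear[OF P'.xU]
  \<comment> \<open>The class of the tension is tested by \<open>?L'\<close>, which is linear and so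
    commutes with the sum over the frame; this brings the selected representatives of the
    connections into their chart form.\<close>
  have "?L' (transverse_tension M M' \<phi> x) = (\<Sum>a<DIM('q).
      D2f H P.y0 (normal_frame M x a) (normal_frame M x a)
      + P'.\<Gamma> (Df H P.y0 (normal_frame M x a)) (Df H P.y0 (normal_frame M x a))
      - Df H P.y0 (N (normal_frame M x a) (normal_frame M x a)))"
    unfolding transverse_tension_def normal_trace_def nabla_induced_def linear_sum[OF lin] linear_diff[OF lin]
      conn DHx N_def ..
  also have "\<dots> = 0"
    by (rule holomorphic_trace_zero[OF P.germ.hermitian_germ_axioms P'.germ.hermitian_germ_axioms P.F_twice P.F_y0 H2
        P.DF_surj ker hol' _ P.frame_orthonormal P.cosymplectic_germ[OF assms(3)] P'.symplectic_germ[OF assms(4)]])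
      (simp add: N_def P.normal_conn_DF)
  also have "\<dots> = ?L' 0" using linear_0[OF lin] by simp
  finally show "normal_class M' (\<phi> x) (transverse_tension M M' \<phi> x) = normal_class M' (\<phi> x) 0"
    unfolding P'.normal_class_Tf[OF P'.xU] .
qed

end
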